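(* Let $n,d$ be coprime positive integers, $a\ge 0$ real, $p=\sqrt q$ with $q\in\mathbb R$, and let $\alpha=CH(n,d,a)$ be a cyclic-harmonic curve lying in a plane of $\mathbb E^3$ that does not contain the axis $z$. Let $O$ denote its $2n$-fold (or $n$-fold, if $a=0$ and $n\cdot d$ is odd) point, i.e. the pole of its polar equation, and denote its other real $j$-fold points by $D^j$. Let $\mathcal{CS}(\alpha,p)$ be the corresponding generalized rose surface. "Case A" means that $a=0$ and $n\cdot d$ is odd; "Case B" means all other cases (i.e. $a\ne0$ or $n\cdot d$ even). Below, $(o;\,c;\,\zeta;\,\pi)$ means: the surface $\mathcal{CS}(\alpha,p)$ has order $o$, the absolute conic has multiplicity $c$ on it, the axis $z$ has multiplicity $\zeta$ on it, and the points $P_1,P_2$ have multiplicity $\pi$ on it. Then: Type 1 ($O=P_1$ or $O=P_2$): - Case A, $d<n$: $(n+d;\ d;\ n-d;\ n)$. - Case A, $d>n$: $(2d;\ d;\ 0;\ d)$. - Case B, $d<n$: $(2(n+d);\ 2d;\ 2(n-d);\ 2n)$. - Case B, $d>n$: $(4d;\ 2d;\ 0;\ 2d)$. Type 2 ($O\in z$, $O\ne P_i$ for $i=1,2$): - Case A, $d<n$: $(2n+d;\ d;\ 2n-d;\ 2n)$. - Case A, $d>n$: $(n+2d;\ d;\ n;\ n+d)$. - Case B, $d<n$: $(2(2n+d);\ 2d;\ 2(2n-d);\ 4n)$. - Case B, $d>n$: $(2(n+2d);\ 2d;\ 2n;\ 2(n+d))$. Type 3 ($D^j=P_1$ or $D^j=P_2$):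 - Case A, $d<n$: $(3n+d-2j;\ n+d-j;\ n-d;\ 2n-j)$. - Case A, $d>n$: $(2(n+d)-2j;\ n+d-j;\ 0;\ n+d-j)$. - Case B, $d<n$: $(2(3n+d)-2j;\ 2(n+d)-j;\ 2(n-d);\ 4n-j)$. - Case B, $d>n$: $(4(n+d)-2j;\ 2(n+d)-j;\ 0;\ 2(n+d)-j)$. Type 4 ($D^j\in z$, $D^j\neq P_i$ for $i=1,2$): - Case A, $d<n$: $(3n+d-j;\ n+d-j;\ n-d+j;\ 2n)$. - Case A, $d>n$: $(2(n+d)-j;\ n+d-j;\ j;\ n+d)$. - Case B, $d<n$: $(2(3n+d)-j;\ 2(n+d)-j;\ 2(n-d)+j;\ 4n)$. - Case B, $d>n$: $(4(n+d)-j;\ 2(n+d)-j;\ j;\ 2(n+d))$. Type 5 (no point of the axis $z$ lies on $CH(n,d,a)$): - Case A, $d<n$: $(3n+d;\ n+d;\ n-d;\ 2n)$. - Case A, $d>n$: $(2(n+d);\ n+d;\ 0;\ n+d)$. - Case B, $d<n$: $(2(3n+d);\ 2(n+d);\ 2(n-d);\ 4n)$. - Case B, $d>n$: $(4(n+d);\ 2(n+d);\ 0;\ 2(n+d))$.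
   Context: Cyclic-harmonic curve: for $\frac nd$ a positive rational number in lowest terms and $a\ge0$, $CH(n,d,a)$ is the curve with polar equation $r(\varphi)=\cos\frac nd\varphi+a$, $\varphi\in[0,2d\pi]$ (in polar coordinates of the plane in which it lies, with an arbitrary choice of pole $O$ and polar axis in that plane), regarded as the algebraic plane curve given by its implicit polynomial equation, i.e. the smallest algebraic curve containing this locus. In particular the pole $O$ belongs to the algebraic curve, possibly as an isolated real point. A $j$-fold point is a point of multiplicity $j$ on the algebraic curve; $j=1$ (regular points) is allowed for $D^j$. Congruence of circles $\mathcal C(p)$: let $p=\sqrt q$, $q\in\mathbb R$, and let $P_1,P_2$ be the points $(0,0,\pm p)$ on the axis $z$ of Euclidean space $\mathbb E^3$. $\mathcal C(p)$ consists of all circles passing through $P_1$ and $P_2$. It is called elliptic if $q>0$ ($P_1,P_2$ real and different), parabolic if $q=0$ ($P_1=P_2$, and the circles are those tangent to the axis $z$ at this point), and hyperbolic if $q<0$ ($P_1,P_2$ imaginary). In a plane through $z$ with Cartesian coordinates $(\rho,z)$, the circles of $\mathcal C(p)$ are those of the form $\rho^2+z^2-2c\rho-p^2=0$. For every point $A\notin z$ there is a unique circle $c^A(p)\in\mathcal C(p)$ passing through $A,P_1,P_2$; for a point at infinity $A^\infty\notin z$, the circle $c^{A^\infty}(p)$ splits into the axis $z$ and the line at infinity of the plane through $z$ and $A^\infty$. Circular surface: for a curve $\alpha$, $\mathcal{CS}(\alpha,p)$ is the system of circles from $\mathcal C(p)$ that intersect $\alpha$, regarded as an algebraic surface in the (complexified)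 projective closure of $\mathbb E^3$. A generalized rose surface is a circular surface $\mathcal{CS}(\alpha,p)$ for which $\alpha$ is a curve $CH(n,d,a)$ lying in a plane that does not contain the axis $z$. The absolute conic is the conic $x_0=0$, $x_1^2+x_2^2+x_3^2=0$ in homogeneous coordinates $(x_0:x_1:x_2:x_3)$ with $x=x_1/x_0$, $y=x_2/x_0$, $z=x_3/x_0$. The order of a surface is its degree, and the multiplicity of a curve on a surface is the multiplicity of the surface at a generic point of that curve; multiplicity $0$ means that the curve is not contained in the surface.
   Formalization: The surface is counted with multiplicity: its reduced equation is raised to the number of points off the axis z in which a generic circle of the system meets the curve (usually 1). For special symmetric positions the stated numbers fail for the reduced surface. *)

theory Defs
  imports
    "HOL-Analysis.Analysis"
    "HOL-Computational_Algebra.Polynomial"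
    "HOL-Library.Poly_Mapping"
begin

section \<open>Polynomials in several variables and algebraic hypersurfaces\<close>

text \<open>
  Finitely supported maps from exponent vectors to coefficients form, with the convolution
  product of \<^theory>\<open>HOL-Library.Poly_Mapping\<close>, the polynomial ring over the complex
  numbers in the variables indexed by the finite type \<^typ>\<open>'n\<close>.
\<close>

type_synonym 'n cpoly = "('n \<Rightarrow>\<^sub>0 nat) \<Rightarrow>\<^sub>0 complex"

definition eval_cpoly :: "('n::finite) cpoly \<Rightarrow> complex^'n \<Rightarrow> complex" where
  "eval_cpoly F x =
    (\<Sum>m\<in>Poly_Mapping.keys F. Poly_Mapping.lookup F m * (\<Prod>i\<in>UNIV. x $ i ^ Poly_Mapping.lookup m i))"

definition total_degree :: "('n::finite) cpoly \<Rightarrow> nat" where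
  "total_degree F = (MAX m\<in>Poly_Mapping.keys F. \<Sum>i\<in>UNIV. Poly_Mapping.lookup m i)"

text \<open>The univariate polynomial \<open>F (x + T w)\<close> in the indeterminate \<open>T\<close>.\<close>

definition restrict_line :: "('n::finite) cpoly \<Rightarrow> complex^'n \<Rightarrow> complex^'n \<Rightarrow> complex poly" where
  "restrict_line F x w =
    (\<Sum>m\<in>Poly_Mapping.keys F.
      [:Poly_Mapping.lookup F m:] * (\<Prod>i\<in>UNIV. [:x $ i, w $ i:] ^ Poly_Mapping.lookup m i))"

text \<open>
  The multiplicity of the hypersurface \<open>F = 0\<close> at \<open>x\<close> is its intersection multiplicity at \<open>x\<close>
  with a generic line through \<open>x\<close>, which is the smallest one that occurs. If \<open>F\<close> is
  homogeneous and \<open>x\<close> is a vector of homogeneous coordinates, this is the multiplicity of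
  the projective hypersurface at the corresponding point. It is \<open>0\<close> iff \<open>F\<close> does not
  vanish at \<open>x\<close>.
\<close>

definition mult_at :: "('n::finite) cpoly \<Rightarrow> complex^'n \<Rightarrow> nat" where
  "mult_at F x = (INF w\<in>{w. restrict_line F x w \<noteq> 0}. order 0 (restrict_line F x w))"

text \<open>
  A reduced equation of the smallest algebraic hypersurface containing a set of points: a
  generator of the ideal of all polynomials vanishing on the set. It is unique up to a nonzero
  constant factor, on which none of the notions below depends.
\<close>

definition implicit_poly :: "(complex^'n) set \<Rightarrow> ('n::finite) cpoly" where
  "implicit_poly X = (SOME F. F \<noteq> 0 \<and> (\<forall>G. F dvd G \<longleftrightarrow> (\<forall>x\<in>X. eval_cpoly G x = 0)))"

definition cvec :: "real^'n \<Rightarrow> complex^('n::finite)" where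
  "cvec x = (\<chi> i. complex_of_real (x $ i))"


section \<open>Homogeneous coordinates in space\<close>

text \<open>
  The components \<open>v $ 1, v $ 2, v $ 3, v $ 4\<close> of a vector of homogeneous coordinates are
  \<open>x\<^sub>0, x\<^sub>1, x\<^sub>2, x\<^sub>3\<close>.
\<close>

definition homog :: "complex^3 \<Rightarrow> complex^4" where
  "homog x = vector [1, x $ 1, x $ 2, x $ 3]"

text \<open>
  The polynomials vanishing on the cone over \<open>X\<close> form the homogeneous ideal of the projective
  closure of \<open>X\<close>.
\<close>

definition cone_over :: "(complex^3) set \<Rightarrow> (complex^4) set" where
  "cone_over X = {c *s homog x | c x. x \<in> X}"

definition proj_point :: "complex^4 \<Rightarrow> (complex^4) set" where
  "proj_point v = {c *s v | c. c \<noteq> 0}"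

text \<open>
  Multiplicity of a projective curve, given by the cone \<open>K\<close> of its homogeneous coordinate
  vectors, on a surface: the multiplicity of all but finitely many points of the curve.
\<close>

definition mult_along :: "4 cpoly \<Rightarrow> (complex^4) set \<Rightarrow> nat" where
  "mult_along G K = (THE k. finite (proj_point ` {v\<in>K. v \<noteq> 0 \<and> mult_at G v \<noteq> k}))"

definition absolute_conic :: "(complex^4) set" where
  "absolute_conic = {v. v $ 1 = 0 \<and> (v $ 2)\<^sup>2 + (v $ 3)\<^sup>2 + (v $ 4)\<^sup>2 = 0}"

definition proj_z_axis :: "(complex^4) set" where
  "proj_z_axis = {v. v $ 2 = 0 \<and> v $ 3 = 0}"

definition z_axis :: "(complex^3) set" where
  "z_axis = {x. x $ 1 = 0 \<and> x $ 2 = 0}"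


section \<open>Circular surfaces\<close>

definition base_point1 :: "complex \<Rightarrow> complex^3" where
  "base_point1 p = vector [0, 0, p]"

definition base_point2 :: "complex \<Rightarrow> complex^3" where
  "base_point2 p = vector [0, 0, - p]"

text \<open>
  The circle \<open>\<rho>\<^sup>2 + z\<^sup>2 - 2c\<rho> - p\<^sup>2 = 0\<close> in the plane through the axis \<open>z\<close> and the horizontal
  unit vector \<open>e\<close>.
\<close>

definition circle_in :: "complex^2 \<Rightarrow> complex \<Rightarrow> complex \<Rightarrow> (complex^3) set" where
  "circle_in e c p =
    {vector [\<rho> * e $ 1, \<rho> * e $ 2, z] | \<rho> z. \<rho>\<^sup>2 + z\<^sup>2 - 2 * c * \<rho> - p\<^sup>2 = 0}"

definition congruence :: "complex \<Rightarrow> (complex^3) set set" where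
  "congruence p = {circle_in e c p | e c. (e $ 1)\<^sup>2 + (e $ 2)\<^sup>2 = 1}"

text \<open>
  The circles through the points of \<open>\<alpha>\<close>. Only points off the axis count: they determine the
  circle, whereas through \<open>P\<^sub>1\<close> and \<open>P\<^sub>2\<close> pass all circles of the congruence.
\<close>

definition circle_system :: "(complex^3) set \<Rightarrow> complex \<Rightarrow> (complex^3) set set" where
  "circle_system \<alpha> p = {C \<in> congruence p. \<exists>A\<in>\<alpha>. A \<notin> z_axis \<and> A \<in> C}"

text \<open>The number of points off the axis in which a generic circle of the system meets \<open>\<alpha>\<close>.\<close>

definition circle_count :: "(complex^3) set \<Rightarrow> complex \<Rightarrow> nat" where
  "circle_count \<alpha> p = (THE k. finite {C \<in> circle_system \<alpha> p. card ((\<alpha> - z_axis) \<inter> C) \<noteq> k})"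

text \<open>
  The homogeneous equation of the circular surface. The surface is traced by the circle
  through \<open>A\<close> as \<open>A\<close> runs over \<open>\<alpha>\<close>, and a circle counts as often as it is traced. For most
  positions of a plane curve \<open>\<alpha>\<close> the exponent is \<open>1\<close>, and the equation is the reduced one.
  The exponent is \<open>2\<close> if, for example, \<open>\<alpha>\<close> lies in a plane parallel to the axis and is
  symmetric with respect to the plane \<open>z = 0\<close>: every circle of the system then meets \<open>\<alpha>\<close> in
  pairs of symmetric points.
\<close>

definition circular_surface :: "(complex^3) set \<Rightarrow> complex \<Rightarrow> 4 cpoly" where
  "circular_surface \<alpha> p =
    implicit_poly (cone_over (\<Union> (circle_system \<alpha> p))) ^ circle_count \<alpha> p"

text \<open>Order, and multiplicities of the absolute conic, of the axis \<open>z\<close> and of the points \<open>P\<^sub>i\<close>.\<close>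

definition has_characters ::
  "4 cpoly \<Rightarrow> complex \<Rightarrow> int \<Rightarrow> int \<Rightarrow> int \<Rightarrow> int \<Rightarrow> bool" where
  "has_characters G p deg cm zm pm \<longleftrightarrow>
    int (total_degree G) = deg \<and>
    int (mult_along G absolute_conic) = cm \<and>
    int (mult_along G proj_z_axis) = zm \<and>
    int (mult_at G (homog (base_point1 p))) = pm \<and>
    int (mult_at G (homog (base_point2 p))) = pm"


section \<open>Cyclic-harmonic curves and generalized rose surfaces\<close>

definition CH_locus :: "nat \<Rightarrow> nat \<Rightarrow> real \<Rightarrow> (real^2) set" where
  "CH_locus n d a =
    (\<lambda>\<phi>. (cos (real n / real d * \<phi>) + a) *s vector [cos \<phi>, sin \<phi>]) ` {0..2 * real d * pi}"

definition CH_poly :: "nat \<Rightarrow> nat \<Rightarrow> real \<Rightarrow> 2 cpoly" where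
  "CH_poly n d a = implicit_poly (cvec ` CH_locus n d a)"

definition CH :: "nat \<Rightarrow> nat \<Rightarrow> real \<Rightarrow> (complex^2) set" where
  "CH n d a = {A. eval_cpoly (CH_poly n d a) A = 0}"

text \<open>
  The (complexified) plane with pole \<open>b\<close>, polar axis in the direction \<open>u\<close>, and \<open>u, v\<close> as an
  orthonormal basis of directions.
\<close>

definition place :: "real^3 \<Rightarrow> real^3 \<Rightarrow> real^3 \<Rightarrow> complex^2 \<Rightarrow> complex^3" where
  "place b u v A = cvec b + A $ 1 *s cvec u + A $ 2 *s cvec v"

definition rose_curve ::
  "nat \<Rightarrow> nat \<Rightarrow> real \<Rightarrow> real^3 \<Rightarrow> real^3 \<Rightarrow> real^3 \<Rightarrow> (complex^3) set" where
  "rose_curve n d a b u v = place b u v ` CH n d a"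

text \<open>A real \<open>j\<close>-fold point of the curve other than the pole, in the coordinates of its plane.\<close>

definition real_fold_point :: "nat \<Rightarrow> nat \<Rightarrow> real \<Rightarrow> nat \<Rightarrow> real^2 \<Rightarrow> bool" where
  "real_fold_point n d a j D \<longleftrightarrow> D \<noteq> 0 \<and> 1 \<le> j \<and> mult_at (CH_poly n d a) (cvec D) = j"

definition case_A :: "nat \<Rightarrow> nat \<Rightarrow> real \<Rightarrow> bool" where
  "case_A n d a \<longleftrightarrow> a = 0 \<and> odd (n * d)"


end

theory Submission
  imports Defs
    "HOL-Computational_Algebra.Polynomial_Factorial"
    "HOL-Computational_Algebra.Field_as_Ring"
    "HOL-Computational_Algebra.Fundamental_Theorem_Algebra"
begin

text \<open>
  The circles of the congruence are the fibres of \<open>(x, y, z) \<mapsto> (x : y : x\<^sup>2 + y\<^sup>2 + z\<^sup>2 - q)\<close>, so the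
  surface is the pullback of a rational plane curve \<open>\<Gamma>\<close>, the image of \<open>\<alpha>\<close>. If \<open>g\<close> is the equation
  of \<open>\<Gamma>\<close>, of degree \<open>m\<close> and of degree \<open>L\<close> in its last variable, the surface has the equation
  \<open>g (x\<^sub>0 x\<^sub>1, x\<^sub>0 x\<^sub>2, x\<^sub>1\<^sup>2 + x\<^sub>2\<^sup>2 + x\<^sub>3\<^sup>2 - q x\<^sub>0\<^sup>2) / x\<^sub>0\<^sup>m\<^sup>-\<^sup>L\<close>, from which order \<open>m + L\<close> and multiplicities
  \<open>L\<close>, \<open>m - L\<close>, \<open>m\<close> are read off. Both \<open>L\<close> and \<open>m\<close>, times the number \<open>e\<close> of parameters of a
  generic point, are degrees of projections of \<open>\<Gamma>\<close> in the rational parameter \<open>w = exp (i \<phi> / d)\<close>,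
  and so are computed from degrees and common zeros of the parametrizing polynomials. The same
  count for \<open>\<alpha>\<close> shows that the common zeros over a point \<open>D\<close> of the curve number its
  multiplicity (times two in Case A, where \<open>w\<close> and \<open>-w\<close> give the same point).
\<close>

section \<open>Polynomials in two variables\<close>

text \<open>No resultants are used: an equation of the image curve is found by counting coefficients
  against conditions. Each point of the curve supplies \<open>e\<close> zeros of the pullback, so
  the degree in a coordinate comes out as the degree of a projection divided by \<open>e\<close>.
  This also explains the exponent \<open>circle_count\<close> in \<open>circular_surface\<close>: a
  generic circle carries \<open>e\<close> parameters, hence \<open>e\<close> /
  \<open>branches\<close> points of \<alpha>, and the exponent cancels the division by
  \<open>e\<close>. The characters therefore do not depend on whether circles are traced repeatedly.
  The alternative d < n or d > n comes from w = 0 and w = infinity, the ends of \<alpha> at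
  infinity. There x and y have poles of order n + d, but the curve leaves in isotropic directions,
  so that x^2 + y^2 = r^2 has poles of order 2 n only; the larger of n + d and 2 n is the number
  \<open>K\<close>, and 2 \<open>K\<close> is the degree of the parametrization of the image curve.
  Since the isotropic directions are not real, a nonzero real linear form in x and y keeps its full
  pole at both ends.\<close>

lemma MOST_complex_ex: "(MOST x::complex. P x) \<Longrightarrow> \<exists>x. P x"
  using MOST_INFM[of P] INFM_EX[of P] by (simp add: infinite_UNIV_char_0)

lemma MOST_poly_nonzero: "p \<noteq> 0 \<Longrightarrow> MOST t. poly p t \<noteq> (0::complex)"
  by (simp add: eventually_cofinite poly_roots_finite)

lemma poly_eqI_MOST: "(MOST t. poly p t = poly q (t::complex)) \<Longrightarrow> p = q"
proof (rule ccontr)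
  assume *: "MOST t. poly p t = poly q t" "p \<noteq> q"
  then have "MOST t. poly (p - q) t \<noteq> 0" by (intro MOST_poly_nonzero) simp
  with *(1) have "MOST t::complex. False" by eventually_elim simp
  then show False by (simp add: infinite_UNIV_char_0)
qed

lemma coprime_no_common_root:
  fixes p q :: "complex poly"
  assumes "coprime p q" "poly p t = 0" "poly q t = 0"
  shows False
proof -
  have "[:-t, 1:] dvd p" "[:-t, 1:] dvd q" using assms by (simp_all add: poly_eq_0_iff_dvd)
  then have "is_unit [:-t, 1:]" using assms(1) coprime_common_divisor by blast
  then show False by (simp add: is_unit_poly_iff)
qed

lemma card_roots_le_degree: "p \<noteq> 0 \<Longrightarrow> card {t. poly p t = (0::complex)} \<le> degree p"
  using card_poly_roots_bound[of p] by simp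

lemma card_roots_eq_degree:
  fixes p :: "complex poly"
  assumes "p \<noteq> 0" "\<And>t. poly p t = 0 \<Longrightarrow> poly (pderiv p) t \<noteq> 0"
  shows "card {t. poly p t = 0} = degree p"
proof -
  have "rsquarefree p" using assms by (auto simp: rsquarefree_roots)
  from complex_poly_decompose_rsquarefree[OF this] have "degree p =
    degree (smult (lead_coeff p) (\<Prod>z|poly p z = 0. [:-z, 1:]))" by simp
  also have "\<dots> = degree (\<Prod>z|poly p z = 0. [:-z, 1:])" using assms(1) by simp
  also have "\<dots> = card {t. poly p t = 0}" by (subst degree_prod_sum_eq) auto
  finally show ?thesis ..
qed

lemma poly_eq_sum_le:
  fixes p :: "'a::comm_semiring_1 poly"
  shows "degree p \<le> n \<Longrightarrow> poly p x = (\<Sum>i\<le>n. coeff p i * x ^ i)"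
  unfolding poly_altdef by (rule sum.mono_neutral_left) (auto simp: coeff_eq_0)

text \<open>Degrees add up over a factorization while numbers of distinct roots are only
  subadditive; if the product has as many distinct roots as its degree allows, so has each
  factor.\<close>

lemma card_roots_divisor:
  fixes p D :: "complex poly"
  assumes "p \<noteq> 0" "card {t. poly p t = 0} = degree p" "D dvd p"
  shows "card {t. poly D t = 0} = degree D"
proof -
  obtain E where E: "p = D * E" using assms(3) by auto
  then have nz: "D \<noteq> 0" "E \<noteq> 0" using assms(1) by auto
  have "{t. poly p t = 0} = {t. poly D t = 0} \<union> {t. poly E t = 0}" by (auto simp: E)
  then have "degree D + degree E \<le> card {t. poly D t = 0} + card {t. poly E t = 0}"
    using assms(2) nz card_Un_le[of "{t. poly D t = 0}" "{t. poly E t = 0}"] by (simp add: E degree_mult_eq)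
  with card_roots_le_degree[OF nz(1)] card_roots_le_degree[OF nz(2)] show ?thesis by linarith
qed

text \<open>Polynomials over the univariate polynomials form no Euclidean ring, so an element
  \<open>E\<close> of least degree in the ideal of \<open>A\<close> and \<open>B\<close> divides
  them only up to a coefficient \<open>c\<close>. As \<open>c\<close> vanishes at finitely many
  values of the inner variable, at all others the roots of the specialized \<open>E\<close> are the
  common roots of \<open>A\<close> and \<open>B\<close>.\<close>

lemma pseudo_bezout:
  fixes A B :: "complex poly poly"
  assumes "A \<noteq> 0"
  obtains E U V A' B' c where "E \<noteq> 0" "c \<noteq> 0" "E = U * A + V * B"
    "smult c A = E * A'" "smult c B = E * B'"
proof -
  define I where "I = {E. \<exists>U V. E = U * A + V * B}"
  have "A \<in> I" unfolding I_def by (rule CollectI, rule exI[of _ 1], rule exI[of _ 0]) simp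
  then have "\<exists>E. E \<in> I \<and> E \<noteq> 0" using assms by blast
  then obtain E where E: "E \<in> I" "E \<noteq> 0" "\<And>F. F \<in> I \<Longrightarrow> F \<noteq> 0 \<Longrightarrow> degree E \<le> degree F"
    using ex_has_least_nat[of "\<lambda>E. E \<in> I \<and> E \<noteq> 0" _ degree] by metis
  obtain U V where UV: "E = U * A + V * B" using E(1) I_def by blast
  have div: "\<exists>c q. c \<noteq> 0 \<and> smult c F = E * q" if FI: "F \<in> I" for F
  proof -
    obtain U' V' where F: "F = U' * A + V' * B" using FI unfolding I_def by blast
    obtain c q where cq: "c \<noteq> 0" "smult c F = E * q + pseudo_mod F E"
      using pseudo_mod(1)[OF E(2)] by blast
    have "pseudo_mod F E = [:c:] * F - E * q" using cq(2) by simp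
    also have "\<dots> = ([:c:] * U' - q * U) * A + ([:c:] * V' - q * V) * B"
      unfolding F UV by (simp only: algebra_simps)
    finally have "pseudo_mod F E \<in> I" unfolding I_def by blast
    \<comment> \<open>The pseudo-remainder lies in the ideal and is of smaller degree than
      \<open>E\<close>, which minimality allows only for zero.\<close>
    then have "pseudo_mod F E = 0" using pseudo_mod(2)[OF E(2), of F] E(3) by fastforce
    then show ?thesis using cq by auto
  qed
  have "B \<in> I" unfolding I_def by (rule CollectI, rule exI[of _ 0], rule exI[of _ 1]) simp
  then obtain b B' where b: "b \<noteq> 0" "smult b B = E * B'" using div by blast
  obtain a A' where a: "a \<noteq> 0" "smult a A = E * A'" using div \<open>A \<in> I\<close> by blast
  show thesis
  proof (rule that[OF E(2) _ UV])
    show "a * b \<noteq> 0" using a b by simp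
    show "smult (a * b) A = E * smult b A'"
      by (metis a(2) mult.commute mult_smult_right smult_smult)
    show "smult (a * b) B = E * smult a B'"
      by (metis b(2) mult_smult_right smult_smult)
  qed
qed

text \<open>The outer variable stands for the second coordinate \<zeta>, the coefficients are
  polynomials in \<xi>. Thus \<open>degree\<close> is the degree in \<zeta>, and pseudo-division and
  contents apply to it.\<close>

definition ev2 :: "complex poly poly \<Rightarrow> complex \<Rightarrow> complex \<Rightarrow> complex" where
  "ev2 P x y = poly (poly P [:y:]) x"

definition specialize :: "complex \<Rightarrow> complex poly poly \<Rightarrow> complex poly" where
  "specialize x P = map_poly (\<lambda>c. poly c x) P"

lemma ev2_simps [simp]:
  "ev2 0 x y = 0" "ev2 1 x y = 1" "ev2 (P + Q) x y = ev2 P x y + ev2 Q x y"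
  "ev2 (P - Q) x y = ev2 P x y - ev2 Q x y"
  "ev2 (P * Q) x y = ev2 P x y * ev2 Q x y" "ev2 (smult c P) x y = poly c x * ev2 P x y"
  "ev2 (P ^ k) x y = ev2 P x y ^ k"
  "ev2 [:c:] x y = poly c x"
  by (simp_all add: ev2_def)

lemma ev2_sum [simp]: "ev2 (\<Sum>i\<in>I. P i) x y = (\<Sum>i\<in>I. ev2 (P i) x y)"
  by (simp add: ev2_def poly_sum)

lemma coeff_specialize [simp]: "coeff (specialize x P) j = poly (coeff P j) x"
  by (simp add: specialize_def coeff_map_poly)

lemma poly_specialize: "poly (specialize x P) y = ev2 P x y"
  unfolding specialize_def ev2_def
  by (induction P rule: pCons_induct) (simp_all add: map_poly_pCons)

lemma specialize_mult: "specialize x (P * Q) = specialize x P * specialize x Q"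
  by (intro poly_eqI_MOST MOST_I) (simp add: poly_specialize)

lemma specialize_smult: "specialize x (smult c P) = smult (poly c x) (specialize x P)"
  by (intro poly_eqI_MOST MOST_I) (simp add: poly_specialize)

lemma degree_specialize_le: "degree (specialize x P) \<le> degree P"
  by (rule degree_le) (simp add: coeff_eq_0)

lemma MOST_degree_specialize:
  assumes "P \<noteq> 0"
  shows "MOST x. specialize x P \<noteq> 0 \<and> degree (specialize x P) = degree P"
proof -
  have "MOST x. poly (lead_coeff P) x \<noteq> 0" using assms by (intro MOST_poly_nonzero) simp
  then show ?thesis
  proof eventually_elim
    case (elim x)
    then have c: "coeff (specialize x P) (degree P) \<noteq> 0" by simp
    then have "degree P \<le> degree (specialize x P)" by (rule le_degree)
    moreover have "specialize x P \<noteq> 0" using c by (metis coeff_0)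
    ultimately show ?case using degree_specialize_le[of x P] by auto
  qed
qed

lemma specialize_eq_0_imp:
  assumes "MOST x. specialize x P = 0"
  shows "P = 0"
proof (rule ccontr)
  assume "P \<noteq> 0"
  from MOST_degree_specialize[OF this] assms have "MOST x::complex. False"
    by eventually_elim simp
  then show False by (simp add: infinite_UNIV_char_0)
qed

lemma ev2_expand:
  assumes "\<And>j. degree (coeff P j) \<le> K" "degree P \<le> L"
  shows "ev2 P x y = (\<Sum>j\<le>L. \<Sum>i\<le>K. coeff (coeff P j) i * x ^ i * y ^ j)"
proof -
  have "ev2 P x y = poly (specialize x P) y" by (simp add: poly_specialize)
  also have "\<dots> = (\<Sum>j\<le>L. poly (coeff P j) x * y ^ j)"
    using degree_specialize_le[of x P] assms(2) by (subst poly_eq_sum_le) (auto intro: order_trans)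
  also have "\<dots> = (\<Sum>j\<le>L. \<Sum>i\<le>K. coeff (coeff P j) i * x ^ i * y ^ j)"
    using assms(1) by (intro sum.cong refl) (subst poly_eq_sum_le[of _ K], auto simp: sum_distrib_right)
  finally show ?thesis .
qed

lemma ex_ev2_sum:
  "\<exists>P. (\<forall>x y. ev2 P x y = (\<Sum>j\<le>L. \<Sum>i\<le>K. c i j * x ^ i * y ^ j)) \<and>
    degree P \<le> L \<and> (\<forall>i\<le>K. \<forall>j\<le>L. coeff (coeff P j) i = c i j)"
proof -
  define P where "P = (\<Sum>j\<le>L. monom (\<Sum>i\<le>K. monom (c i j) i) j)"
  have "ev2 P x y = (\<Sum>j\<le>L. \<Sum>i\<le>K. c i j * x ^ i * y ^ j)" for x y
    by (simp add: P_def, simp add: ev2_def poly_monom poly_sum sum_distrib_right)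
  moreover have "degree P \<le> L" unfolding P_def
    by (intro degree_sum_le) (auto intro: order_trans[OF degree_monom_le])
  moreover have "coeff (coeff P j) i = c i j" if "i \<le> K" "j \<le> L" for i j
  proof -
    have "coeff P j = (\<Sum>i\<le>K. monom (c i j) i)"
      using that(2) by (simp add: P_def coeff_sum if_distrib[of "\<lambda>x. coeff x _"] cong: if_cong)
    then show ?thesis using that(1) by (simp add: coeff_sum)
  qed
  ultimately show ?thesis by blast
qed

text \<open>Gaussian elimination by induction on the equations: an unknown \<open>k\<close> that
  occurs in equation \<open>j\<close> is eliminated from the others, and a solution for the
  remaining unknowns is extended by solving equation \<open>j\<close> for \<open>k\<close>.\<close>

lemma underdetermined_system:
  fixes a :: "'j \<Rightarrow> 'i \<Rightarrow> complex"
  assumes "finite J" "finite I" "card J < card I"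
  shows "\<exists>x. (\<exists>i\<in>I. x i \<noteq> 0) \<and> (\<forall>j\<in>J. (\<Sum>i\<in>I. a j i * x i) = 0)"
  using assms
proof (induction J arbitrary: I a rule: finite_induct)
  case empty
  then obtain i where "i \<in> I" by (auto simp: card_gt_0_iff)
  then show ?case by (intro exI[of _ "\<lambda>_. 1"]) auto
next
  case (insert j J)
  show ?case
  proof (cases "\<forall>i\<in>I. a j i = 0")
    case True
    have "card J < card I" using insert.prems insert.hyps by simp
    from insert.IH[OF insert.prems(1) this, of a] True show ?thesis by (auto intro!: exI sum.neutral)
  next
    case False
    then obtain k where k: "k \<in> I" "a j k \<noteq> 0" by blast
    define I' where "I' = I - {k}"
    have I: "I = insert k I'" "k \<notin> I'" "finite I'" using k insert.prems by (auto simp: I'_def)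
    have "card J < card I'" using insert.prems insert.hyps I by simp
    from insert.IH[OF I(3) this, of "\<lambda>l i. a l i - a l k * a j i / a j k"]
    obtain x where x: "\<exists>i\<in>I'. x i \<noteq> 0"
      "\<And>l. l \<in> J \<Longrightarrow> (\<Sum>i\<in>I'. (a l i - a l k * a j i / a j k) * x i) = 0" by blast
    define y where "y = x(k := - (\<Sum>i\<in>I'. a j i * x i) / a j k)"
    have y: "(\<Sum>i\<in>I. a l i * y i) = (\<Sum>i\<in>I'. a l i * x i) - a l k * (\<Sum>i\<in>I'. a j i * x i) / a j k" for l
    proof -
      have "(\<Sum>i\<in>I'. a l i * y i) = (\<Sum>i\<in>I'. a l i * x i)"
        using I by (intro sum.cong) (auto simp: y_def)
      then show ?thesis using I by (simp add: y_def)
    qed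
    have "(\<Sum>i\<in>I. a j i * y i) = 0" using k by (simp add: y)
    moreover have "(\<Sum>i\<in>I. a l i * y i) = 0" if "l \<in> J" for l
      using x(2)[OF that] by (simp add: y left_diff_distrib sum_subtractf sum_distrib_left 
         sum_divide_distrib mult.assoc)
    moreover have "\<exists>i\<in>I. y i \<noteq> 0" using x(1) I by (auto simp: y_def)
    ultimately show ?thesis by (intro exI[of _ y]) auto
  qed
qed

section \<open>Equations of rational plane curves\<close>

text \<open>
  The plane curve \<open>t \<mapsto> (f\<^sub>2/f\<^sub>1, f\<^sub>3/f\<^sub>1)\<close> for \<open>f\<^sub>1 = h p\<^sub>1\<close>, \<open>f\<^sub>2 = h p\<^sub>2\<close>; its first coordinate
  is a map of degree \<open>\<delta>\<close> of the projective line.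
\<close>

locale rational_curve =
  fixes h p1 p2 f3 :: "complex poly" and \<delta> :: nat
  assumes h_nz: "h \<noteq> 0" and p1_nz: "p1 \<noteq> 0" and cop: "coprime p1 p2"
    and \<delta>_def: "\<delta> = max (degree p1) (degree p2)" and \<delta>_pos: "\<delta> > 0"
begin

definition f1 where "f1 = h * p1"
definition "\<xi> t = poly p2 t / poly p1 t"
definition "\<zeta> t = poly f3 t / poly f1 t"
text \<open>The condition on \<open>f1\<close> keeps out poles, where division by zero would yield
  the value 0. It is put on \<open>t\<close> only, as cofinitely many \<open>s\<close> will be
  considered.\<close>

definition "fibre s = {t. poly f1 t \<noteq> 0 \<and> \<xi> t = \<xi> s \<and> \<zeta> t = \<zeta> s}"

lemma f1_nz: "f1 \<noteq> 0" using h_nz p1_nz by (simp add: f1_def)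

lemma p1_0: "poly p1 t = 0 \<Longrightarrow> poly p2 t \<noteq> 0"
  using coprime_no_common_root[OF cop] by blast

lemma f1_root: "poly f1 t = 0 \<longleftrightarrow> poly h t = 0 \<or> poly p1 t = 0"
  by (simp add: f1_def)

text \<open>The zeros of the Wronskian are the ramification points of \<open>p2 / p1\<close>. If it
  vanished identically, coprimality would make \<open>p1\<close> divide its own derivative, so
  \<open>p1\<close> and then \<open>p2\<close> would be constant, against
  \<open>\<delta>_pos\<close>.\<close>

lemma wronskian_nz: "pderiv p2 * p1 - p2 * pderiv p1 \<noteq> 0"
proof
  assume *: "pderiv p2 * p1 - p2 * pderiv p1 = 0"
  then have eq: "p2 * pderiv p1 = pderiv p2 * p1" by simp
  then have "p1 dvd p2 * pderiv p1" by simp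
  then have "p1 dvd pderiv p1" using cop by (simp add: coprime_dvd_mult_right_iff)
  then have 1: "pderiv p1 = 0"
    by (metis degree_pderiv diff_less dvd_imp_degree_le le_zero_eq linorder_not_le not_gr_zero
        pderiv_eq_0_iff zero_less_one)
  with eq p1_nz have "pderiv p2 = 0" by simp
  with 1 \<delta>_pos show False by (simp add: pderiv_eq_0_iff \<delta>_def)
qed

lemma pencil_nz: "x \<noteq> 0 \<or> y \<noteq> 0 \<Longrightarrow> smult x p2 - smult y p1 \<noteq> 0"
proof
  assume xy: "x \<noteq> 0 \<or> y \<noteq> 0" and *: "smult x p2 - smult y p1 = 0"
  then have e: "smult x p2 = smult y p1" by simp
  have e': "smult x (pderiv p2) = smult y (pderiv p1)"
    using arg_cong[OF e, of pderiv] by (simp add: pderiv_smult)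
  have "smult x (pderiv p2 * p1 - p2 * pderiv p1) = smult x (pderiv p2) * p1 - smult x p2 * pderiv p1"
    by (simp add: smult_diff_right)
  also have "\<dots> = 0" unfolding e e' by (simp add: mult.commute)
  finally have "x = 0" using wronskian_nz by simp
  with e p1_nz xy show False by simp
qed

lemma finite_pencil_roots: "finite {t. poly p2 t = y * poly p1 t}"
proof -
  have "{t. poly p2 t = y * poly p1 t} = {t. poly (smult 1 p2 - smult y p1) t = 0}" by auto
  then show ?thesis using pencil_nz[of 1 y] by (simp only: poly_roots_finite zero_neq_one[symmetric] simp_thms not_False_eq_True)
qed

lemma MOST_f1: "MOST t. poly f1 t \<noteq> 0"
  by (rule MOST_poly_nonzero[OF f1_nz])

text \<open>Off the zeros of \<open>p1\<close> each value is taken by \<xi> finitely often, so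
  finite exceptional sets have finite preimages.\<close>

lemma MOST_pullback:
  assumes "MOST y. P y"
  shows "MOST t. P (\<xi> t)"
proof -
  have "{t. \<not> P (\<xi> t)} \<subseteq> {t. poly p1 t = 0} \<union> (\<Union>y\<in>{y. \<not> P y}. {t. poly p2 t = y * poly p1 t})"
    by (auto simp: \<xi>_def)
  moreover have "finite \<dots>" using assms finite_pencil_roots p1_nz
    by (auto simp: eventually_cofinite poly_roots_finite)
  ultimately show ?thesis by (simp add: eventually_cofinite finite_subset)
qed

text \<open>Finite exceptional sets have finite images. The zeros of \<open>p1\<close> cause no
  trouble: by coprimality they solve none of the equations \<open>p2 t = y * p1 t\<close>.\<close>

lemma MOST_pushforward:
  assumes "MOST t. P t"
  shows "MOST y. \<forall>t. poly p2 t = y * poly p1 t \<longrightarrow> P t"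
proof -
  have "{y. \<not> (\<forall>t. poly p2 t = y * poly p1 t \<longrightarrow> P t)} \<subseteq> \<xi> ` {t. \<not> P t}"
    by (auto simp: \<xi>_def image_iff) (metis nonzero_mult_div_cancel_right mult_zero_right p1_0)
  moreover have "finite \<dots>" using assms by (simp add: eventually_cofinite)
  ultimately show ?thesis unfolding eventually_cofinite by (rule finite_subset)
qed

text \<open>Two kinds of \<open>y\<close> are excluded: the value of \<open>p2 / p1\<close> at
  infinity, where the coefficient at \<delta> cancels, and the critical values, where a double root
  would be a zero of the Wronskian.\<close>

lemma MOST_card_pencil:
  "MOST y. degree (p2 - smult y p1) = \<delta> \<and> card {t. poly (p2 - smult y p1) t = 0} = \<delta>"
proof -
  have "MOST y. coeff p2 \<delta> - y * coeff p1 \<delta> \<noteq> 0"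
  proof -
    have "[:coeff p2 \<delta>, - coeff p1 \<delta>:] \<noteq> 0"
      using \<delta>_pos by (auto simp: \<delta>_def max_def split: if_splits)
    from MOST_poly_nonzero[OF this] show ?thesis by simp
  qed
  moreover have "MOST y. \<forall>t. poly p2 t = y * poly p1 t \<longrightarrow>
      poly (pderiv p2 * p1 - p2 * pderiv p1) t \<noteq> 0"
    by (intro MOST_pushforward MOST_poly_nonzero wronskian_nz)
  ultimately show ?thesis
  proof eventually_elim
    case (elim y)
    let ?q = "p2 - smult y p1"
    have nz: "?q \<noteq> 0" using pencil_nz[of 1 y] by simp
    have "degree ?q \<le> \<delta>" by (intro degree_diff_le) (auto simp: \<delta>_def)
    moreover have "degree ?q \<ge> \<delta>" using elim(1) by (intro le_degree) simp
    moreover have "card {t. poly ?q t = 0} = degree ?q"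
    proof (rule card_roots_eq_degree[OF nz])
      fix t assume t: "poly ?q t = 0"
      show "poly (pderiv ?q) t \<noteq> 0"
      proof
        assume d: "poly (pderiv ?q) t = 0"
        have "poly (pderiv p2 * p1 - p2 * pderiv p1) t = 0"
          using t d by (simp add: pderiv_diff pderiv_smult algebra_simps)
        with elim(2) t show False by simp
      qed
    qed
    ultimately show ?case by simp
  qed
qed

lemma MOST_card_pencil_at:
  "MOST s. poly f1 s \<noteq> 0 \<and>
     (let q = smult (poly p1 s) p2 - smult (poly p2 s) p1 in
      q \<noteq> 0 \<and> degree q = \<delta> \<and> card {t. poly q t = 0} = \<delta>)"
  using MOST_pullback[OF MOST_card_pencil] MOST_f1
proof eventually_elim
  case (elim s)
  then have s: "poly p1 s \<noteq> 0" by (simp add: f1_root)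
  have eq: "smult (poly p1 s) p2 - smult (poly p2 s) p1 = smult (poly p1 s) (p2 - smult (\<xi> s) p1)"
    using s by (simp add: smult_diff_right \<xi>_def)
  show ?case unfolding eq Let_def using elim s pencil_nz[of 1 "\<xi> s"] by simp
qed

text \<open>A fibre consists of common roots in \<open>t\<close> of two polynomials \<open>A\<close>
  and \<open>B\<close> with parameter \<open>s\<close>. For generic \<open>s\<close> these are the
  roots of the specialized \<open>E\<close> of \<open>pseudo_bezout\<close>, and they are simple
  because \<open>E\<close> then divides \<open>A\<close>, whose roots are simple. So their number is
  \<open>degree E\<close>.\<close>

lemma ex_generic_fibre: "\<exists>e. MOST s. poly f1 s \<noteq> 0 \<and> finite (fibre s) \<and> card (fibre s) = e"
proof -
  \<comment> \<open>\<open>lift\<close> turns a polynomial in \<open>t\<close> into one in the outer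
    variable; multiplication by plain coefficients then carries the dependence on
    \<open>s\<close>.\<close>
  define lift :: "complex poly \<Rightarrow> complex poly poly" where "lift = map_poly (\<lambda>c. [:c:])"
  have lift: "specialize s (lift p) = p" for s p
    by (rule poly_eqI) (simp add: lift_def coeff_map_poly)
  define A where "A = smult p1 (lift p2) - smult p2 (lift p1)"
  define B where "B = smult f1 (lift f3) - smult f3 (lift f1)"
  have evA: "ev2 A s t = poly p1 s * poly p2 t - poly p2 s * poly p1 t" for s t
    by (simp add: A_def lift flip: poly_specialize[of _ "lift _"])
  have evB: "ev2 B s t = poly f1 s * poly f3 t - poly f3 s * poly f1 t" for s t
    by (simp add: B_def lift flip: poly_specialize[of _ "lift _"])
  have spA: "specialize s A = smult (poly p1 s) p2 - smult (poly p2 s) p1" for s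
    by (intro poly_eqI_MOST MOST_I) (simp add: poly_specialize evA)
  have "A \<noteq> 0"
  proof
    assume "A = 0"
    then have "specialize s A = 0" for s by (simp add: specialize_def)
    then have "MOST s::complex. False" using MOST_card_pencil_at
      by (auto simp flip: spA simp: Let_def elim: eventually_mono)
    then show False by (simp add: infinite_UNIV_char_0)
  qed
  then obtain E U V A' B' c where E: "E \<noteq> 0" "c \<noteq> 0" "E = U * A + V * B"
    "smult c A = E * A'" "smult c B = E * B'" by (rule pseudo_bezout)
  \<comment> \<open>At the roots of \<open>h\<close> also \<open>f1\<close> vanishes, so they belong
    to no fibre. For generic \<open>s\<close> they are not roots of \<open>A\<close> either, and
    \<open>E\<close> does not count them.\<close>
  have "MOST s. \<forall>t\<in>{t. poly h t = 0}. ev2 A s t \<noteq> 0"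
  proof (intro eventually_ball_finite ballI)
    show "finite {t. poly h t = 0}" using h_nz by (rule poly_roots_finite)
    fix t
    have "smult (- poly p1 t) p2 - smult (- poly p2 t) p1 \<noteq> 0" using p1_0 by (intro pencil_nz) auto
    from MOST_poly_nonzero[OF this] show "MOST s. ev2 A s t \<noteq> 0"
      by (simp add: evA mult.commute)
  qed
  moreover have "MOST s. poly c s \<noteq> 0" using E(2) by (rule MOST_poly_nonzero)
  ultimately have "MOST s. poly f1 s \<noteq> 0 \<and> finite (fibre s) \<and> card (fibre s) = degree E"
    using MOST_card_pencil_at MOST_degree_specialize[OF E(1)]
  proof eventually_elim
    case (elim s)
    have s: "poly f1 s \<noteq> 0" "poly p1 s \<noteq> 0" using elim by (auto simp: f1_root)
    have "fibre s = {t. poly (specialize s E) t = 0}"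
    proof (rule set_eqI, rule iffI)
      fix t assume "t \<in> fibre s"
      then have t: "poly f1 t \<noteq> 0" "poly p1 t \<noteq> 0" "\<xi> t = \<xi> s" "\<zeta> t = \<zeta> s"
        by (auto simp: fibre_def f1_root)
      then have "ev2 A s t = 0" "ev2 B s t = 0" using s by (auto simp: evA evB \<xi>_def \<zeta>_def field_simps)
      then show "t \<in> {t. poly (specialize s E) t = 0}" by (simp add: poly_specialize E(3))
    next
      fix t assume "t \<in> {t. poly (specialize s E) t = 0}"
      then have e: "ev2 E s t = 0" by (simp add: poly_specialize)
      have "poly c s * ev2 A s t = 0" "poly c s * ev2 B s t = 0"
        using arg_cong[OF E(4), of "\<lambda>P. ev2 P s t"] arg_cong[OF E(5), of "\<lambda>P. ev2 P s t"] e by simp_all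
      then have AB: "ev2 A s t = 0" "ev2 B s t = 0" using elim by auto
      then have "poly h t \<noteq> 0" using elim by auto
      moreover have "poly p1 t \<noteq> 0" using AB(1) s p1_0[of t] by (auto simp: evA)
      ultimately have "poly f1 t \<noteq> 0" by (simp add: f1_root)
      then show "t \<in> fibre s" using AB s \<open>poly p1 t \<noteq> 0\<close>
        by (auto simp: fibre_def evA evB \<xi>_def \<zeta>_def field_simps)
    qed
    moreover have "card {t. poly (specialize s E) t = 0} = degree (specialize s E)"
    proof (rule card_roots_divisor)
      show "specialize s A \<noteq> 0" "card {t. poly (specialize s A) t = 0} = degree (specialize s A)"
        using elim by (auto simp: spA Let_def)
      have "smult (poly c s) (specialize s A) = specialize s E * specialize s A'"
        using arg_cong[OF E(4), of "specialize s"] by (simp add: specialize_mult specialize_smult)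
      then have "specialize s E dvd smult (poly c s) (specialize s A)" by simp
      then show "specialize s E dvd specialize s A" using elim by (simp add: dvd_smult_iff)
    qed
    ultimately show ?case using elim s by (auto simp: poly_roots_finite)
  qed
  then show ?thesis by blast
qed

section \<open>The degree in the second coordinate of the equation of the image curve\<close>

definition "generic_fibre e \<longleftrightarrow> (MOST s. card (fibre s) = e)"

lemma fibre_self: "poly f1 s \<noteq> 0 \<Longrightarrow> s \<in> fibre s"
  by (simp add: fibre_def)

lemma finite_fibre: "finite (fibre s)"
proof -
  have "fibre s \<subseteq> {t. poly p2 t = \<xi> s * poly p1 t}"
    by (auto simp: fibre_def f1_root \<xi>_def field_simps)
  then show ?thesis using finite_pencil_roots finite_subset by blast
qed

lemma generic_fibre_pos:
  assumes "generic_fibre e"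
  shows "e > 0"
proof -
  have "MOST s. card (fibre s) = e \<and> poly f1 s \<noteq> 0" using assms MOST_f1
    unfolding generic_fibre_def by eventually_elim simp
  then obtain s where "card (fibre s) = e" "poly f1 s \<noteq> 0" by (auto dest: MOST_complex_ex)
  then show ?thesis using fibre_self finite_fibre by (metis card_gt_0_iff empty_iff)
qed

definition "values y = \<zeta> ` {t. poly p2 t = y * poly p1 t}"

text \<open>The \<delta> parameters over a generic \<open>y\<close> are grouped by their value of
  \<zeta> into fibres of \<open>e\<close> elements each.\<close>

lemma MOST_card_values:
  assumes "generic_fibre e"
  shows "MOST y. card (values y) * e = \<delta> \<and> (\<forall>t. poly p2 t = y * poly p1 t \<longrightarrow> poly f1 t \<noteq> 0)"
proof -
  have "MOST s. card (fibre s) = e \<and> poly f1 s \<noteq> 0"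
    using assms MOST_f1 unfolding generic_fibre_def by eventually_elim simp
  from MOST_pushforward[OF this] MOST_card_pencil show ?thesis
  proof eventually_elim
    case (elim y)
    let ?R = "{t. poly p2 t = y * poly p1 t}"
    have R: "finite ?R" "card ?R = \<delta>" using elim finite_pencil_roots by auto
    have "card {t\<in>?R. \<zeta> t = z} = e" if z: "z \<in> values y" for z
    proof -
      obtain s where s: "s \<in> ?R" "z = \<zeta> s" using z by (auto simp: values_def)
      have "{t\<in>?R. \<zeta> t = z} = fibre s"
        using s elim(1) by (auto simp: fibre_def f1_root \<xi>_def field_simps)
      with s elim(1) show ?thesis by simp
    qed
    moreover have "card ?R = (\<Sum>z\<in>values y. card {t\<in>?R. \<zeta> t = z})"
      using sum.image_gen[OF R(1), of "\<lambda>_. 1::nat" \<zeta>] unfolding values_def card_eq_sum .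
    ultimately show ?case using R elim by simp
  qed
qed

definition "vanishes P \<longleftrightarrow> (MOST t. ev2 P (\<xi> t) (\<zeta> t) = 0)"

text \<open>For generic \<open>y\<close> the specialization of \<open>P\<close> is not zero and has
  the \<delta> / e elements of \<open>values y\<close> among its roots.\<close>

lemma vanishes_degree:
  assumes "generic_fibre e" "vanishes P" "P \<noteq> 0"
  shows "\<delta> \<le> degree P * e"
proof -
  have "MOST y::complex. \<delta> \<le> degree P * e"
    using MOST_pushforward[OF assms(2)[unfolded vanishes_def]] MOST_card_values[OF assms(1)]
      MOST_degree_specialize[OF assms(3)]
  proof eventually_elim
    case (elim y)
    have "values y \<subseteq> {z. poly (specialize y P) z = 0}"
      using elim(1,2) by (auto simp: values_def poly_specialize \<xi>_def f1_root)
    then have "card (values y) \<le> card {z. poly (specialize y P) z = 0}"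
      using elim by (intro card_mono poly_roots_finite) auto
    also have "\<dots> \<le> degree P" using card_roots_le_degree[of "specialize y P"] elim by simp
    finally show ?case using elim(2) by (metis mult_le_mono1)
  qed
  then show ?thesis by (simp add: infinite_UNIV_char_0)
qed

end

context rational_curve
begin

lemma infinite_good_points:
  assumes "MOST t. Q t"
  shows "infinite ((\<lambda>t. (\<xi> t, \<zeta> t)) ` {t. Q t \<and> poly f1 t \<noteq> 0})" (is "infinite (?g ` ?G)")
proof
  assume fin: "finite (?g ` ?G)"
  have "?G \<subseteq> (\<Union>z\<in>?g ` ?G. {t. poly p2 t = fst z * poly p1 t})"
    by (auto simp: \<xi>_def f1_root)
  moreover have "finite \<dots>" using fin finite_pencil_roots by (intro finite_UN_I) auto
  ultimately have "finite ?G" by (rule finite_subset)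
  moreover have "MOST t. Q t \<and> poly f1 t \<noteq> 0" using assms MOST_f1 by (rule eventually_conj)
  then have "infinite ?G"
    using MOST_INFM by (metis (mono_tags, lifting) INFM_iff_infinite infinite_UNIV_char_0)
  ultimately show False by simp
qed

text \<open>
  By a dimension count: a polynomial vanishing at sufficiently many points of the curve vanishes
  on it, since each point provides a whole fibre of roots of the pullback.
\<close>

lemma ex_vanishing:
  assumes e: "generic_fibre e"
  shows "\<exists>P. P \<noteq> 0 \<and> degree P * e \<le> \<delta> \<and> vanishes P"
proof -
  have e_pos: "e > 0" by (rule generic_fibre_pos[OF e])
  obtain y0 where "card (values y0) * e = \<delta>" using MOST_complex_ex[OF MOST_card_values[OF e]] by blast
  then obtain l where l: "\<delta> = l * e" by metis
  \<comment> \<open>A polynomial of degree at most \<open>N\<close> in \<xi> and \<open>l\<close> in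
    \<zeta> pulls back to one of degree at most \<open>D\<close>, which is zero once it has s e > D
    roots. It has (N + 1)(l + 1) coefficients, and the choice of \<open>N\<close> makes this larger
    than the number \<open>s\<close> of conditions, which is at most N l + N.\<close>
  define M where "M = max (degree f1) (degree f3)"
  define N where "N = l * M + 1"
  define D where "D = N * \<delta> + l * M"
  define s where "s = D div e + 1"
  have "D < s * e" unfolding s_def using dividend_less_div_times[OF e_pos, of D] by simp
  have "D = l * M + (N * l) * e" by (simp add: D_def l)
  then have "D div e = N * l + (l * M) div e" using e_pos by (simp only: div_mult_self1)
  also have "\<dots> \<le> N * l + l * M" by simp
  finally have s_less: "s < (N + 1) * (l + 1)" by (simp add: s_def N_def algebra_simps)
  \<comment> \<open>Only points with a full fibre are used, so that each accounts for exactly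
    \<open>e\<close> roots.\<close>
  define Z where "Z = (\<lambda>t. (\<xi> t, \<zeta> t)) ` {t. card (fibre t) = e \<and> poly f1 t \<noteq> 0}"
  have "infinite Z" unfolding Z_def
    using e by (intro infinite_good_points) (simp add: generic_fibre_def)
  then obtain Y where Y: "finite Y" "card Y = s" "Y \<subseteq> Z" using infinite_arbitrarily_large by blast
  let ?I = "{..N} \<times> {..l}"
  obtain x where x: "\<exists>i\<in>?I. x i \<noteq> 0"
    "\<And>y. y \<in> Y \<Longrightarrow> (\<Sum>i\<in>?I. (fst y ^ fst i * snd y ^ snd i) * x i) = 0"
    using underdetermined_system[of Y ?I "\<lambda>y i. fst y ^ fst i * snd y ^ snd i"] Y s_less
    by (auto simp: card_cartesian_product)
  define c where "c i j = x (i, j)" for i j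
  from ex_ev2_sum[where L = l and K = N and c = c]
  obtain P where P0: "(\<forall>y z. ev2 P y z = (\<Sum>j\<le>l. \<Sum>i\<le>N. c i j * y ^ i * z ^ j)) \<and>
    degree P \<le> l \<and> (\<forall>i\<le>N. \<forall>j\<le>l. coeff (coeff P j) i = c i j)" by (rule exE)
  then have P: "\<And>y z. ev2 P y z = (\<Sum>j\<le>l. \<Sum>i\<le>N. c i j * y ^ i * z ^ j)" "degree P \<le> l" by simp_all
  have "P \<noteq> 0"
  proof
    assume "P = 0"
    with P0 have "\<forall>i\<le>N. \<forall>j\<le>l. c i j = 0" by simp
    with x(1) show False by (auto simp: c_def)
  qed
  have PY: "ev2 P (fst y) (snd y) = 0" if "y \<in> Y" for y
  proof -
    have "ev2 P (fst y) (snd y) = (\<Sum>i\<le>N. \<Sum>j\<le>l. c i j * fst y ^ i * snd y ^ j)"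
      unfolding P(1) by (rule sum.swap)
    also have "\<dots> = (\<Sum>i\<in>?I. (fst y ^ fst i * snd y ^ snd i) * x i)"
      unfolding sum.cartesian_product by (intro sum.cong refl) (simp add: c_def case_prod_unfold)
    finally show ?thesis using x(2)[OF that] by simp
  qed
  define R where "R = (\<Sum>j\<le>l. \<Sum>i\<le>N. smult (c i j) (p2 ^ i * p1 ^ (N - i) * f3 ^ j * f1 ^ (l - j)))"
  have R: "poly R t = poly p1 t ^ N * poly f1 t ^ l * ev2 P (\<xi> t) (\<zeta> t)" if t: "poly f1 t \<noteq> 0" for t
  proof -
    have p1: "poly p1 t \<noteq> 0" using t by (simp add: f1_root)
    have *: "a ^ (n - k) = a ^ n / a ^ k" if "k \<le> n" "a \<noteq> 0" for a :: complex and n k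
      using that by (simp add: power_diff)
    show ?thesis unfolding R_def P(1) poly_sum sum_distrib_left
      by (intro sum.cong refl) (simp add: * p1 t \<xi>_def \<zeta>_def power_divide mult_ac)
  qed
  have deg: "degree R \<le> D" unfolding R_def
  proof (intro degree_sum_le finite_atMost)
    fix i j assume ij: "i \<in> {..N}" "j \<in> {..l}"
    have pw: "degree (q ^ k) \<le> k * m" if "degree q \<le> m" for q :: "complex poly" and k m
      by (rule order_trans[OF degree_power_le]) (use that in \<open>simp add: mult.commute\<close>)
    let ?A = "p2 ^ i" and ?B = "p1 ^ (N - i)" and ?C = "f3 ^ j" and ?D = "f1 ^ (l - j)"
    have "degree (smult (c i j) (?A * ?B * ?C * ?D)) \<le> degree ?A + degree ?B + degree ?C + degree ?D"
      using degree_smult_le[of "c i j" "?A * ?B * ?C * ?D"] degree_mult_le[of "?A * ?B * ?C" ?D]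
        degree_mult_le[of "?A * ?B" ?C] degree_mult_le[of ?A ?B] by linarith
    also have "\<dots> \<le> i * \<delta> + (N - i) * \<delta> + j * M + (l - j) * M"
      by (intro add_mono pw) (auto simp: \<delta>_def M_def)
    also have "i * \<delta> + (N - i) * \<delta> = N * \<delta>"
      using ij by (simp flip: add_mult_distrib)
    also have "N * \<delta> + j * M + (l - j) * M = D"
      unfolding D_def add.assoc using ij by (simp flip: add_mult_distrib)
    finally show "degree (smult (c i j) (p2 ^ i * p1 ^ (N - i) * f3 ^ j * f1 ^ (l - j))) \<le> D" .
  qed
  have "R = 0"
  proof (rule ccontr)
    assume "R \<noteq> 0"
    let ?F = "\<lambda>y. {t. poly f1 t \<noteq> 0 \<and> (\<xi> t, \<zeta> t) = y}"
    have F: "finite (?F y) \<and> card (?F y) = e" if y: "y \<in> Y" for y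
    proof -
      obtain t where "y = (\<xi> t, \<zeta> t)" "card (fibre t) = e" using y Y(3) by (auto simp: Z_def)
      moreover from this have "?F y = fibre t" by (auto simp: fibre_def)
      ultimately show ?thesis using finite_fibre by simp
    qed
    have "card (\<Union>y\<in>Y. ?F y) = (\<Sum>y\<in>Y. card (?F y))"
      using Y(1) F by (intro card_UN_disjoint) auto
    also have "\<dots> = s * e" using F Y(2) by simp
    finally have "card (\<Union>y\<in>Y. ?F y) = s * e" .
    moreover have "(\<Union>y\<in>Y. ?F y) \<subseteq> {t. poly R t = 0}" using PY by (fastforce simp: R)
    ultimately have "s * e \<le> degree R"
      using card_mono[OF poly_roots_finite[OF \<open>R \<noteq> 0\<close>], of "\<Union>y\<in>Y. ?F y"]
        card_roots_le_degree[OF \<open>R \<noteq> 0\<close>] by linarith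
    with deg \<open>D < s * e\<close> show False by simp
  qed
  have "vanishes P" using MOST_f1 unfolding vanishes_def
  proof eventually_elim
    case (elim t)
    then show ?case using R[OF elim] \<open>R = 0\<close> by (simp add: f1_root)
  qed
  moreover have "degree P * e \<le> \<delta>" using P(2) l by simp
  ultimately show ?thesis using \<open>P \<noteq> 0\<close> by blast
qed

lemma vanishes_smult:
  assumes "c \<noteq> 0" "vanishes (smult c P)"
  shows "vanishes P"
  using MOST_pullback[OF MOST_poly_nonzero[OF assms(1)]] assms(2) unfolding vanishes_def
  by eventually_elim simp

text \<open>A primitive polynomial of the least possible degree \<delta> / e divides every vanishing
  \<open>G\<close>: the pseudo-remainder vanishes on the curve as well, but its degree is too small.
  The factor \<open>c\<close> of pseudo-division is removed by Gauss's lemma on contents.\<close>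

lemma ex_generator:
  assumes e: "generic_fibre e"
  shows "\<exists>\<gamma>. \<gamma> \<noteq> 0 \<and> degree \<gamma> * e = \<delta> \<and> (\<forall>G. vanishes G \<longleftrightarrow> \<gamma> dvd G)"
proof -
  obtain P where P: "P \<noteq> 0" "degree P * e \<le> \<delta>" "vanishes P" using ex_vanishing[OF e] by blast
  define \<gamma> where "\<gamma> = primitive_part P"
  have \<gamma>: "\<gamma> \<noteq> 0" "content \<gamma> = 1" "degree \<gamma> = degree P" "P = smult (content P) \<gamma>"
    using P(1) by (simp_all add: \<gamma>_def)
  have v: "vanishes \<gamma>" using vanishes_smult[of "content P" \<gamma>] P(1,3) unfolding \<gamma>(4)[symmetric] by simp
  have deg: "degree \<gamma> * e = \<delta>" using vanishes_degree[OF e v \<gamma>(1)] P(2) \<gamma>(3) by simp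
  have "\<gamma> dvd G" if G: "vanishes G" for G
  proof -
    obtain c q where cq: "c \<noteq> 0" "smult c G = \<gamma> * q + pseudo_mod G \<gamma>"
      using pseudo_mod(1)[OF \<gamma>(1)] by blast
    have van: "vanishes (pseudo_mod G \<gamma>)" using G v unfolding vanishes_def
    proof eventually_elim
      case (elim t)
      then show ?case using arg_cong[OF cq(2), of "\<lambda>P. ev2 P (\<xi> t) (\<zeta> t)"] by simp
    qed
    have "pseudo_mod G \<gamma> = 0"
    proof (rule ccontr)
      assume nz: "pseudo_mod G \<gamma> \<noteq> 0"
      then have "degree (pseudo_mod G \<gamma>) < degree \<gamma>" using pseudo_mod(2)[OF \<gamma>(1), of G] by blast
      then have "degree (pseudo_mod G \<gamma>) * e < \<delta>"
        unfolding deg[symmetric] using generic_fibre_pos[OF e] by (rule mult_less_mono1)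
      with vanishes_degree[OF e van nz] show False by simp
    qed
    with cq have eq: "smult c G = \<gamma> * q" by simp
    have "[:c:] dvd \<gamma> * q" unfolding eq[symmetric] by (rule dvdI[of _ _ G]) simp
    then have "c dvd content \<gamma> * content q" by (simp only: const_poly_dvd_iff_dvd_content content_mult)
    then have "[:c:] dvd q" using \<gamma>(2) by (simp add: const_poly_dvd_iff_dvd_content)
    then obtain r where "q = [:c:] * r" by (rule dvdE)
    with eq have "[:c:] * (G - \<gamma> * r) = 0" by (simp add: smult_diff_right)
    then have "G = \<gamma> * r" using cq(1) by (simp only: mult_eq_0_iff) simp
    then show ?thesis by simp
  qed
  moreover have "vanishes G" if G: "\<gamma> dvd G" for G
  proof -
    obtain H where "G = \<gamma> * H" using G by (rule dvdE)
    with v show ?thesis unfolding vanishes_def by (auto elim!: eventually_mono)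
  qed
  ultimately show ?thesis using \<gamma>(1) deg by blast
qed

end

lemma coprime_if_no_common_root:
  fixes p q :: "complex poly"
  assumes "\<And>t. poly p t = 0 \<Longrightarrow> poly q t \<noteq> 0"
  shows "coprime p q"
proof (rule ccontr)
  assume "\<not> coprime p q"
  then have u: "\<not> is_unit (gcd p q)" by (simp add: coprime_iff_gcd_eq_1 is_unit_gcd_iff)
  have "\<exists>t. poly (gcd p q) t = 0"
  proof (rule ccontr)
    assume *: "\<nexists>t. poly (gcd p q) t = 0"
    then have "constant (poly (gcd p q))" using fundamental_theorem_of_algebra by blast
    then have "degree (gcd p q) = 0" by (simp add: constant_degree)
    moreover have "gcd p q \<noteq> 0" using * by auto
    ultimately show False using u is_unit_iff_degree by blast
  qed
  then obtain t where "poly (gcd p q) t = 0" by blast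
  then have "poly p t = 0" "poly q t = 0"
    by (meson gcd_dvd1 gcd_dvd2 poly_eq_0_iff_dvd dvd_trans)+
  with assms show False by blast
qed

lemma ev2_eqI: "(\<And>x y. ev2 P x y = ev2 Q x y) \<Longrightarrow> P = Q"
proof -
  assume *: "\<And>x y. ev2 P x y = ev2 Q x y"
  have "specialize x (P - Q) = 0" for x
    by (intro poly_eqI_MOST MOST_I) (simp add: poly_specialize *)
  then have "P - Q = 0" by (intro specialize_eq_0_imp) simp
  then show ?thesis by simp
qed

section \<open>Bivariate polynomial functions, total degree and shears\<close>

definition polyfun2 :: "(complex \<Rightarrow> complex \<Rightarrow> complex) \<Rightarrow> bool" where
  "polyfun2 f \<longleftrightarrow> (\<exists>P. \<forall>x y. f x y = ev2 P x y)"

lemma polyfun2_const: "polyfun2 (\<lambda>x y. c)"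
  unfolding polyfun2_def by (rule exI[of _ "[:[:c:]:]"]) simp

lemma polyfun2_1: "polyfun2 (\<lambda>x y. x)"
  unfolding polyfun2_def by (rule exI[of _ "[:[:0, 1:]:]"]) simp

lemma polyfun2_2: "polyfun2 (\<lambda>x y. y)"
  unfolding polyfun2_def by (rule exI[of _ "[:0, 1:]"]) (simp add: ev2_def)

lemma polyfun2_add: "polyfun2 f \<Longrightarrow> polyfun2 g \<Longrightarrow> polyfun2 (\<lambda>x y. f x y + g x y)"
  unfolding polyfun2_def by (metis ev2_simps(3))

lemma polyfun2_mult: "polyfun2 f \<Longrightarrow> polyfun2 g \<Longrightarrow> polyfun2 (\<lambda>x y. f x y * g x y)"
  unfolding polyfun2_def by (metis ev2_simps(5))

lemma polyfun2_power: "polyfun2 f \<Longrightarrow> polyfun2 (\<lambda>x y. f x y ^ k)"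
  by (induction k) (simp_all add: polyfun2_const polyfun2_mult)

lemma polyfun2_sum: "(\<And>i. i \<in> I \<Longrightarrow> polyfun2 (f i)) \<Longrightarrow> polyfun2 (\<lambda>x y. \<Sum>i\<in>I. f i x y)"
  by (induction I rule: infinite_finite_induct) (simp_all add: polyfun2_const polyfun2_add)

lemmas polyfun2_intros = polyfun2_const polyfun2_1 polyfun2_2 polyfun2_add polyfun2_mult
  polyfun2_power polyfun2_sum

lemma ex_inner_degree_bound: "\<exists>K. \<forall>j. degree (coeff P j) \<le> K"
proof -
  have "degree (coeff P j) \<le> Max ((\<lambda>j. degree (coeff P j)) ` {..degree P})" for j
  proof (cases "j \<le> degree P")
    case True then show ?thesis by (intro Max_ge) auto
  next
    case False then show ?thesis by (simp add: coeff_eq_0)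
  qed
  then show ?thesis by blast
qed

lemma polyfun2_ev2: "polyfun2 f \<Longrightarrow> polyfun2 g \<Longrightarrow> polyfun2 (\<lambda>x y. ev2 P (f x y) (g x y))"
proof -
  assume *: "polyfun2 f" "polyfun2 g"
  obtain K where K: "\<And>j. degree (coeff P j) \<le> K" using ex_inner_degree_bound by blast
  show ?thesis unfolding ev2_expand[OF K order_refl] by (intro polyfun2_intros *)
qed

text \<open>A relation instead of a function: it implies that \<open>P\<close> is not zero, and no
  convention for the zero polynomial is involved.\<close>

definition total_degree2 :: "complex poly poly \<Rightarrow> nat \<Rightarrow> bool" where
  "total_degree2 P m \<longleftrightarrow> (\<forall>i j. coeff (coeff P j) i \<noteq> 0 \<longrightarrow> i + j \<le> m) \<and>
    (\<exists>i j. coeff (coeff P j) i \<noteq> 0 \<and> i + j = m)"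

lemma ex_total_degree2:
  assumes "P \<noteq> 0"
  shows "\<exists>m. total_degree2 P m"
proof -
  obtain K where K: "\<And>j. degree (coeff P j) \<le> K" using ex_inner_degree_bound by blast
  define S where "S = {(i, j). coeff (coeff P j) i \<noteq> 0}"
  have "S \<subseteq> {..K} \<times> {..degree P}"
  proof clarify
    fix i j assume "(i, j) \<in> S"
    then have *: "coeff (coeff P j) i \<noteq> 0" by (simp add: S_def)
    then show "i \<in> {..K} \<and> j \<in> {..degree P}"
      using K[of j] le_degree[OF *] by (auto intro!: le_degree)
  qed
  then have fin: "finite S" by (rule finite_subset) simp
  have "(degree (coeff P (degree P)), degree P) \<in> S" using assms by (simp add: S_def)
  then have "S \<noteq> {}" by blast
  define m where "m = Max ((\<lambda>(i, j). i + j) ` S)"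
  have "m \<in> (\<lambda>(i, j). i + j) ` S" unfolding m_def using fin \<open>S \<noteq> {}\<close> by (intro Max_in) auto
  moreover have "i + j \<le> m" if "(i, j) \<in> S" for i j
    unfolding m_def using fin that by (intro Max_ge) force+
  ultimately show ?thesis unfolding total_degree2_def S_def by (intro exI[of _ m]) force
qed

lemma total_degree2_expand:
  assumes "total_degree2 P m"
  shows "ev2 P x y = (\<Sum>j\<le>degree P. \<Sum>i\<le>m. coeff (coeff P j) i * x ^ i * y ^ j)"
    and "degree P \<le> m"
proof -
  have "degree (coeff P j) \<le> m" for j
  proof (intro degree_le allI impI)
    fix i assume "m < i"
    then show "coeff (coeff P j) i = 0"
      using assms unfolding total_degree2_def by (metis add_leD1 not_le)
  qed
  then show "ev2 P x y = (\<Sum>j\<le>degree P. \<Sum>i\<le>m. coeff (coeff P j) i * x ^ i * y ^ j)"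
    by (intro ev2_expand) auto
  have "P \<noteq> 0" using assms by (auto simp: total_degree2_def)
  then have "coeff (coeff P (degree P)) (degree (coeff P (degree P))) \<noteq> 0" by simp
  then show "degree P \<le> m" using assms unfolding total_degree2_def by fastforce
qed

text \<open>After the shear the coefficient of y^m is the value at (u, 1) of the form of degree
  \<open>m\<close> in \<open>P\<close>, called \<open>T\<close> below. As a polynomial in
  \<open>u\<close> it is not zero, so only finitely many \<open>u\<close> let the degree in y drop
  below \<open>m\<close>.\<close>

lemma MOST_degree_shear:
  assumes P: "total_degree2 P m"
  shows "MOST u. \<forall>Q. (\<forall>x y. ev2 Q x y = ev2 P (x + u * y) y) \<longrightarrow> degree Q = m"
proof -
  define T where "T = (\<Sum>j\<le>degree P. \<Sum>i\<le>m. if i + j = m then monom (coeff (coeff P j) i) i else 0)"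
  have coeff_T: "coeff T i = coeff (coeff P (m - i)) i" if "i \<le> m" for i
  proof -
    have "coeff T i = (\<Sum>j\<le>degree P. \<Sum>k\<le>m. if k = i then (if j = m - i then coeff (coeff P j) i else 0) else 0)"
      unfolding T_def coeff_sum using that by (intro sum.cong refl) auto
    also have "\<dots> = coeff (coeff P (m - i)) i" using that by (auto simp: coeff_eq_0)
    finally show ?thesis .
  qed
  obtain i j where ij: "coeff (coeff P j) i \<noteq> 0" "i + j = m"
    using P by (auto simp: total_degree2_def)
  then have "coeff T i \<noteq> 0" by (subst coeff_T) (auto simp flip: ij(2))
  then have "T \<noteq> 0" by auto
  from MOST_poly_nonzero[OF this] show ?thesis
  proof eventually_elim
    case (elim u)
    show ?case
    proof (intro allI impI)
      fix Q assume Q: "\<forall>x y. ev2 Q x y = ev2 P (x + u * y) y"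
      have deg: "degree (specialize x Q) = m" for x
      proof -
        let ?R = "\<Sum>j\<le>degree P. \<Sum>i\<le>m. smult (coeff (coeff P j) i) ([:x, u:] ^ i * [:0, 1:] ^ j)"
        have R: "specialize x Q = ?R"
          by (intro poly_eqI_MOST MOST_I)
            (simp add: poly_specialize Q total_degree2_expand(1)[OF P] poly_sum mult_ac)
        have d: "degree ([:x, u:] ^ i * [:0, 1:] ^ j) \<le> i + j" for i j
        proof -
          have "degree ([:x, u:] ^ i) \<le> 1 * i"
            by (rule order_trans[OF degree_power_le]) (simp add: degree_pCons_eq_if)
          moreover have "degree ([:0, 1::complex:] ^ j) \<le> 1 * j"
            by (rule order_trans[OF degree_power_le]) simp
          ultimately show ?thesis using degree_mult_le[of "[:x, u:] ^ i" "[:0, 1:] ^ j"] by linarith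
        qed
        have t: "smult (coeff (coeff P j) i) ([:x, u:] ^ i * [:0, 1:] ^ j) = 0 \<or> i + j \<le> m" for i j
          using P by (auto simp: total_degree2_def)
        have "degree ?R \<le> m"
        proof (intro degree_sum_le finite_atMost)
          fix i j
          show "degree (smult (coeff (coeff P j) i) ([:x, u:] ^ i * [:0, 1:] ^ j)) \<le> m"
            using t[of j i] d[of i j] degree_smult_le[of "coeff (coeff P j) i" "[:x, u:] ^ i * [:0, 1:] ^ j"]
            by (metis degree_0 le_trans zero_le)
        qed
        moreover have c: "coeff (smult (coeff (coeff P j) i) ([:x, u:] ^ i * [:0, 1:] ^ j)) m =
            (if i + j = m then coeff (coeff P j) i * u ^ i else 0)" for i j
        proof (cases "i + j = m")
          case True
          have "coeff ([:x, u:] ^ i) i = u ^ i" for i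
          proof (induction i)
            case (Suc i)
            have "coeff ([:x, u:] ^ i) (Suc i) = 0"
              using d[of i 0] by (intro coeff_eq_0) simp
            with Suc show ?case by (simp add: mult.commute)
          qed simp
          moreover have "coeff (p * [:0, 1:] ^ j) (i + j) = coeff p i" for p :: "complex poly"
            by (induction j) (simp_all add: mult.left_commute[of p])
          ultimately show ?thesis using True by auto
        next
          case False
          have "coeff (smult (coeff (coeff P j) i) ([:x, u:] ^ i * [:0, 1:] ^ j)) m = 0"
          proof (cases "i + j < m")
            case True
            then show ?thesis using d[of i j] by (simp add: coeff_eq_0)
          next
            case f: False
            then have "coeff (coeff P j) i = 0"
              using False P unfolding total_degree2_def by (metis le_neq_implies_less)
            then show ?thesis by simp
          qed
          with False show ?thesis by simp
        qed
        have "coeff ?R m = poly T u"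
          unfolding coeff_sum c T_def poly_sum by (intro sum.cong refl) (simp add: poly_monom)
        then have "coeff ?R m \<noteq> 0" using elim by simp
        ultimately show ?thesis unfolding R by (meson le_antisym le_degree)
      qed
      show "degree Q = m"
      proof (cases "Q = 0")
        case True
        then show ?thesis using deg[of 0] by (simp add: specialize_def)
      next
        case False
        then show ?thesis using MOST_complex_ex[OF MOST_degree_specialize[OF False]] deg by auto
      qed
    qed
  qed
qed

text \<open>
  The degree of the image curve is found by projecting it from a general point, i.e. by
  replacing the first coordinate \<open>f\<^sub>2/f\<^sub>1\<close> by \<open>(f\<^sub>2 - \<mu> f\<^sub>3)/f\<^sub>1\<close> for general \<open>\<mu>\<close>.
\<close>

theorem rational_curve_equation:
  fixes f1 f2 f3 :: "complex poly"
  assumes f1: "f1 \<noteq> 0" and indep: "\<And>c. f2 \<noteq> smult c f1"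
  defines "fib \<equiv> \<lambda>s. {t. poly f1 t \<noteq> 0 \<and> poly f2 t / poly f1 t = poly f2 s / poly f1 s \<and>
    poly f3 t / poly f1 t = poly f3 s / poly f1 s}"
  shows "\<exists>e \<gamma> m. e > 0 \<and> (MOST s. card (fib s) = e) \<and> \<gamma> \<noteq> 0 \<and> total_degree2 \<gamma> m \<and>
    degree \<gamma> * e + degree (gcd f1 f2) = max (degree f1) (degree f2) \<and>
    m * e + degree (gcd (gcd f1 f2) f3) = max (max (degree f1) (degree f2)) (degree f3) \<and>
    (\<forall>G. (MOST t. ev2 G (poly f2 t / poly f1 t) (poly f3 t / poly f1 t) = 0) \<longleftrightarrow> \<gamma> dvd G)"
proof -
  define h where "h = gcd f1 f2"
  obtain p1 where p1: "f1 = h * p1" using gcd_dvd1[of f1 f2] unfolding h_def by (rule dvdE)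
  obtain p2 where p2: "f2 = h * p2" using gcd_dvd2[of f1 f2] unfolding h_def by (rule dvdE)
  note p = p1 p2
  have nz: "h \<noteq> 0" "p1 \<noteq> 0" using f1 p by auto
  have cop: "coprime p1 p2" using gcd_coprime[of f1 f2 p1 p2] p nz(1) by (metis h_def mult.commute)
  define \<delta> where "\<delta> = max (degree p1) (degree p2)"
  have \<delta>_pos: "\<delta> > 0"
  proof (rule ccontr)
    assume "\<not> \<delta> > 0"
    then have "degree p1 = 0" "degree p2 = 0" by (auto simp: \<delta>_def)
    then obtain a b where ab: "p1 = [:a:]" "p2 = [:b:]" by (metis degree_eq_zeroE)
    then have "a \<noteq> 0" using nz by auto
    then have "f2 = smult (b / a) f1" by (simp add: p ab)
    then show False using indep by blast
  qed
  \<comment> \<open>The first projection is to \<xi> itself: cancelling \<open>h\<close> leaves a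
    map of degree \<delta>, which yields the degree in \<zeta>.\<close>
  interpret A: rational_curve h p1 p2 f3 \<delta>
    by unfold_locales (use nz cop \<delta>_pos in \<open>simp_all add: \<delta>_def\<close>)
  have A_f1: "A.f1 = f1" by (simp add: A.f1_def p)
  have A_xi: "A.\<xi> t = poly f2 t / poly f1 t" if "poly f1 t \<noteq> 0" for t
    using that by (simp add: A.\<xi>_def p)
  have A_zeta: "A.\<zeta> t = poly f3 t / poly f1 t" for t
    by (simp add: A.\<zeta>_def A_f1)
  have MOST_f1: "MOST t. poly f1 t \<noteq> 0" by (rule MOST_poly_nonzero[OF f1])
  have A_fib: "A.fibre s = fib s" if "poly f1 s \<noteq> 0" for s
    using that by (auto simp: A.fibre_def fib_def A_f1 A_xi A_zeta)
  obtain e where "MOST s. poly A.f1 s \<noteq> 0 \<and> finite (A.fibre s) \<and> card (A.fibre s) = e"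
    using A.ex_generic_fibre by blast
  then have e: "MOST s. poly f1 s \<noteq> 0 \<and> card (fib s) = e"
    by eventually_elim (metis A_f1 A_fib)
  then have Ae: "A.generic_fibre e" unfolding A.generic_fibre_def
    by eventually_elim (metis A_fib)
  obtain \<gamma> where \<gamma>: "\<gamma> \<noteq> 0" "degree \<gamma> * e = \<delta>" "\<And>G. A.vanishes G \<longleftrightarrow> \<gamma> dvd G"
    using A.ex_generator[OF Ae] by blast
  have A_van: "A.vanishes G \<longleftrightarrow> (MOST t. ev2 G (poly f2 t / poly f1 t) (poly f3 t / poly f1 t) = 0)" for G
    unfolding A.vanishes_def by (intro eventually_cong[OF MOST_f1]) (simp add: A_xi A_zeta)
  obtain m where m: "total_degree2 \<gamma> m" using ex_total_degree2[OF \<gamma>(1)] by blast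
  have "max (degree f1) (degree f2) = degree h + \<delta>"
    unfolding p \<delta>_def using nz by (cases "p2 = 0") (simp_all add: degree_mult_eq)
  then have deg1: "degree \<gamma> * e + degree (gcd f1 f2) = max (degree f1) (degree f2)"
    using \<gamma>(2) by (simp add: h_def)

  \<comment> \<open>For the second projection only the common factor \<open>D\<close> of all three
    polynomials cancels: a general combination of \<open>f2\<close> and \<open>f3\<close> shares no
    further zero with \<open>f1\<close>.\<close>
  define D where "D = gcd h f3"
  obtain k where k1: "h = D * k" using gcd_dvd1[of h f3] unfolding D_def by (rule dvdE)
  obtain k3 where k3: "f3 = D * k3" using gcd_dvd2[of h f3] unfolding D_def by (rule dvdE)
  note k = k1 k3
  have D: "D \<noteq> 0" "k \<noteq> 0" using nz k by auto
  have cop3: "coprime k k3" using gcd_coprime[of h f3 k k3] k D(1) by (metis D_def mult.commute)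
  define k1 k2 where "k1 = k * p1" and "k2 = k * p2"
  have k12: "f1 = D * k1" "f2 = D * k2" by (simp_all add: p k k1_def k2_def mult_ac)
  have k1: "k1 \<noteq> 0" using f1 k12 by auto
  define M where "M = max (max (degree k1) (degree k2)) (degree k3)"
  have no_common: "poly k1 t = 0 \<Longrightarrow> poly k2 t \<noteq> 0 \<or> poly k3 t \<noteq> 0" for t
    using coprime_no_common_root[OF cop3] A.p1_0[of t] by (auto simp: k1_def k2_def)
  \<comment> \<open>Four conditions on \<open>u\<close>, each failing for finitely many values only:
    no new common root, no drop of the maximal degree, a nonconstant first coordinate, and a shear
    that brings out the total degree.\<close>
  have "MOST u. \<forall>t\<in>{t. poly k1 t = 0}. poly (k2 - smult u k3) t \<noteq> 0"
  proof (intro eventually_ball_finite ballI poly_roots_finite k1)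
    fix t assume "t \<in> {t. poly k1 t = 0}"
    then have "[:poly k2 t, - poly k3 t:] \<noteq> 0" using no_common by auto
    from MOST_poly_nonzero[OF this] show "MOST u. poly (k2 - smult u k3) t \<noteq> 0" by simp
  qed
  moreover have "MOST u. coeff (k2 - smult u k3) M \<noteq> 0 \<or> degree k1 = M"
  proof (cases "degree k1 = M")
    case False
    then have "degree k2 = M \<and> k2 \<noteq> 0 \<or> degree k3 = M \<and> k3 \<noteq> 0"
      by (auto simp: M_def max_def split: if_splits)
    then have "[:coeff k2 M, - coeff k3 M:] \<noteq> 0" by auto
    from MOST_poly_nonzero[OF this] show ?thesis by eventually_elim simp
  qed simp
  moreover have "MOST u. \<forall>c. f2 - smult u f3 \<noteq> smult c f1"
  proof -
    have "u = u'" if "f2 - smult u f3 = smult c f1" "f2 - smult u' f3 = smult c' f1" for u u' c c'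
    proof (rule ccontr)
      assume "u \<noteq> u'"
      have "smult (u' - u) f2 = smult u' (f2 - smult u f3) - smult u (f2 - smult u' f3)"
        by (simp add: smult_diff_right smult_diff_left mult.commute)
      also have "\<dots> = smult (u' * c - u * c') f1" by (simp add: that smult_diff_left)
      finally have "smult (1 / (u' - u)) (smult (u' - u) f2) = smult ((u' * c - u * c') / (u' - u)) f1" by simp
      then have "f2 = smult ((u' * c - u * c') / (u' - u)) f1" using \<open>u \<noteq> u'\<close> by simp
      then show False using indep by blast
    qed
    then have "\<exists>u0. {u. \<not> (\<forall>c. f2 - smult u f3 \<noteq> smult c f1)} \<subseteq> {u0}" by blast
    then show ?thesis unfolding eventually_cofinite by (meson finite.simps finite_subset)
  qed
  moreover note MOST_degree_shear[OF m]
  ultimately have "MOST u. (\<forall>t. poly k1 t = 0 \<longrightarrow> poly (k2 - smult u k3) t \<noteq> 0) \<and>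
    (coeff (k2 - smult u k3) M \<noteq> 0 \<or> degree k1 = M) \<and>
    (\<forall>c. f2 - smult u f3 \<noteq> smult c f1) \<and>
    (\<forall>Q. (\<forall>x y. ev2 Q x y = ev2 \<gamma> (x + u * y) y) \<longrightarrow> degree Q = m)"
    by eventually_elim blast
  from MOST_complex_ex[OF this] obtain u where u0: "(\<forall>t. poly k1 t = 0 \<longrightarrow> poly (k2 - smult u k3) t \<noteq> 0) \<and>
    (coeff (k2 - smult u k3) M \<noteq> 0 \<or> degree k1 = M) \<and>
    (\<forall>c. f2 - smult u f3 \<noteq> smult c f1) \<and>
    (\<forall>Q. (\<forall>x y. ev2 Q x y = ev2 \<gamma> (x + u * y) y) \<longrightarrow> degree Q = m)" by (rule exE)
  then have u: "\<And>t. poly k1 t = 0 \<Longrightarrow> poly (k2 - smult u k3) t \<noteq> 0"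
    "coeff (k2 - smult u k3) M \<noteq> 0 \<or> degree k1 = M" "\<And>c. f2 - smult u f3 \<noteq> smult c f1"
    "\<And>Q. (\<And>x y. ev2 Q x y = ev2 \<gamma> (x + u * y) y) \<Longrightarrow> degree Q = m"
    by blast+
  define g where "g = k2 - smult u k3"
  have Dg: "f2 - smult u f3 = D * g" by (simp add: g_def k12 k algebra_simps)
  have "degree g \<le> M" unfolding g_def by (intro degree_diff_le) (auto simp: M_def intro: le_trans[OF degree_smult_le])
  then have M: "M = max (degree k1) (degree g)"
    using u(2) le_degree[of g M] by (auto simp: g_def[symmetric] M_def)
  have "M > 0"
  proof (rule ccontr)
    assume "\<not> M > 0"
    then have "degree k1 = 0" "degree g = 0" by (auto simp: M)
    then obtain a b where ab: "k1 = [:a:]" "g = [:b:]" by (metis degree_eq_zeroE)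
    then have "a \<noteq> 0" using k1 by auto
    then have "f2 - smult u f3 = smult (b / a) f1" unfolding Dg k12(1) ab by simp
    then show False using u(3) by blast
  qed
  interpret B: rational_curve D k1 g f3 M
  proof unfold_locales
    show "coprime k1 g" using u(1) by (intro coprime_if_no_common_root) (simp add: g_def)
  qed (use D k1 M \<open>M > 0\<close> in simp_all)
  have B_f1: "B.f1 = f1" by (simp add: B.f1_def k12)
  have B_xi: "B.\<xi> t = (poly f2 t - u * poly f3 t) / poly f1 t" if "poly f1 t \<noteq> 0" for t
  proof -
    have "poly f2 t - u * poly f3 t = poly (f2 - smult u f3) t" by simp
    then show ?thesis using that unfolding Dg by (simp add: B.\<xi>_def k12)
  qed
  have B_zeta: "B.\<zeta> t = poly f3 t / poly f1 t" for t by (simp add: B.\<zeta>_def B_f1)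
  \<comment> \<open>A shear is invertible, so the fibres and with them \<open>e\<close> remain the
    same.\<close>
  have B_fib: "B.fibre s = fib s" if "poly f1 s \<noteq> 0" for s
    using that by (auto simp: B.fibre_def fib_def B_f1 B_xi B_zeta diff_divide_distrib simp flip: times_divide_eq_right)
  have Be: "B.generic_fibre e" unfolding B.generic_fibre_def using e
    by eventually_elim (metis B_fib)
  obtain \<gamma>' where \<gamma>': "\<gamma>' \<noteq> 0" "degree \<gamma>' * e = M" "\<And>G. B.vanishes G \<longleftrightarrow> \<gamma>' dvd G"
    using B.ex_generator[OF Be] by blast
  have shear: "\<exists>Q. \<forall>x y. ev2 Q x y = ev2 P (x + c * y) y" for P c
  proof -
    have "polyfun2 (\<lambda>x y. ev2 P (x + c * y) y)" by (intro polyfun2_ev2 polyfun2_intros)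
    then show ?thesis by (auto simp: polyfun2_def)
  qed
  obtain Q where Q: "\<And>x y. ev2 Q x y = ev2 \<gamma> (x + u * y) y" using shear by blast
  have degQ: "degree Q = m" by (rule u(4)[OF Q])
  have "A.vanishes \<gamma>" using \<gamma>(3) by simp
  then have "B.vanishes Q" unfolding A_van B.vanishes_def using MOST_f1
    by eventually_elim (simp add: Q B_xi B_zeta add_divide_distrib[symmetric])
  then have "\<gamma>' dvd Q" using \<gamma>'(3) by simp
  moreover have "Q \<noteq> 0"
  proof
    assume "Q = 0"
    then have "ev2 \<gamma> x y = ev2 0 x y" for x y using Q[of "x - u * y" y] by simp
    then show False using \<gamma>(1) ev2_eqI by blast
  qed
  \<comment> \<open>The shear \<open>Q\<close> of \<gamma> is a multiple of \<gamma>'. Shearing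
    \<gamma>' back gives the converse below, so the degree of \<gamma>' in \<zeta> is exactly
    \<open>m\<close>.\<close>
  ultimately have 1: "degree \<gamma>' \<le> m" unfolding degQ[symmetric] by (rule dvd_imp_degree_le)
  obtain R where R: "\<And>x y. ev2 R x y = ev2 \<gamma>' (x + (- u) * y) y" using shear by blast
  have "B.vanishes \<gamma>'" using \<gamma>'(3) by simp
  then have "A.vanishes R" unfolding A_van B.vanishes_def using MOST_f1
    by eventually_elim (simp add: R B_xi B_zeta diff_divide_distrib)
  then have "\<gamma> dvd R" using \<gamma>(3) by blast
  then obtain H where H: "R = \<gamma> * H" by (rule dvdE)
  obtain H' where H': "\<And>x y. ev2 H' x y = ev2 H (x + u * y) y" using shear by blast
  have "\<gamma>' = Q * H'"
  proof (rule ev2_eqI)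
    fix x y
    have "ev2 \<gamma>' x y = ev2 R (x + u * y) y" by (simp add: R)
    then show "ev2 \<gamma>' x y = ev2 (Q * H') x y" by (simp add: H Q H')
  qed
  then have 2: "m \<le> degree \<gamma>'" using \<gamma>'(1) degQ by (auto simp: degree_mult_eq)
  from 1 2 have "m * e = M" using \<gamma>'(2) by simp
  moreover have "degree D + M = max (max (degree f1) (degree f2)) (degree f3)"
    unfolding M_def k12 k(2) using D k1 by (cases "k2 = 0"; cases "k3 = 0") (simp_all add: degree_mult_eq)
  ultimately have "m * e + degree (gcd (gcd f1 f2) f3) = max (max (degree f1) (degree f2)) (degree f3)"
    by (simp add: D_def h_def)
  moreover have "MOST s. card (fib s) = e" using e by eventually_elim simp
  ultimately show ?thesis
    using A.generic_fibre_pos[OF Ae] \<gamma>(1) m deg1 \<gamma>(3) unfolding A_van by blast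
qed

section \<open>Polynomial functions and multiplicities\<close>

abbreviation lk :: "('a \<Rightarrow>\<^sub>0 'b::zero) \<Rightarrow> 'a \<Rightarrow> 'b" where "lk \<equiv> Poly_Mapping.lookup"

definition monomial :: "('n::finite \<Rightarrow>\<^sub>0 nat) \<Rightarrow> complex^'n \<Rightarrow> complex" where
  "monomial m x = (\<Prod>i\<in>UNIV. x $ i ^ lk m i)"

lemma monomial_add: "monomial (m + m') x = monomial m x * monomial m' x"
  by (simp add: monomial_def lookup_add power_add prod.distrib)

lemma monomial_0 [simp]: "monomial 0 x = 1"
  by (simp add: monomial_def)

lemma monomial_single [simp]: "monomial (Poly_Mapping.single i 1) x = x $ i"
proof -
  have "monomial (Poly_Mapping.single i 1) x = (\<Prod>j\<in>UNIV. if j = i then x $ i else 1)"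
    unfolding monomial_def by (intro prod.cong refl) (auto simp: lookup_single when_def)
  then show ?thesis by simp
qed

lemma eval_cpoly_superset:
  assumes "finite S" "Poly_Mapping.keys F \<subseteq> S"
  shows "eval_cpoly F x = (\<Sum>m\<in>S. lk F m * monomial m x)"
  unfolding eval_cpoly_def monomial_def[symmetric] using assms
  by (intro sum.mono_neutral_left) (auto simp: in_keys_iff)

lemma eval_cpoly_0 [simp]: "eval_cpoly 0 x = 0"
  by (simp add: eval_cpoly_def)

lemma eval_cpoly_single [simp]: "eval_cpoly (Poly_Mapping.single m c) x = c * monomial m x"
  by (subst eval_cpoly_superset[of "{m}"]) auto

lemma eval_cpoly_add [simp]: "eval_cpoly (F + G) x = eval_cpoly F x + eval_cpoly G x"
proof -
  let ?S = "Poly_Mapping.keys F \<union> Poly_Mapping.keys G"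
  have "Poly_Mapping.keys (F + G) \<subseteq> ?S" by (rule keys_add)
  then show ?thesis
    by (simp add: eval_cpoly_superset[of ?S] lookup_add algebra_simps sum.distrib)
qed

lemma eval_cpoly_sum [simp]: "eval_cpoly (\<Sum>i\<in>I. F i) x = (\<Sum>i\<in>I. eval_cpoly (F i) x)"
  by (induction I rule: infinite_finite_induct) simp_all

lemma cpoly_eq_sum_single:
  fixes F :: "'n::finite cpoly"
  shows "F = (\<Sum>m\<in>Poly_Mapping.keys F. Poly_Mapping.single m (lk F m))"
proof (rule poly_mapping_eqI)
  fix k
  have "lk (\<Sum>m\<in>Poly_Mapping.keys F. Poly_Mapping.single m (lk F m)) k =
      (\<Sum>m\<in>Poly_Mapping.keys F. if m = k then lk F k else 0)"
    unfolding lookup_sum by (intro sum.cong refl) (auto simp: lookup_single when_def)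
  then show "lk F k = lk (\<Sum>m\<in>Poly_Mapping.keys F. Poly_Mapping.single m (lk F m)) k"
    by (simp add: in_keys_iff)
qed

lemma eval_cpoly_mult [simp]: "eval_cpoly (F * G) x = eval_cpoly F x * eval_cpoly G x"
proof -
  have "F * G = (\<Sum>m\<in>Poly_Mapping.keys F. Poly_Mapping.single m (lk F m)) *
      (\<Sum>m\<in>Poly_Mapping.keys G. Poly_Mapping.single m (lk G m))"
    using cpoly_eq_sum_single[of F] cpoly_eq_sum_single[of G] by simp
  also have "\<dots> = (\<Sum>i\<in>Poly_Mapping.keys F. \<Sum>j\<in>Poly_Mapping.keys G.
      Poly_Mapping.single (i + j) (lk F i * lk G j))"
    by (simp add: sum_product mult_single)
  finally have FG: "F * G = \<dots>" .
  show ?thesis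
    unfolding FG eval_cpoly_sum eval_cpoly_single monomial_add
    unfolding eval_cpoly_def[of F] eval_cpoly_def[of G] monomial_def[symmetric] sum_product
    by (intro sum.cong refl) simp
qed

lemma eval_cpoly_1 [simp]: "eval_cpoly 1 x = 1"
  using eval_cpoly_single[of 0 1 x] by simp

lemma eval_cpoly_power [simp]: "eval_cpoly (F ^ k) x = eval_cpoly F x ^ k"
  by (induction k) simp_all

lemma eval_cpoly_uminus [simp]: "eval_cpoly (- F) x = - eval_cpoly F x"
  using eval_cpoly_add[of F "- F" x] by (simp add: add_eq_0_iff)

lemma eval_cpoly_diff [simp]: "eval_cpoly (F - G) x = eval_cpoly F x - eval_cpoly G x"
  using eval_cpoly_add[of F "- G" x] by simp

text \<open>Distinct monomials are distinct characters of the torus, hence linearly independent.\<close>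

lemma monomial_independent:
  assumes "finite K" "\<And>x. (\<Sum>m\<in>K. a m * monomial m x) = 0" "m \<in> K"
  shows "a m = 0"
  using assms
proof (induction K arbitrary: a m rule: finite_induct)
  case empty
  then show ?case by simp
next
  case (insert m' K)
  have K: "a k = 0" if k: "k \<in> K" for k
  proof -
    have "k \<noteq> m'" using k insert.hyps by auto
    then obtain i where i: "lk k i \<noteq> lk m' i" by (meson poly_mapping_eqI)
    \<comment> \<open>Doubling coordinate \<open>i\<close> separates the monomials \<open>k\<close>
      and \<open>m'\<close>; subtracting a multiple of the original relation from the scaled one
      then removes \<open>m'\<close>.\<close>
    define y :: "complex^'a" where "y = (\<chi> j. if j = i then 2 else 1)"
    have y: "monomial m y = 2 ^ lk m i" for m
    proof -
      have "monomial m y = (\<Prod>j\<in>UNIV. if j = i then 2 ^ lk m i else 1)"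
        unfolding monomial_def y_def by (intro prod.cong refl) auto
      then show ?thesis by simp
    qed
    have mul: "monomial m (\<chi> j. x $ j * y $ j) = monomial m x * monomial m y" for m x
      by (simp add: monomial_def power_mult_distrib prod.distrib)
    have "(\<Sum>m\<in>K. a m * (monomial m y - monomial m' y) * monomial m x) = 0" for x
    proof -
      have "(\<Sum>m\<in>insert m' K. a m * (monomial m y - monomial m' y) * monomial m x) =
          (\<Sum>m\<in>insert m' K. a m * monomial m (\<chi> j. x $ j * y $ j)) -
          monomial m' y * (\<Sum>m\<in>insert m' K. a m * monomial m x)"
        unfolding mul sum_distrib_left sum_subtractf[symmetric]
        by (intro sum.cong refl) (simp add: algebra_simps)
      also have "\<dots> = 0" by (simp only: insert.prems(1)) simp
      finally show ?thesis using insert.hyps by simp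
    qed
    from insert.IH[OF this k] have "a k * (monomial k y - monomial m' y) = 0" .
    moreover have "(2::complex) ^ lk k i \<noteq> 2 ^ lk m' i"
    proof
      assume "(2::complex) ^ lk k i = 2 ^ lk m' i"
      then have "norm ((2::complex) ^ lk k i) = norm ((2::complex) ^ lk m' i)" by simp
      then show False using i by (simp add: norm_power)
    qed
    ultimately show ?thesis by (simp add: y)
  qed
  have "(\<Sum>m\<in>insert m' K. a m * monomial m (\<chi> j. 1)) = a m'"
    using insert.hyps K by (simp add: monomial_def)
  then have "a m' = 0" using insert.prems(1) by metis
  with K insert.prems(2) show ?case by auto
qed

lemma eval_cpoly_eqI:
  assumes "\<And>x. eval_cpoly F x = eval_cpoly G x"
  shows "F = G"
proof -
  have "(\<Sum>m\<in>Poly_Mapping.keys (F - G). lk (F - G) m * monomial m x) = 0" for x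
    using assms[of x] eval_cpoly_diff[of F G x] by (simp add: eval_cpoly_def monomial_def)
  from monomial_independent[OF finite_keys this] have "lk (F - G) k = 0" for k
    by (cases "k \<in> Poly_Mapping.keys (F - G)") (auto simp: in_keys_iff)
  then have "F - G = 0" by (intro poly_mapping_eqI) simp
  then show ?thesis by simp
qed

lemma eval_cpoly_nonzero: "F \<noteq> 0 \<Longrightarrow> \<exists>x. eval_cpoly F x \<noteq> 0"
  using eval_cpoly_eqI[of F 0] by auto

lemma poly_restrict_line: "poly (restrict_line F x w) T = eval_cpoly F (x + T *s w)"
  unfolding restrict_line_def eval_cpoly_def by (simp add: poly_sum poly_prod mult.commute)

lemma restrict_line_eqI:
  "(\<And>T. poly R T = eval_cpoly F (x + T *s w)) \<Longrightarrow> restrict_line F x w = R"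
  by (intro poly_eqI_MOST MOST_I) (simp add: poly_restrict_line)

lemma restrict_line_mult: "restrict_line (F * G) x w = restrict_line F x w * restrict_line G x w"
  by (rule restrict_line_eqI) (simp add: poly_restrict_line)

lemma restrict_line_power: "restrict_line (F ^ k) x w = restrict_line F x w ^ k"
  by (rule restrict_line_eqI) (simp add: poly_restrict_line)

lemma restrict_line_to:
  "eval_cpoly F y \<noteq> 0 \<Longrightarrow> restrict_line F x (y - x) \<noteq> 0"
  using poly_restrict_line[of F x "y - x" 1] by auto

text \<open>On the line joining a point where \<open>F\<close> is not zero to one where
  \<open>G\<close> is not zero, both restrict to nonzero univariate polynomials.\<close>

lemma cpoly_no_zero_divisors:
  fixes F G :: "'n::finite cpoly"
  assumes "F * G = 0" "F \<noteq> 0"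
  shows "G = 0"
proof (rule ccontr)
  assume "G \<noteq> 0"
  then obtain y z where yz: "eval_cpoly F y \<noteq> 0" "eval_cpoly G z \<noteq> 0"
    using eval_cpoly_nonzero assms(2) by blast
  have "restrict_line F y (z - y) \<noteq> 0" using yz(1) poly_restrict_line[of F y "z - y" 0] by auto
  moreover have "restrict_line G y (z - y) \<noteq> 0" using yz(2) by (rule restrict_line_to)
  moreover have "restrict_line F y (z - y) * restrict_line G y (z - y) = 0"
    unfolding restrict_line_mult[symmetric] assms(1) by (rule restrict_line_eqI) simp
  ultimately show False by simp
qed

section \<open>Polynomial functions in several variables and divisibility\<close>

definition polyfun :: "(complex^'n::finite \<Rightarrow> complex) \<Rightarrow> bool" where
  "polyfun f \<longleftrightarrow> (\<exists>F. f = eval_cpoly F)"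

lemma polyfun_eval [simp]: "polyfun (eval_cpoly F)"
  by (auto simp: polyfun_def)

lemma polyfunI: "(\<And>x. f x = eval_cpoly F x) \<Longrightarrow> polyfun f"
  by (auto simp: polyfun_def)

lemma polyfun_const: "polyfun (\<lambda>x. c)"
  unfolding polyfun_def by (rule exI[of _ "Poly_Mapping.single 0 c"]) auto

lemma polyfun_var: "polyfun (\<lambda>x. x $ i)"
  unfolding polyfun_def
  by (rule exI[of _ "Poly_Mapping.single (Poly_Mapping.single i 1) 1"]) (auto simp del: One_nat_def)

lemma polyfun_add: "polyfun f \<Longrightarrow> polyfun g \<Longrightarrow> polyfun (\<lambda>x. f x + g x)"
proof -
  assume "polyfun f" "polyfun g"
  then obtain F G where "f = eval_cpoly F" "g = eval_cpoly G" by (auto simp: polyfun_def)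
  then show ?thesis by (intro polyfunI[of _ "F + G"]) simp
qed

lemma polyfun_diff: "polyfun f \<Longrightarrow> polyfun g \<Longrightarrow> polyfun (\<lambda>x. f x - g x)"
proof -
  assume "polyfun f" "polyfun g"
  then obtain F G where "f = eval_cpoly F" "g = eval_cpoly G" by (auto simp: polyfun_def)
  then show ?thesis by (intro polyfunI[of _ "F - G"]) simp
qed

lemma polyfun_mult: "polyfun f \<Longrightarrow> polyfun g \<Longrightarrow> polyfun (\<lambda>x. f x * g x)"
proof -
  assume "polyfun f" "polyfun g"
  then obtain F G where "f = eval_cpoly F" "g = eval_cpoly G" by (auto simp: polyfun_def)
  then show ?thesis by (intro polyfunI[of _ "F * G"]) simp
qed

lemma polyfun_power: "polyfun f \<Longrightarrow> polyfun (\<lambda>x. f x ^ k)"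
  by (induction k) (simp_all add: polyfun_const polyfun_mult)

lemma polyfun_sum: "(\<And>i. i \<in> I \<Longrightarrow> polyfun (f i)) \<Longrightarrow> polyfun (\<lambda>x. \<Sum>i\<in>I. f i x)"
  by (induction I rule: infinite_finite_induct) (simp_all add: polyfun_const polyfun_add)

lemmas polyfun_intros = polyfun_const polyfun_var polyfun_add polyfun_diff polyfun_mult
  polyfun_power polyfun_sum

text \<open>Induction on the formation of polynomials by sums and multiplication with one variable
  replaces the handling of exponent maps.\<close>

lemma polyfun_induct [consumes 1, case_names const var add]:
  assumes "polyfun f" and const: "\<And>c. P (\<lambda>x. c)"
    and var: "\<And>i f. polyfun f \<Longrightarrow> P f \<Longrightarrow> P (\<lambda>x. x $ i * f x)"
    and add: "\<And>f g. polyfun f \<Longrightarrow> polyfun g \<Longrightarrow> P f \<Longrightarrow> P g \<Longrightarrow> P (\<lambda>x. f x + g x)"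
  shows "P f"
proof -
  obtain F where F: "f = eval_cpoly F" using assms(1) by (auto simp: polyfun_def)
  have pw: "P (\<lambda>x. x $ i ^ k * g x) \<and> polyfun (\<lambda>x. x $ i ^ k * g x)" if "P g" "polyfun g" for i k g
  proof (induction k)
    case (Suc k)
    have "P (\<lambda>x. x $ i * (x $ i ^ k * g x))" using Suc by (intro var) auto
    moreover have "polyfun (\<lambda>x. x $ i * (x $ i ^ k * g x))"
      using Suc by (intro polyfun_mult[OF polyfun_var]) auto
    ultimately show ?case by (simp add: mult.assoc)
  qed (use that in simp)
  have mon: "P (\<lambda>x. (\<Prod>i\<in>A. x $ i ^ lk m i) * c) \<and> polyfun (\<lambda>x. (\<Prod>i\<in>A. x $ i ^ lk m i) * c)" if "finite A" for m c A
    using that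
  proof (induction A rule: finite_induct)
    case empty then show ?case by (simp add: const polyfun_const)
  next
    case (insert i A)
    have eq: "(\<lambda>x. (\<Prod>i\<in>insert i A. x $ i ^ lk m i) * c) =
        (\<lambda>x. x $ i ^ lk m i * ((\<Prod>i\<in>A. x $ i ^ lk m i) * c))"
      using insert.hyps by (simp add: mult_ac)
    show ?case unfolding eq by (rule pw[OF conjunct1[OF insert.IH] conjunct2[OF insert.IH]])
  qed
  have "P (\<lambda>x. \<Sum>m\<in>S. (\<Prod>i\<in>UNIV. x $ i ^ lk m i) * lk F m) \<and>
      polyfun (\<lambda>x. \<Sum>m\<in>S. (\<Prod>i\<in>UNIV. x $ i ^ lk m i) * lk F m)" if "finite S" for S
    using that
  proof (induction S rule: finite_induct)
    case empty then show ?case by (simp add: const polyfun_const)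
  next
    case (insert m S)
    have eq: "(\<lambda>x. \<Sum>m\<in>insert m S. (\<Prod>i\<in>UNIV. x $ i ^ lk m i) * lk F m) =
      (\<lambda>x. (\<Prod>i\<in>UNIV. x $ i ^ lk m i) * lk F m + (\<Sum>m\<in>S. (\<Prod>i\<in>UNIV. x $ i ^ lk m i) * lk F m))"
      using insert.hyps by simp
    show ?case unfolding eq
      by (intro conjI add polyfun_add conjunct1[OF insert.IH] conjunct2[OF insert.IH]
          conjunct1[OF mon[OF finite]] conjunct2[OF mon[OF finite]])
  qed
  from this[OF finite_keys[of F]]
  show ?thesis unfolding F eval_cpoly_def[abs_def] by (simp add: mult.commute)
qed

lemma dvd_cpoly_iff: "F dvd G \<longleftrightarrow> (\<exists>h. polyfun h \<and> (\<forall>x. eval_cpoly G x = eval_cpoly F x * h x))"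
proof
  assume "F dvd G"
  then obtain H where "G = F * H" by (rule dvdE)
  then show "\<exists>h. polyfun h \<and> (\<forall>x. eval_cpoly G x = eval_cpoly F x * h x)"
    by (intro exI[of _ "eval_cpoly H"]) simp
next
  assume "\<exists>h. polyfun h \<and> (\<forall>x. eval_cpoly G x = eval_cpoly F x * h x)"
  then obtain H where "\<forall>x. eval_cpoly G x = eval_cpoly F x * eval_cpoly H x" by (auto simp: polyfun_def)
  then have "G = F * H" by (intro eval_cpoly_eqI) simp
  then show "F dvd G" by simp
qed

text \<open>Division with remainder by a polynomial that is monic and linear in the variable
  \<open>x $ k\<close>.\<close>

lemma polyfun_divide_hyperplane:
  assumes "polyfun f"
  shows "\<exists>g. polyfun g \<and> (\<forall>x. f x = (x $ k - d) * g x + f (\<chi> i. if i = k then d else x $ i))"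
  using assms
proof (induction f rule: polyfun_induct)
  case (const c)
  then show ?case by (intro exI[of _ "\<lambda>_. 0"]) (simp add: polyfun_const)
next
  case (var i f)
  then obtain g where g: "polyfun g" "\<And>x. f x = (x $ k - d) * g x + f (\<chi> i. if i = k then d else x $ i)" by blast
  show ?case
  proof (cases "i = k")
    case True
    show ?thesis
    proof (intro exI[of _ "\<lambda>x. f x + d * g x"] conjI allI)
      fix x
      show "x $ i * f x = (x $ k - d) * (f x + d * g x) +
          (\<chi> i. if i = k then d else x $ i) $ i * f (\<chi> i. if i = k then d else x $ i)"
        using True arg_cong[OF g(2)[of x], of "\<lambda>y. d * y"] by (simp add: algebra_simps)
    qed (intro polyfun_intros var g)
  next
    case False
    show ?thesis
    proof (intro exI[of _ "\<lambda>x. x $ i * g x"] conjI allI)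
      fix x
      show "x $ i * f x = (x $ k - d) * (x $ i * g x) +
          (\<chi> i. if i = k then d else x $ i) $ i * f (\<chi> i. if i = k then d else x $ i)"
        using False by (subst g(2)) (simp add: algebra_simps)
    qed (intro polyfun_intros g)
  qed
next
  case (add f f')
  then obtain g g' where g: "polyfun g" "\<And>x. f x = (x $ k - d) * g x + f (\<chi> i. if i = k then d else x $ i)"
    "polyfun g'" "\<And>x. f' x = (x $ k - d) * g' x + f' (\<chi> i. if i = k then d else x $ i)" by blast
  show ?case
  proof (intro exI[of _ "\<lambda>x. g x + g' x"] conjI allI polyfun_add g)
    fix x
    show "f x + f' x = (x $ k - d) * (g x + g' x) +
        (f (\<chi> i. if i = k then d else x $ i) + f' (\<chi> i. if i = k then d else x $ i))"
      using g(2)[of x] g(4)[of x] by (simp add: algebra_simps)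
  qed
qed

text \<open>The linear polynomial is prime and, by the point \<open>y\<close>, does not divide
  \<open>F\<close>; so all its factors on the right-hand side are absorbed by \<open>h\<close>. This
  removes the powers that arise from clearing denominators.\<close>

lemma dvd_cancel_hyperplane:
  fixes F G :: "'n::finite cpoly"
  assumes "polyfun h" "\<And>x. eval_cpoly F x * h x = (x $ k - d) ^ N * eval_cpoly G x"
    and y: "y $ k = d" "eval_cpoly F y \<noteq> 0"
  shows "F dvd G"
  using assms(1,2)
proof (induction N arbitrary: h)
  case 0
  then show ?case unfolding dvd_cpoly_iff by (intro exI[of _ h]) simp
next
  case (Suc N)
  obtain H where H: "h = eval_cpoly H" using Suc.prems(1) by (auto simp: polyfun_def)
  obtain g where g: "polyfun g" "\<And>x. h x = (x $ k - d) * g x + h (\<chi> i. if i = k then d else x $ i)"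
    using polyfun_divide_hyperplane[OF Suc.prems(1)] by blast
  \<comment> \<open>On the hyperplane the product of \<open>F\<close> and \<open>h\<close> is zero.
    The line from \<open>y\<close> to \<open>z\<close> lies in it, and \<open>F\<close> is not
    identically zero there, so \<open>h\<close> is.\<close>
  have "h z = 0" if z: "z $ k = d" for z
  proof (rule ccontr)
    assume hz: "h z \<noteq> 0"
    have "restrict_line F y (z - y) \<noteq> 0" using y(2) poly_restrict_line[of F y "z - y" 0] by auto
    moreover have "restrict_line H y (z - y) \<noteq> 0" using hz H by (intro restrict_line_to) simp
    moreover have "restrict_line F y (z - y) * restrict_line H y (z - y) = 0"
    proof (intro poly_eqI_MOST MOST_I)
      fix T
      show "poly (restrict_line F y (z - y) * restrict_line H y (z - y)) T = poly 0 T"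
        using Suc.prems(2)[of "y + T *s (z - y)"] y(1) z by (simp add: poly_restrict_line H)
    qed
    ultimately show False by simp
  qed
  then have hg: "h x = (x $ k - d) * g x" for x using g(2)[of x] by simp
  have "eval_cpoly F x * g x = (x $ k - d) ^ N * eval_cpoly G x" for x
  proof -
    have "polyfun (\<lambda>x. eval_cpoly F x * g x - (x $ k - d) ^ N * eval_cpoly G x)"
      by (intro polyfun_intros polyfun_eval g)
    then obtain D where D: "eval_cpoly D = (\<lambda>x. eval_cpoly F x * g x - (x $ k - d) ^ N * eval_cpoly G x)"
      by (auto simp: polyfun_def)
    have "polyfun (\<lambda>x::complex^'n. x $ k - d)" by (intro polyfun_intros)
    then obtain L where L: "eval_cpoly L = (\<lambda>x::complex^'n. x $ k - d)" by (metis polyfun_def)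
    have "L \<noteq> 0" using fun_cong[OF L, of "\<chi> i. d + 1"] by auto
    moreover have "L * D = 0"
      by (rule eval_cpoly_eqI) (use Suc.prems(2) in \<open>simp add: L D hg algebra_simps\<close>)
    ultimately have "D = 0" by (rule cpoly_no_zero_divisors[rotated])
    then show ?thesis using fun_cong[OF D, of x] by simp
  qed
  then show ?case using Suc.IH g(1) by blast
qed

definition ideal_generator :: "(complex^'n::finite) set \<Rightarrow> 'n cpoly \<Rightarrow> bool" where
  "ideal_generator X F \<longleftrightarrow> F \<noteq> 0 \<and> (\<forall>G. F dvd G \<longleftrightarrow> (\<forall>x\<in>X. eval_cpoly G x = 0))"

text \<open>Two generators divide each other and differ by a unit. A unit restricts to a unit, hence
  to a constant, on every line through the origin.\<close>

lemma implicit_poly_eq: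
  assumes "ideal_generator X F"
  shows "\<exists>c. c \<noteq> 0 \<and> (\<forall>x. eval_cpoly (implicit_poly X) x = c * eval_cpoly F x)"
proof -
  let ?G = "implicit_poly X"
  have "ideal_generator X ?G"
    using someI[of "\<lambda>F. F \<noteq> 0 \<and> (\<forall>G. F dvd G \<longleftrightarrow> (\<forall>x\<in>X. eval_cpoly G x = 0))" F] assms
    unfolding ideal_generator_def implicit_poly_def by blast
  then have dv: "?G dvd F" "F dvd ?G" and nz: "F \<noteq> 0"
    using assms unfolding ideal_generator_def by (metis dvd_refl)+
  obtain U where U: "?G = F * U" using dv(2) by (rule dvdE)
  obtain V where V: "F = ?G * V" using dv(1) by (rule dvdE)
  have "F * (U * V - 1) = 0" using U V by (simp add: algebra_simps)
  then have UV: "U * V = 1" using cpoly_no_zero_divisors[OF _ nz] by fastforce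
  have const: "eval_cpoly U x = eval_cpoly U 0" for x
  proof -
    have "restrict_line U 0 x * restrict_line V 0 x = restrict_line 1 0 x"
      unfolding restrict_line_mult[symmetric] UV ..
    also have "\<dots> = 1" by (rule restrict_line_eqI) simp
    finally have "is_unit (restrict_line U 0 x)" by (metis dvd_triv_left)
    then obtain c where "restrict_line U 0 x = [:c:]" by (auto simp: is_unit_poly_iff)
    then show ?thesis
      using poly_restrict_line[of U 0 x 1] poly_restrict_line[of U 0 x 0] by simp
  qed
  have "eval_cpoly U 0 * eval_cpoly V 0 = 1"
    using arg_cong[OF UV, of "\<lambda>F. eval_cpoly F 0"] by simp
  then have "eval_cpoly U 0 \<noteq> 0" by auto
  moreover have "eval_cpoly ?G x = eval_cpoly U 0 * eval_cpoly F x" for x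
    by (subst U) (simp add: const[of x])
  ultimately show ?thesis by blast
qed

text \<open>Homogeneity is used at T = 2 only: by independence of the monomials, 2^s = 2^D for every
  degree s that occurs.\<close>

lemma total_degree_eqI:
  fixes F :: "'n::finite cpoly"
  assumes "F \<noteq> 0" "\<And>x T. eval_cpoly F (T *s x) = T ^ D * eval_cpoly F x"
  shows "total_degree F = D"
proof -
  define s where "s m = (\<Sum>i\<in>UNIV. lk m i)" for m :: "'n \<Rightarrow>\<^sub>0 nat"
  have mon: "monomial m (T *s x) = T ^ s m * monomial m x" for m T and x :: "complex^'n"
    by (simp add: monomial_def power_mult_distrib prod.distrib s_def power_sum)
  have sD: "s m = D" if m: "m \<in> Poly_Mapping.keys F" for m
  proof -
    have "(\<Sum>m\<in>Poly_Mapping.keys F. (lk F m * (2 ^ s m - 2 ^ D)) * monomial m x) = 0" for x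
      using assms(2)[of 2 x] unfolding eval_cpoly_def monomial_def[symmetric] mon
      by (simp add: sum_distrib_left right_diff_distrib left_diff_distrib sum_subtractf mult_ac)
    from monomial_independent[OF finite_keys this m]
    have "(2::complex) ^ s m = 2 ^ D" using m by (simp add: in_keys_iff)
    then have "norm ((2::complex) ^ s m) = norm ((2::complex) ^ D)" by simp
    then show ?thesis by (simp add: norm_power)
  qed
  obtain m where "m \<in> Poly_Mapping.keys F" using assms(1) by fastforce
  then have "s ` Poly_Mapping.keys F = {D}" using sD by auto
  then show ?thesis unfolding total_degree_def s_def by simp
qed

section \<open>Multiplicity at a point\<close>

lemma mult_at_le: "restrict_line F x w \<noteq> 0 \<Longrightarrow> mult_at F x \<le> order 0 (restrict_line F x w)"
  unfolding mult_at_def by (intro cINF_lower) auto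

lemma mult_at_attained:
  assumes "F \<noteq> 0"
  obtains w where "restrict_line F x w \<noteq> 0" "mult_at F x = order 0 (restrict_line F x w)"
proof -
  obtain y where "eval_cpoly F y \<noteq> 0" using eval_cpoly_nonzero[OF assms] by blast
  then have "{w. restrict_line F x w \<noteq> 0} \<noteq> {}" using restrict_line_to by blast
  then have "Inf ((\<lambda>w. order 0 (restrict_line F x w)) ` {w. restrict_line F x w \<noteq> 0})
      \<in> (\<lambda>w. order 0 (restrict_line F x w)) ` {w. restrict_line F x w \<noteq> 0}"
    by (intro Inf_nat_def1) simp
  then show thesis using that unfolding mult_at_def by blast
qed

text \<open>The factor T^k has to split off along every line, while a single direction with a
  cofactor not vanishing at T = 0 bounds the minimum from above.\<close>

lemma mult_at_eqI:
  assumes "\<And>w. \<exists>R. \<forall>T. eval_cpoly F (x + T *s w) = T ^ k * poly R T"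
    and "\<exists>w R. (\<forall>T. eval_cpoly F (x + T *s w) = T ^ k * poly R T) \<and> poly R 0 \<noteq> 0"
  shows "mult_at F x = k"
proof (rule antisym)
  obtain w R where wR: "\<And>T. eval_cpoly F (x + T *s w) = T ^ k * poly R T" "poly R 0 \<noteq> 0"
    using assms(2) by blast
  have eq: "restrict_line F x w = [:0, 1:] ^ k * R" by (rule restrict_line_eqI) (simp add: wR)
  have nz: "R \<noteq> 0" using wR(2) by auto
  have "order 0 (restrict_line F x w) = order 0 ([:- 0, 1::complex:] ^ k) + order 0 R"
    unfolding eq using nz by (subst order_mult) auto
  also have "\<dots> = k" unfolding order_power_n_n using order_0I[OF wR(2)] by simp
  finally show "mult_at F x \<le> k" using mult_at_le[of F x w] nz by (simp add: eq)
  have "F \<noteq> 0"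
  proof
    assume "F = 0"
    then have "restrict_line F x w = 0" by (intro restrict_line_eqI) simp
    then show False using nz by (simp add: eq)
  qed
  then obtain w' where w': "restrict_line F x w' \<noteq> 0" "mult_at F x = order 0 (restrict_line F x w')"
    by (rule mult_at_attained)
  obtain R' where R': "\<And>T. eval_cpoly F (x + T *s w') = T ^ k * poly R' T" using assms(1) by blast
  have "restrict_line F x w' = [:- 0, 1:] ^ k * R'" by (rule restrict_line_eqI) (simp add: R')
  then have "[:- 0, 1:] ^ k dvd restrict_line F x w'" by simp
  then show "k \<le> mult_at F x" using w' unfolding order_divides by simp
qed

lemma order_power: "p \<noteq> 0 \<Longrightarrow> order x (p ^ e) = e * order x (p :: complex poly)"
  by (induction e) (simp_all add: order_mult)

lemma mult_at_power:
  assumes "F \<noteq> 0"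
  shows "mult_at (F ^ e) x = e * mult_at F x"
proof (rule antisym)
  obtain w where w: "restrict_line F x w \<noteq> 0" "mult_at F x = order 0 (restrict_line F x w)"
    using assms by (rule mult_at_attained)
  then show "mult_at (F ^ e) x \<le> e * mult_at F x"
    using mult_at_le[of "F ^ e" x w] by (simp add: restrict_line_power order_power)
  obtain y where "eval_cpoly F y \<noteq> 0" using eval_cpoly_nonzero[OF assms] by blast
  then have "eval_cpoly (F ^ e) y \<noteq> eval_cpoly 0 y" by simp
  then have "F ^ e \<noteq> 0" by metis
  then obtain w' where w': "restrict_line (F ^ e) x w' \<noteq> 0"
    "mult_at (F ^ e) x = order 0 (restrict_line (F ^ e) x w')" by (rule mult_at_attained)
  show "e * mult_at F x \<le> mult_at (F ^ e) x"
  proof (cases "e = 0")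
    case False
    then have "restrict_line F x w' \<noteq> 0" using w'(1) by (auto simp: restrict_line_power zero_power)
    then show ?thesis using w'(2) mult_at_le[of F x w'] by (simp add: restrict_line_power order_power)
  qed simp
qed

lemma mult_at_pos_iff:
  assumes "F \<noteq> 0"
  shows "mult_at F x > 0 \<longleftrightarrow> eval_cpoly F x = 0"
proof
  assume z: "eval_cpoly F x = 0"
  obtain w where w: "restrict_line F x w \<noteq> 0" "mult_at F x = order 0 (restrict_line F x w)"
    using assms by (rule mult_at_attained)
  have "poly (restrict_line F x w) 0 = 0" using z by (simp add: poly_restrict_line)
  then show "mult_at F x > 0" using w by (simp add: order_root)
next
  assume pos: "mult_at F x > 0"
  show "eval_cpoly F x = 0"
  proof (rule ccontr)
    assume z: "eval_cpoly F x \<noteq> 0"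
    then have "poly (restrict_line F x 0) 0 \<noteq> 0" by (simp add: poly_restrict_line)
    then have "restrict_line F x 0 \<noteq> 0" "order 0 (restrict_line F x 0) = 0" by (auto intro: order_0I)
    then show False using mult_at_le[of F x 0] pos by simp
  qed
qed

lemma mult_at_scale:
  assumes "c \<noteq> 0" "\<And>x. eval_cpoly G x = c * eval_cpoly F x"
  shows "mult_at G x = mult_at F x"
proof -
  have "restrict_line G x w = smult c (restrict_line F x w)" for w
    by (rule restrict_line_eqI) (simp add: poly_restrict_line assms(2))
  then show ?thesis using assms(1) unfolding mult_at_def by (simp add: order_smult)
qed

section \<open>Equations obtained by homogenization\<close>

text \<open>
  The homogenization \<open>\<Sum> c\<^sub>i\<^sub>j s\<^sub>1\<^sup>m\<^sup>-\<^sup>i\<^sup>-\<^sup>j s\<^sub>2\<^sup>i s\<^sub>3\<^sup>j\<close> of \<open>P = \<Sum> c\<^sub>i\<^sub>j \<xi>\<^sup>i \<zeta>\<^sup>j\<close>, with a further variable \<open>a\<close> that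
  makes up for the missing powers of \<open>s\<^sub>3\<close>.
\<close>

definition hom2 :: "complex poly poly \<Rightarrow> nat \<Rightarrow> complex \<Rightarrow> complex \<Rightarrow> complex \<Rightarrow> complex \<Rightarrow> complex" where
  "hom2 P m a s1 s2 s3 = (\<Sum>j\<le>degree P. \<Sum>i\<le>m.
    coeff (coeff P j) i * a ^ (degree P - j) * s1 ^ (m - i - j) * s2 ^ i * s3 ^ j)"

lemma polyfun_hom2:
  "polyfun a \<Longrightarrow> polyfun f \<Longrightarrow> polyfun g \<Longrightarrow> polyfun h \<Longrightarrow>
    polyfun (\<lambda>x. hom2 P m (a x) (f x) (g x) (h x))"
  unfolding hom2_def by (intro polyfun_intros)

lemma ex_poly_hom2:
  "\<exists>R. \<forall>T. poly R T = hom2 P m (poly A T) (poly B T) (poly C T) (poly D T)"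
  by (rule exI[of _ "\<Sum>j\<le>degree P. \<Sum>i\<le>m. smult (coeff (coeff P j) i)
      (A ^ (degree P - j) * B ^ (m - i - j) * C ^ i * D ^ j)"])
    (simp add: hom2_def poly_sum mult_ac)

locale plane_curve_equation =
  fixes P :: "complex poly poly" and m :: nat
  assumes tdeg: "total_degree2 P m"
begin

abbreviation "L \<equiv> degree P"
abbreviation "c i j \<equiv> coeff (coeff P j) i"
abbreviation "W \<equiv> hom2 P m"

lemma P_nz: "P \<noteq> 0" using tdeg by (auto simp: total_degree2_def)

lemma L_le: "L \<le> m" by (rule total_degree2_expand(2)[OF tdeg])

lemma c_0: "m < i + j \<Longrightarrow> c i j = 0"
  using tdeg unfolding total_degree2_def by (meson not_le)

text \<open>Scaling laws of \<open>W\<close> reduce to single monomials. The truncated subtractions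
  in the exponents are exact in all terms that matter, because the coefficients with i + j > m are
  zero.\<close>

lemma W_cong:
  assumes "\<And>i j. i + j \<le> m \<Longrightarrow> j \<le> L \<Longrightarrow>
    C * (a ^ (L - j) * s1 ^ (m - i - j) * s2 ^ i * s3 ^ j) =
    C' * (a' ^ (L - j) * s1' ^ (m - i - j) * s2' ^ i * s3' ^ j)"
  shows "C * W a s1 s2 s3 = C' * W a' s1' s2' s3'"
  unfolding hom2_def sum_distrib_left
proof (intro sum.cong refl)
  fix i j assume j: "j \<in> {..L}"
  show "C * (c i j * a ^ (L - j) * s1 ^ (m - i - j) * s2 ^ i * s3 ^ j) =
      C' * (c i j * a' ^ (L - j) * s1' ^ (m - i - j) * s2' ^ i * s3' ^ j)"
  proof (cases "i + j \<le> m")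
    case True
    from arg_cong[OF assms[OF this], of "\<lambda>z. c i j * z"] j show ?thesis by (simp add: mult_ac)
  qed (simp add: c_0)
qed

text \<open>The exponents add up to (L - j) + (m - i - j) + i + 2 j = L + m; with a quadratic form
  in the last place this is the order of the surface.\<close>

lemma W_scale: "W (T * a) (T * s1) (T * s2) (T\<^sup>2 * s3) = T ^ (L + m) * W a s1 s2 s3"
proof -
  have "1 * W (T * a) (T * s1) (T * s2) (T\<^sup>2 * s3) = T ^ (L + m) * W a s1 s2 s3"
  proof (rule W_cong)
    fix i j assume ij: "i + j \<le> m" "j \<le> L"
    have "T ^ (L - j) * T ^ (m - i - j) * T ^ i * (T\<^sup>2) ^ j = T ^ (L + m)"
      unfolding power_mult[symmetric] power_add[symmetric] using ij by (intro arg_cong[of _ _ "power T"]) simp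
    then show "1 * ((T * a) ^ (L - j) * (T * s1) ^ (m - i - j) * (T * s2) ^ i * (T\<^sup>2 * s3) ^ j) =
        T ^ (L + m) * (a ^ (L - j) * s1 ^ (m - i - j) * s2 ^ i * s3 ^ j)"
      by (simp add: power_mult_distrib mult_ac flip: \<open>_ = T ^ (L + m)\<close>)
  qed
  then show ?thesis by simp
qed

text \<open>The exponents add up to (L - j) + j = L. Along the absolute conic x0 and the quadric
  vanish, which makes \<open>L\<close> its multiplicity.\<close>

lemma W_conic: "W (T * a) s1 s2 (T * s3) = T ^ L * W a s1 s2 s3"
proof -
  have "1 * W (T * a) s1 s2 (T * s3) = T ^ L * W a s1 s2 s3"
  proof (rule W_cong)
    fix i j assume ij: "i + j \<le> m" "j \<le> L"
    have "T ^ (L - j) * T ^ j = T ^ L"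
      unfolding power_add[symmetric] using ij by simp
    then show "1 * ((T * a) ^ (L - j) * s1 ^ (m - i - j) * s2 ^ i * (T * s3) ^ j) =
        T ^ L * (a ^ (L - j) * s1 ^ (m - i - j) * s2 ^ i * s3 ^ j)"
      by (simp add: power_mult_distrib mult_ac flip: \<open>_ = T ^ L\<close>)
  qed
  then show ?thesis by simp
qed

text \<open>Here (m - i - j) + i = (m - L) + (L - j). On the axis x1 and x2 vanish, which gives the
  multiplicity m - L; the surplus T^(L - j) is handed over to \<open>a\<close>.\<close>

lemma W_axis: "W a (T * s1) (T * s2) s3 = T ^ (m - L) * W (T * a) s1 s2 s3"
proof -
  have "1 * W a (T * s1) (T * s2) s3 = T ^ (m - L) * W (T * a) s1 s2 s3"
  proof (rule W_cong)
    fix i j assume ij: "i + j \<le> m" "j \<le> L"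
    have "T ^ (m - i - j) * T ^ i = T ^ (m - L) * T ^ (L - j)"
      unfolding power_add[symmetric] using ij L_le by (intro arg_cong[of _ _ "power T"]) simp
    then show "1 * (a ^ (L - j) * (T * s1) ^ (m - i - j) * (T * s2) ^ i * s3 ^ j) =
        T ^ (m - L) * ((T * a) ^ (L - j) * s1 ^ (m - i - j) * s2 ^ i * s3 ^ j)"
      by (simp add: power_mult_distrib)
  qed
  then show ?thesis by simp
qed

text \<open>The exponents add up to (m - i - j) + i + j = m. At the base points x1, x2 and the
  quadric vanish together.\<close>

lemma W_homogeneous: "W a (T * s1) (T * s2) (T * s3) = T ^ m * W a s1 s2 s3"
proof -
  have "1 * W a (T * s1) (T * s2) (T * s3) = T ^ m * W a s1 s2 s3"
  proof (rule W_cong)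
    fix i j assume ij: "i + j \<le> m" "j \<le> L"
    have "T ^ (m - i - j) * T ^ i * T ^ j = T ^ m"
      unfolding power_add[symmetric] using ij by (intro arg_cong[of _ _ "power T"]) simp
    then show "1 * (a ^ (L - j) * (T * s1) ^ (m - i - j) * (T * s2) ^ i * (T * s3) ^ j) =
        T ^ m * (a ^ (L - j) * s1 ^ (m - i - j) * s2 ^ i * s3 ^ j)"
      by (simp add: power_mult_distrib mult_ac flip: \<open>_ = T ^ m\<close>)
  qed
  then show ?thesis by simp
qed

lemma W_1_1: "W 1 1 x y = ev2 P x y"
  by (simp add: hom2_def total_degree2_expand(1)[OF tdeg])

lemma W_affine:
  assumes "a \<noteq> 0" "s1 \<noteq> 0"
  shows "W a s1 s2 s3 = a ^ L * s1 ^ m * ev2 P (s2 / s1) (s3 / (a * s1))"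
proof -
  have "W a s1 s2 s3 = W (a * 1) (s1 * 1) (s1 * (s2 / s1)) (a * (s3 / a))" using assms by simp
  also have "\<dots> = a ^ L * W 1 (s1 * 1) (s1 * (s2 / s1)) (s1 * (s3 / (a * s1)))"
    unfolding W_conic using assms by simp
  also have "\<dots> = a ^ L * (s1 ^ m * ev2 P (s2 / s1) (s3 / (a * s1)))"
    unfolding W_homogeneous W_1_1 ..
  finally show ?thesis by simp
qed

text \<open>At a = 0 only the terms with j = L survive, since 0^0 = 1; they form the leading
  coefficient in \<zeta>.\<close>

lemma W_0: "W 0 1 s2 s3 = s3 ^ L * poly (lead_coeff P) s2"
proof -
  have "W 0 1 s2 s3 = (\<Sum>j\<le>L. if j = L then \<Sum>i\<le>m. c i j * s2 ^ i * s3 ^ j else 0)"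
    unfolding hom2_def by (intro sum.cong refl) (auto simp: power_0_left)
  also have "\<dots> = (\<Sum>i\<le>m. c i L * s2 ^ i) * s3 ^ L" by (simp add: sum_distrib_right)
  also have "(\<Sum>i\<le>m. c i L * s2 ^ i) = poly (lead_coeff P) s2"
    by (rule poly_eq_sum_le[symmetric], rule degree_le) (auto simp: c_0)
  finally show ?thesis by simp
qed

lemma MOST_W_0: "s3 \<noteq> 0 \<Longrightarrow> MOST s2. W 0 1 s2 s3 \<noteq> 0"
  unfolding W_0 using MOST_poly_nonzero[of "lead_coeff P"] P_nz by (auto elim: eventually_mono)

text \<open>At s1 = 0 only the form of degree \<open>m\<close> survives, and it is not zero. So the
  equation is not divisible by s1.\<close>

lemma ex_W_1_0: "\<exists>s2. W 1 0 s2 1 \<noteq> 0"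
proof -
  define T where "T = (\<Sum>j\<le>L. \<Sum>i\<le>m. if i + j = m then monom (c i j) i else 0)"
  have coeff_T: "coeff T i = c i (m - i)" if "i \<le> m" for i
  proof -
    have "coeff T i = (\<Sum>j\<le>L. \<Sum>k\<le>m. if k = i then (if j = m - i then c i j else 0) else 0)"
      unfolding T_def coeff_sum using that by (intro sum.cong refl) auto
    also have "\<dots> = c i (m - i)" using that by (auto simp: coeff_eq_0)
    finally show ?thesis .
  qed
  obtain i j where ij: "c i j \<noteq> 0" "i + j = m"
    using tdeg by (auto simp: total_degree2_def)
  then have "coeff T i \<noteq> 0" by (subst coeff_T) (auto simp flip: ij(2))
  then have "T \<noteq> 0" by auto
  then obtain s where s: "poly T s \<noteq> 0" using MOST_complex_ex[OF MOST_poly_nonzero] by blast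
  have "W 1 0 s 1 = poly T s" unfolding hom2_def T_def poly_sum
  proof (intro sum.cong refl)
    fix i j
    show "c i j * 1 ^ (L - j) * 0 ^ (m - i - j) * s ^ i * 1 ^ j =
        poly (if i + j = m then monom (c i j) i else 0) s"
      using c_0[of i j] by (cases "i + j = m"; cases "i + j < m") (auto simp: poly_monom power_0_left)
  qed
  with s show ?thesis by (intro exI[of _ s]) simp
qed

end

text \<open>
  The equation of a plane curve, from the equation of its image under
  \<open>(x, y) \<mapsto> ((y - D\<^sub>2)/(x - D\<^sub>1), 1/(x - D\<^sub>1))\<close>.
\<close>

context plane_curve_equation
begin

lemma mult_at_plane_curve:
  assumes F: "\<And>v::complex^2. eval_cpoly F v = W 1 (v $ 1 - D1) (v $ 2 - D2) 1"
  shows "mult_at F (vector [D1, D2]) = m - L"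
proof (rule mult_at_eqI)
  have line: "eval_cpoly F (vector [D1, D2] + T *s w) = T ^ (m - L) * W T (w $ 1) (w $ 2) 1" for T w
    using W_axis[of 1 T "w $ 1" "w $ 2" 1] by (simp add: F)
  have R: "\<exists>R. \<forall>T. poly R T = W T s1 s2 1" for s1 s2
    using ex_poly_hom2[of P m "[:0, 1:]" "[:s1:]" "[:s2:]" "[:1:]"] by simp
  show "\<exists>R. \<forall>T. eval_cpoly F (vector [D1, D2] + T *s w) = T ^ (m - L) * poly R T" for w
  proof -
    obtain R where "\<And>T. poly R T = W T (w $ 1) (w $ 2) 1" using R by blast
    then show ?thesis unfolding line by (intro exI[of _ R]) simp
  qed
  \<comment> \<open>A direction (1, s2) that is no root of the leading coefficient of
    \<open>P\<close>, that is, no tangent direction at the point.\<close>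
  obtain s2 where s2: "W 0 1 s2 1 \<noteq> 0" using MOST_complex_ex[OF MOST_W_0[of 1]] by auto
  obtain R where "\<And>T. poly R T = W T 1 s2 1" using R by blast
  then show "\<exists>w R. (\<forall>T. eval_cpoly F (vector [D1, D2] + T *s w) = T ^ (m - L) * poly R T) \<and> poly R 0 \<noteq> 0"
    unfolding line using s2 by (intro exI[of _ "vector [1, s2]"] exI[of _ R]) simp
qed

text \<open>The change of coordinates has the inverse x = D1 + 1 / \<zeta>, y = D2 + \<xi> /
  \<zeta>. A vanishing \<open>G\<close> is carried over, divided by \<open>P\<close> and carried
  back. The powers of x - D1 that arise are cancelled, because \<open>F\<close> is not identically
  zero on the line x = D1, as the point \<open>y0\<close> shows.\<close>

lemma ideal_generator_plane_curve:
  fixes x y :: "complex \<Rightarrow> complex"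
  assumes gen: "\<And>G. (MOST t. ev2 G ((y t - D2) / (x t - D1)) (1 / (x t - D1)) = 0) \<longleftrightarrow> P dvd G"
    and nz: "MOST t. x t \<noteq> D1"
    and X: "\<And>G. (\<forall>v\<in>X. eval_cpoly G v = 0) \<longleftrightarrow> (MOST t. eval_cpoly G (vector [x t, y t]) = 0)"
    and F: "\<And>v::complex^2. eval_cpoly F v = W 1 (v $ 1 - D1) (v $ 2 - D2) 1"
  shows "ideal_generator X F"
  unfolding ideal_generator_def
proof (intro conjI allI iffI)
  obtain s2 where s2: "W 1 0 s2 1 \<noteq> 0" using ex_W_1_0 by blast
  define y0 :: "complex^2" where "y0 = vector [D1, D2 + s2]"
  have y0: "y0 $ 1 = D1" "eval_cpoly F y0 \<noteq> 0" using s2 by (simp_all add: F y0_def)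
  then show "F \<noteq> 0" by auto
  fix G :: "2 cpoly"
  {
    assume "F dvd G"
    then obtain H where H: "G = F * H" by (rule dvdE)
    have "MOST t. ev2 P ((y t - D2) / (x t - D1)) (1 / (x t - D1)) = 0" using gen by simp
    with nz have "MOST t. eval_cpoly G (vector [x t, y t]) = 0"
      by eventually_elim (simp add: H F W_affine)
    then show "\<forall>v\<in>X. eval_cpoly G v = 0" using X by blast
  next
    assume G: "\<forall>v\<in>X. eval_cpoly G v = 0"
    have "\<exists>N g. polyfun2 g \<and> (\<forall>\<xi> \<zeta>. \<zeta> \<noteq> 0 \<longrightarrow> \<zeta> ^ N * f (vector [D1 + 1 / \<zeta>, D2 + \<xi> / \<zeta>]) = g \<xi> \<zeta>)"
      if "polyfun f" for f :: "complex^2 \<Rightarrow> complex"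
      using that
    proof (induction f rule: polyfun_induct)
      case (const c)
      show ?case by (rule exI[of _ 0], rule exI[of _ "\<lambda>_ _. c"]) (simp add: polyfun2_const)
    next
      case (var i f)
      then obtain N g where g: "polyfun2 g"
        "\<And>\<xi> \<zeta>. \<zeta> \<noteq> 0 \<Longrightarrow> \<zeta> ^ N * f (vector [D1 + 1 / \<zeta>, D2 + \<xi> / \<zeta>]) = g \<xi> \<zeta>" by blast
      define k where "k \<xi> \<zeta> = (if i = 1 then D1 * \<zeta> + 1 else D2 * \<zeta> + \<xi>)" for \<xi> \<zeta>
      have k: "polyfun2 k" unfolding k_def by (cases "i = 1") (simp_all, intro polyfun2_intros, intro polyfun2_intros)
      have i: "i = 1 \<or> i = 2" using exhaust_2 by blast
      show ?case
      proof (intro exI[of _ "Suc N"] exI[of _ "\<lambda>\<xi> \<zeta>. k \<xi> \<zeta> * g \<xi> \<zeta>"] conjI allI impI)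
        show "polyfun2 (\<lambda>\<xi> \<zeta>. k \<xi> \<zeta> * g \<xi> \<zeta>)" by (intro polyfun2_intros k g)
        fix \<xi> \<zeta> :: complex assume \<zeta>: "\<zeta> \<noteq> 0"
        have "\<zeta> * (D1 + 1 / \<zeta>) = D1 * \<zeta> + 1" "\<zeta> * (D2 + \<xi> / \<zeta>) = D2 * \<zeta> + \<xi>"
          using \<zeta> by (simp_all add: distrib_left mult.commute)
        then have ki: "k \<xi> \<zeta> = \<zeta> * (vector [D1 + 1 / \<zeta>, D2 + \<xi> / \<zeta>] :: complex^2) $ i"
          using i unfolding k_def by (elim disjE) (simp_all del: mult_eq_0_iff)
        show "\<zeta> ^ Suc N * ((vector [D1 + 1 / \<zeta>, D2 + \<xi> / \<zeta>] :: complex^2) $ i *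
            f (vector [D1 + 1 / \<zeta>, D2 + \<xi> / \<zeta>])) = k \<xi> \<zeta> * g \<xi> \<zeta>"
          unfolding ki g(2)[OF \<zeta>, symmetric] by (simp only: power_Suc mult_ac)
      qed
    next
      case (add f f')
      then obtain N g N' g' where g: "polyfun2 g" "polyfun2 g'"
        "\<And>\<xi> \<zeta>. \<zeta> \<noteq> 0 \<Longrightarrow> \<zeta> ^ N * f (vector [D1 + 1 / \<zeta>, D2 + \<xi> / \<zeta>]) = g \<xi> \<zeta>"
        "\<And>\<xi> \<zeta>. \<zeta> \<noteq> 0 \<Longrightarrow> \<zeta> ^ N' * f' (vector [D1 + 1 / \<zeta>, D2 + \<xi> / \<zeta>]) = g' \<xi> \<zeta>" by blast
      show ?case
      proof (intro exI[of _ "N + N'"] exI[of _ "\<lambda>\<xi> \<zeta>. \<zeta> ^ N' * g \<xi> \<zeta> + \<zeta> ^ N * g' \<xi> \<zeta>"] conjI allI impI)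
        show "polyfun2 (\<lambda>\<xi> \<zeta>. \<zeta> ^ N' * g \<xi> \<zeta> + \<zeta> ^ N * g' \<xi> \<zeta>)" by (intro polyfun2_intros g)
        fix \<xi> \<zeta> :: complex assume \<zeta>: "\<zeta> \<noteq> 0"
        show "\<zeta> ^ (N + N') * (f (vector [D1 + 1 / \<zeta>, D2 + \<xi> / \<zeta>]) + f' (vector [D1 + 1 / \<zeta>, D2 + \<xi> / \<zeta>])) =
            \<zeta> ^ N' * g \<xi> \<zeta> + \<zeta> ^ N * g' \<xi> \<zeta>"
          unfolding g(3,4)[OF \<zeta>, symmetric] by (simp add: power_add algebra_simps)
      qed
    qed
    from this[OF polyfun_eval[of G]] obtain N g where g: "polyfun2 g"
      "\<And>\<xi> \<zeta>. \<zeta> \<noteq> 0 \<Longrightarrow> \<zeta> ^ N * eval_cpoly G (vector [D1 + 1 / \<zeta>, D2 + \<xi> / \<zeta>]) = g \<xi> \<zeta>" by blast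
    obtain Q where Q: "\<And>\<xi> \<zeta>. g \<xi> \<zeta> = ev2 Q \<xi> \<zeta>" using g(1) unfolding polyfun2_def by blast
    have Q': "eval_cpoly G v = (v $ 1 - D1) ^ N * ev2 Q ((v $ 2 - D2) / (v $ 1 - D1)) (1 / (v $ 1 - D1))"
      if nz: "v $ 1 \<noteq> D1" for v
    proof -
      define z where "z = v $ 1 - D1"
      have z: "z \<noteq> 0" using nz by (simp add: z_def)
      have "v = vector [D1 + 1 / (1 / z), D2 + ((v $ 2 - D2) / z) / (1 / z)]"
        using z by (simp add: vec_eq_iff forall_2) (simp add: z_def)
      then have "(1 / z) ^ N * eval_cpoly G v = ev2 Q ((v $ 2 - D2) / z) (1 / z)"
        using g(2)[of "1 / z" "(v $ 2 - D2) / z"] z unfolding Q by simp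
      then have e1: "z ^ N * ((1 / z) ^ N * eval_cpoly G v) = z ^ N * ev2 Q ((v $ 2 - D2) / z) (1 / z)" by simp
      have e2: "z ^ N * ((1 / z) ^ N * eval_cpoly G v) = eval_cpoly G v"
        using z by (simp add: power_one_over)
      show ?thesis unfolding z_def[symmetric] by (rule trans[OF e2[symmetric] e1])
    qed
    have "MOST t. eval_cpoly G (vector [x t, y t]) = 0" using X G by blast
    with nz have "MOST t. ev2 Q ((y t - D2) / (x t - D1)) (1 / (x t - D1)) = 0"
      by eventually_elim (simp add: Q')
    then have "P dvd Q" using gen by blast
    then obtain H where H: "Q = P * H" by (rule dvdE)
    \<comment> \<open>The denominators of the quotient \<open>H\<close> are cleared by its own
      homogenization.\<close>
    have "\<exists>k h. polyfun h \<and> (\<forall>v::complex^2. v $ 1 \<noteq> D1 \<longrightarrow>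
        h v = (v $ 1 - D1) ^ k * ev2 H ((v $ 2 - D2) / (v $ 1 - D1)) (1 / (v $ 1 - D1)))"
    proof (cases "H = 0")
      case True
      then show ?thesis by (intro exI[of _ 0] exI[of _ "\<lambda>_. 0"]) (simp add: polyfun_const)
    next
      case False
      then obtain k where k: "total_degree2 H k" using ex_total_degree2 by blast
      interpret H: plane_curve_equation H k by unfold_locales (rule k)
      show ?thesis
        by (rule exI[of _ k], rule exI[of _ "\<lambda>v. hom2 H k 1 (v $ 1 - D1) (v $ 2 - D2) 1"])
          (simp add: H.W_affine polyfun_hom2 polyfun_intros)
    qed
    then obtain k h where h: "polyfun h" "\<And>v::complex^2. v $ 1 \<noteq> D1 \<Longrightarrow>
        h v = (v $ 1 - D1) ^ k * ev2 H ((v $ 2 - D2) / (v $ 1 - D1)) (1 / (v $ 1 - D1))" by blast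
    show "F dvd G"
    proof (rule dvd_cancel_hyperplane[OF _ _ y0])
      \<comment> \<open>The additional factor (the + 1) makes both sides zero on the line x = D1,
        where the quotients by x - D1 carry no information.\<close>
      show "polyfun (\<lambda>v. h v * (v $ 1 - D1) ^ (N + 1))" by (intro polyfun_intros h)
      show "eval_cpoly F v * (h v * (v $ 1 - D1) ^ (N + 1)) = (v $ 1 - D1) ^ (m + k + 1) * eval_cpoly G v" for v
      proof (cases "v $ 1 = D1")
        case False
        then show ?thesis by (simp add: F W_affine h(2) Q' H power_add mult_ac)
      qed simp
    qed
  }
qed

end

section \<open>Surfaces composed of circles\<close>

lemma vector_4 [simp]:
  "(vector [w, x, y, z] :: ('a::zero)^4) $ 1 = w"
  "(vector [w, x, y, z] :: ('a::zero)^4) $ 2 = x"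
  "(vector [w, x, y, z] :: ('a::zero)^4) $ 3 = y"
  "(vector [w, x, y, z] :: ('a::zero)^4) $ 4 = z"
  unfolding vector_def by simp_all

text \<open>Membership in the polynomial ring with \<open>x $ 1\<close> and \<open>x $ 2\<close>
  inverted; only the values where both are nonzero are constrained.\<close>

definition localized :: "(complex^4 \<Rightarrow> complex) \<Rightarrow> bool" where
  "localized f \<longleftrightarrow> (\<exists>N h. polyfun h \<and> (\<forall>x. x $ 1 \<noteq> 0 \<longrightarrow> x $ 2 \<noteq> 0 \<longrightarrow> h x = (x $ 1 * x $ 2) ^ N * f x))"

lemma localizedI:
  "polyfun h \<Longrightarrow> (\<And>x. x $ 1 \<noteq> 0 \<Longrightarrow> x $ 2 \<noteq> 0 \<Longrightarrow> h x = (x $ 1 * x $ 2) ^ N * f x) \<Longrightarrow> localized f"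
  unfolding localized_def by blast

lemma localized_polyfun: "polyfun f \<Longrightarrow> localized f"
  by (rule localizedI[where h = f and N = 0]) simp_all

lemma localized_add:
  assumes "localized f" "localized g"
  shows "localized (\<lambda>x. f x + g x)"
proof -
  obtain N h where h: "polyfun h" "\<And>x. x $ 1 \<noteq> 0 \<Longrightarrow> x $ 2 \<noteq> 0 \<Longrightarrow> h x = (x $ 1 * x $ 2) ^ N * f x"
    using assms(1) unfolding localized_def by blast
  obtain M k where k: "polyfun k" "\<And>x. x $ 1 \<noteq> 0 \<Longrightarrow> x $ 2 \<noteq> 0 \<Longrightarrow> k x = (x $ 1 * x $ 2) ^ M * g x"
    using assms(2) unfolding localized_def by blast
  show ?thesis
    by (rule localizedI[where h = "\<lambda>x. (x $ 1 * x $ 2) ^ M * h x + (x $ 1 * x $ 2) ^ N * k x" and N = "N + M"])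
      (auto intro!: polyfun_intros h k simp: h(2) k(2) power_add algebra_simps)
qed

lemma localized_mult:
  assumes "localized f" "localized g"
  shows "localized (\<lambda>x. f x * g x)"
proof -
  obtain N h where h: "polyfun h" "\<And>x. x $ 1 \<noteq> 0 \<Longrightarrow> x $ 2 \<noteq> 0 \<Longrightarrow> h x = (x $ 1 * x $ 2) ^ N * f x"
    using assms(1) unfolding localized_def by blast
  obtain M k where k: "polyfun k" "\<And>x. x $ 1 \<noteq> 0 \<Longrightarrow> x $ 2 \<noteq> 0 \<Longrightarrow> k x = (x $ 1 * x $ 2) ^ M * g x"
    using assms(2) unfolding localized_def by blast
  show ?thesis
    by (rule localizedI[where h = "\<lambda>x. h x * k x" and N = "N + M"])
      (auto intro!: polyfun_intros h k simp: h(2) k(2) power_add mult_ac)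
qed

lemma localized_power: "localized f \<Longrightarrow> localized (\<lambda>x. f x ^ n)"
  by (induction n) (simp_all add: localized_mult localized_polyfun polyfun_const)

lemma localized_sum: "(\<And>i. i \<in> I \<Longrightarrow> localized (f i)) \<Longrightarrow> localized (\<lambda>x. \<Sum>i\<in>I. f i x)"
  by (induction I rule: infinite_finite_induct)
    (simp_all add: localized_add localized_polyfun polyfun_const)

lemma localized_ratios: "localized (\<lambda>x. x $ 3 / x $ 2)" "localized (\<lambda>x. x $ 4 / (x $ 1 * x $ 2))"
proof -
  show "localized (\<lambda>x. x $ 3 / x $ 2)"
    by (rule localizedI[where h = "\<lambda>x. x $ 1 * x $ 3" and N = 1]) (auto intro!: polyfun_intros)
  show "localized (\<lambda>x. x $ 4 / (x $ 1 * x $ 2))"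
    by (rule localizedI[where h = "\<lambda>x. x $ 4" and N = 1]) (auto intro!: polyfun_intros)
qed

lemma localized_ev2:
  assumes "localized f" "localized g"
  shows "localized (\<lambda>x. ev2 P (f x) (g x))"
proof -
  obtain K where K: "\<And>j. degree (coeff P j) \<le> K" using ex_inner_degree_bound by blast
  show ?thesis unfolding ev2_expand[OF K order_refl]
    by (intro localized_sum localized_mult localized_power assms localized_polyfun polyfun_const)
qed

text \<open>Polynomials in \<open>x\<^sub>0\<close> (outermost variable), \<open>x\<^sub>1\<close>, \<open>\<zeta>\<close>, \<open>\<xi>\<close>.\<close>

definition ev4 :: "complex poly poly poly poly \<Rightarrow> complex \<Rightarrow> complex \<Rightarrow> complex \<Rightarrow> complex \<Rightarrow> complex" where
  "ev4 T a b x y = ev2 (poly (poly T [:[:[:a:]:]:]) [:[:b:]:]) x y"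

lemma ev4_add: "ev4 (S + T) a b x y = ev4 S a b x y + ev4 T a b x y"
  and ev4_mult: "ev4 (S * T) a b x y = ev4 S a b x y * ev4 T a b x y"
  by (simp_all add: ev4_def)

lemma ev4_expand:
  "ev4 T a b x y = poly (map_poly (\<lambda>Q. poly (map_poly (\<lambda>C. ev2 C x y) Q) b) T) a"
proof -
  have 1: "ev2 (poly Q [:[:b:]:]) x y = poly (map_poly (\<lambda>C. ev2 C x y) Q) b" for Q
    by (induction Q rule: pCons_induct) (simp_all add: map_poly_pCons)
  have 2: "poly (poly T [:[:[:a:]:]:]) [:[:b:]:] = 
     poly (map_poly (\<lambda>Q. poly Q [:[:b:]:]) T) [:[:a:]:]" for T :: "complex poly poly poly poly"
    by (induction T rule: pCons_induct) (simp_all add: map_poly_pCons)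
  have 3: "ev2 (poly Q [:[:a:]:]) x y = poly (map_poly (\<lambda>C. ev2 C x y) Q) a" for Q
    by (induction Q rule: pCons_induct) (simp_all add: map_poly_pCons)
  show ?thesis unfolding ev4_def 2 3 by (simp add: map_poly_map_poly o_def 1)
qed

lemma localized_ev4:
  "localized (\<lambda>x. ev4 T (x $ 1) (x $ 2) (x $ 3 / x $ 2) (x $ 4 / (x $ 1 * x $ 2)))"
proof -
  have Q: "localized (\<lambda>x. poly (map_poly (\<lambda>C. ev2 C (x $ 3 / x $ 2) (x $ 4 / (x $ 1 * x $ 2))) Q) (x $ 2))" for Q
    by (induction Q rule: pCons_induct)
      (simp_all add: map_poly_pCons localized_add localized_mult localized_ev2 localized_ratios
        localized_polyfun polyfun_const polyfun_var)
  show ?thesis unfolding ev4_expand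
    by (induction T rule: pCons_induct)
      (simp_all add: map_poly_pCons localized_add localized_mult Q
        localized_polyfun polyfun_const polyfun_var)
qed

text \<open>The substitution inverts the passage to \<open>x $ 3 / x $ 2\<close> and
  \<open>x $ 4 / (x $ 1 * x $ 2)\<close> with \<open>x $ 1\<close> and \<open>x $ 2\<close> kept, so
  the four variables of \<open>T\<close> are independent coordinates where \<open>x $ 1\<close> and
  \<open>x $ 2\<close> are nonzero.\<close>

lemma ex_ev4:
  fixes f :: "complex^4 \<Rightarrow> complex"
  assumes "polyfun f"
  shows "\<exists>T. \<forall>a b x y. ev4 T a b x y = f (vector [a, b, x * b, y * a * b])"
  using assms
proof (induction f rule: polyfun_induct)
  case (const c)
  show ?case by (rule exI[of _ "[:[:[:[:c:]:]:]:]"]) (simp add: ev4_def)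
next
  case (var i f)
  then obtain T where T: "\<And>a b x y. ev4 T a b x y = f (vector [a, b, x * b, y * a * b])" by blast
  have "\<exists>S. \<forall>a b x y. ev4 S a b x y = (vector [a, b, x * b, y * a * b] :: complex^4) $ i"
    using exhaust_4[of i]
  proof (elim disjE)
    assume "i = 1"
    then show ?thesis by (intro exI[of _ "[:0, 1:]"]) (simp add: ev4_def)
  next
    assume "i = 2"
    then show ?thesis by (intro exI[of _ "[:[:0, 1:]:]"]) (simp add: ev4_def)
  next
    assume "i = 3"
    then show ?thesis by (intro exI[of _ "[:[:0, [:[:0, 1:]:]:]:]"]) (simp add: ev4_def mult.commute)
  next
    assume "i = 4"
    then show ?thesis
      by (intro exI[of _ "[:0, [:0, [:0, 1:]:]:]"]) (simp add: ev4_def, simp add: ev2_def mult_ac)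
  qed
  then obtain S where "\<And>a b x y. ev4 S a b x y = (vector [a, b, x * b, y * a * b] :: complex^4) $ i" by blast
  with T show ?case by (intro exI[of _ "S * T"]) (simp add: ev4_mult)
next
  case (add f g)
  then obtain S T where "\<And>a b x y. ev4 S a b x y = f (vector [a, b, x * b, y * a * b])"
    "\<And>a b x y. ev4 T a b x y = g (vector [a, b, x * b, y * a * b])" by blast
  then show ?case by (intro exI[of _ "S + T"]) (simp add: ev4_add)
qed

context plane_curve_equation
begin

text \<open>Here the fourth coordinate stands for the quadric \<open>Q = x\<^sub>1\<^sup>2 + x\<^sub>2\<^sup>2 + x\<^sub>3\<^sup>2 - q x\<^sub>0\<^sup>2\<close>.\<close>

lemma dvd_if_vanishes:
  fixes \<xi> \<zeta> :: "complex \<Rightarrow> complex" and F G :: "4 cpoly"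
  assumes gen: "\<And>G. (MOST t. ev2 G (\<xi> t) (\<zeta> t) = 0) \<longleftrightarrow> P dvd G"
    and F: "\<And>v. eval_cpoly F v = W (v $ 1) (v $ 2) (v $ 3) (v $ 4)"
    and G: "MOST t. MOST a. MOST b. eval_cpoly G (vector [a, b, \<xi> t * b, \<zeta> t * a * b]) = 0"
  shows "F dvd G"
proof -
  obtain T where T: "\<And>a b x y. ev4 T a b x y = eval_cpoly G (vector [a, b, x * b, y * a * b])"
    using ex_ev4[OF polyfun_eval[of G]] by blast
  \<comment> \<open>Expansion in \<open>a\<close> and \<open>b\<close>: for generic \<open>t\<close>
    the polynomial vanishes for most \<open>a\<close> and \<open>b\<close>, so each coefficient
    vanishes on the curve and is a multiple of \<open>P\<close>.\<close>
  have "P dvd coeff (coeff T i) j" for i j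
  proof -
    have "MOST t. ev2 (coeff (coeff T i) j) (\<xi> t) (\<zeta> t) = 0" using G
    proof eventually_elim
      case (elim t)
      define S where "S = map_poly (map_poly (\<lambda>C. ev2 C (\<xi> t) (\<zeta> t))) T"
      have coeff_S: "coeff (coeff S i) j = ev2 (coeff (coeff T i) j) (\<xi> t) (\<zeta> t)" for i j
        by (simp add: S_def coeff_map_poly)
      have ev: "ev4 T a b (\<xi> t) (\<zeta> t) = poly (poly S [:a:]) b" for a b
      proof -
        have 1: "poly (poly S [:a:]) b = poly (map_poly (\<lambda>C. poly C b) S) a" for S :: "complex poly poly"
          by (induction S rule: pCons_induct) (simp_all add: map_poly_pCons)
        show ?thesis unfolding 1 ev4_expand S_def by (simp add: map_poly_map_poly o_def)
      qed
      have "MOST a. poly S [:a:] = 0" using elim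
      proof eventually_elim
        case (elim a)
        then show ?case by (intro poly_eqI_MOST) (simp add: T[symmetric] ev)
      qed
      then have "MOST a. poly (map_poly (\<lambda>C. coeff C j) S) a = 0" for j
      proof eventually_elim
        case (elim a)
        have "poly (map_poly (\<lambda>C. coeff C j) S) a = coeff (poly S [:a:]) j"
          by (induction S rule: pCons_induct) (simp_all add: map_poly_pCons)
        with elim show ?case by simp
      qed
      then have "map_poly (\<lambda>C. coeff C j) S = 0" by (intro poly_eqI_MOST) simp
      from arg_cong[OF this, of "\<lambda>p. coeff p i"] show ?case by (simp add: coeff_map_poly coeff_S)
    qed
    then show ?thesis using gen by blast
  qed
  then have "[:[:P:]:] dvd T" by (simp add: const_poly_dvd_iff)
  then obtain H where H: "T = [:[:P:]:] * H" by (rule dvdE)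
  obtain N h where h: "polyfun h" "\<And>x::complex^4. x $ 1 \<noteq> 0 \<Longrightarrow> x $ 2 \<noteq> 0 \<Longrightarrow>
      h x = (x $ 1 * x $ 2) ^ N * ev4 H (x $ 1) (x $ 2) (x $ 3 / x $ 2) (x $ 4 / (x $ 1 * x $ 2))"
    using localized_ev4[of H] unfolding localized_def by blast
  have GH: "eval_cpoly G x = ev2 P (x $ 3 / x $ 2) (x $ 4 / (x $ 1 * x $ 2)) *
      ev4 H (x $ 1) (x $ 2) (x $ 3 / x $ 2) (x $ 4 / (x $ 1 * x $ 2))"
    if "x $ 1 \<noteq> 0" "x $ 2 \<noteq> 0" for x
  proof -
    have "x = vector [x $ 1, x $ 2, x $ 3 / x $ 2 * x $ 2, x $ 4 / (x $ 1 * x $ 2) * x $ 1 * x $ 2]"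
      using that by (simp add: vec_eq_iff forall_4)
    then have "eval_cpoly G x = ev4 T (x $ 1) (x $ 2) (x $ 3 / x $ 2) (x $ 4 / (x $ 1 * x $ 2))"
      unfolding T by simp
    then show ?thesis unfolding H ev4_mult by (simp add: ev4_def)
  qed
  \<comment> \<open>One factor \<open>x $ 1 * x $ 2\<close> more than clearing denominators
    requires, so that the identity also holds where one of these coordinates is zero.\<close>
  have eq: "eval_cpoly F x * (h x * (x $ 1 * x $ 2)) =
      (x $ 1 - 0) ^ (L + N + 1) * ((x $ 2 - 0) ^ (m + N + 1) * eval_cpoly G x)" for x
  proof (cases "x $ 1 = 0 \<or> x $ 2 = 0")
    case False
    then show ?thesis by (simp add: F W_affine h(2) GH power_mult_distrib power_add mult_ac)
  qed auto
  \<comment> \<open>Points with \<open>x $ 1 = 0\<close> and with \<open>x $ 2 = 0\<close> at which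
    \<open>F\<close> is not zero, for the two cancellations.\<close>
  obtain s2 where s2: "W 0 1 s2 1 \<noteq> 0" using MOST_complex_ex[OF MOST_W_0[of 1]] by auto
  obtain s2' where s2': "W 1 0 s2' 1 \<noteq> 0" using ex_W_1_0 by blast
  have "polyfun (\<lambda>x. (x $ 2 - 0) ^ (m + N + 1) * eval_cpoly G x)" by (intro polyfun_intros polyfun_eval)
  then obtain G' where G': "eval_cpoly G' = (\<lambda>x. (x $ 2 - 0) ^ (m + N + 1) * eval_cpoly G x)"
    unfolding polyfun_def by metis
  have "F dvd G'"
  proof (rule dvd_cancel_hyperplane)
    show "polyfun (\<lambda>x. h x * (x $ 1 * x $ 2))" by (intro polyfun_intros h)
    show "eval_cpoly F x * (h x * (x $ 1 * x $ 2)) = (x $ 1 - 0) ^ (L + N + 1) * eval_cpoly G' x" for x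
      unfolding eq G' ..
    show "eval_cpoly F (vector [0, 1, s2, 1]) \<noteq> 0" using s2 by (simp add: F)
  qed simp
  then obtain g where g: "polyfun g" "\<And>x. eval_cpoly G' x = eval_cpoly F x * g x"
    unfolding dvd_cpoly_iff by blast
  show "F dvd G"
  proof (rule dvd_cancel_hyperplane[OF g(1)])
    show "eval_cpoly F x * g x = (x $ 2 - 0) ^ (m + N + 1) * eval_cpoly G x" for x
      using g(2)[of x] unfolding G' by simp
    show "eval_cpoly F (vector [1, 0, s2', 1]) \<noteq> 0" using s2' by (simp add: F)
  qed simp
qed

end

definition quadric :: "complex \<Rightarrow> complex^4 \<Rightarrow> complex" where
  "quadric q x = (x $ 2)\<^sup>2 + (x $ 3)\<^sup>2 + (x $ 4)\<^sup>2 - q * (x $ 1)\<^sup>2"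

lemma polyfun_quadric: "polyfun (quadric q)"
  unfolding quadric_def[abs_def] by (intro polyfun_intros)

text \<open>A double covering: x3 enters only through its square, so points that differ in the sign
  of x3 have the same image.\<close>

definition to_quadric :: "complex \<Rightarrow> complex^4 \<Rightarrow> complex^4" where
  "to_quadric q x = vector [x $ 1, x $ 2, x $ 3, quadric q x]"

lemma to_quadric_nth [simp]:
  "to_quadric q x $ 1 = x $ 1" "to_quadric q x $ 2 = x $ 2" "to_quadric q x $ 3 = x $ 3"
  "to_quadric q x $ 4 = quadric q x"
  by (simp_all add: to_quadric_def)

lemma polyfun_to_quadric: "polyfun f \<Longrightarrow> polyfun (\<lambda>x. f (to_quadric q x))"
proof (induction f rule: polyfun_induct)
  case (var i f)
  have "polyfun (\<lambda>x. to_quadric q x $ i)"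
    using exhaust_4[of i] by (elim disjE) (simp_all add: polyfun_intros polyfun_quadric)
  then show ?case using var by (intro polyfun_mult)
qed (auto intro!: polyfun_intros)

text \<open>The polynomial ring is free over \<open>\<complex>[x\<^sub>0, x\<^sub>1, x\<^sub>2, Q]\<close> with basis \<open>1, x\<^sub>3\<close>.\<close>

lemma even_odd_decomposition:
  assumes "polyfun f"
  shows "\<exists>g h. polyfun g \<and> polyfun h \<and>
    (\<forall>x. f x = g (to_quadric q x) + x $ 4 * h (to_quadric q x))"
  using assms
proof (induction f rule: polyfun_induct)
  case (const c)
  show ?case by (intro exI[of _ "\<lambda>_. c"] exI[of _ "\<lambda>_. 0"]) (simp add: polyfun_const)
next
  case (var i f)
  then obtain g h where gh: "polyfun g" "polyfun h"
    "\<And>x. f x = g (to_quadric q x) + x $ 4 * h (to_quadric q x)" by blast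
  show ?case
  proof (cases "i = 4")
    case True
    show ?thesis
    proof (intro exI conjI allI)
      show "polyfun (\<lambda>y. (y $ 4 + q * (y $ 1)\<^sup>2 - (y $ 2)\<^sup>2 - (y $ 3)\<^sup>2) * h y)"
        by (intro polyfun_intros gh)
      show "x $ i * f x = (to_quadric q x $ 4 + q * (to_quadric q x $ 1)\<^sup>2 - (to_quadric q x $ 2)\<^sup>2 -
          (to_quadric q x $ 3)\<^sup>2) * h (to_quadric q x) + x $ 4 * g (to_quadric q x)" for x
        using True by (simp add: gh(3) quadric_def power2_eq_square algebra_simps)
    qed (rule gh(1))
  next
    case False
    then have i: "x $ i = to_quadric q x $ i" for x using exhaust_4[of i] by auto
    show ?thesis
    proof (intro exI conjI allI)
      show "polyfun (\<lambda>y. y $ i * g y)" "polyfun (\<lambda>y. y $ i * h y)" by (intro polyfun_intros gh)+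
      show "x $ i * f x = to_quadric q x $ i * g (to_quadric q x) +
          x $ 4 * (to_quadric q x $ i * h (to_quadric q x))" for x
        unfolding gh(3) i[symmetric] by (simp add: algebra_simps)
    qed
  qed
next
  case (add f f')
  then obtain g h g' h' where "polyfun g" "polyfun h" "polyfun g'" "polyfun h'"
    "\<And>x. f x = g (to_quadric q x) + x $ 4 * h (to_quadric q x)"
    "\<And>x. f' x = g' (to_quadric q x) + x $ 4 * h' (to_quadric q x)" by blast
  then show ?case
    by (intro exI[of _ "\<lambda>y. g y + g' y"] exI[of _ "\<lambda>y. h y + h' y"])
      (simp add: polyfun_add algebra_simps)
qed

lemma quadric_line:
  "quadric q (v + T *s w) = quadric q v +
    T * (2 * (v $ 2 * w $ 2 + v $ 3 * w $ 3 + v $ 4 * w $ 4 - q * v $ 1 * w $ 1) + T * quadric q w)"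
  by (simp add: quadric_def power2_eq_square algebra_simps)

section \<open>Multiplicity along a projective curve\<close>

lemma proj_point_scale: "c \<noteq> 0 \<Longrightarrow> proj_point (c *s v) = proj_point v"
proof
  assume c: "c \<noteq> 0"
  show "proj_point (c *s v) \<subseteq> proj_point v" using c by (force simp: proj_point_def)
  show "proj_point v \<subseteq> proj_point (c *s v)"
  proof
    fix y assume "y \<in> proj_point v"
    then obtain k where "y = k *s v" "k \<noteq> 0" by (auto simp: proj_point_def)
    then have "y = (k / c) *s (c *s v)" "k / c \<noteq> 0" using c by auto
    then show "y \<in> proj_point (c *s v)" unfolding proj_point_def by blast
  qed
qed

lemma self_in_proj_point: "v \<in> proj_point v"
  unfolding proj_point_def by (rule CollectI, rule exI[of _ 1]) simp

lemma infinite_proj_points: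
  assumes "\<And>s. f s \<in> K" "\<And>s. f s $ i = 1" "\<And>s. f s $ j = s"
  shows "infinite (proj_point ` {v \<in> K. v \<noteq> 0})"
proof -
  have "inj (\<lambda>s. proj_point (f s))"
  proof (rule injI)
    fix s t assume "proj_point (f s) = proj_point (f t)"
    then have "f s \<in> proj_point (f t)" using self_in_proj_point by blast
    then obtain c where c: "f s = c *s f t" by (auto simp: proj_point_def)
    have "c = 1" using arg_cong[OF c, of "\<lambda>v. v $ i"] assms(2) by simp
    then show "s = t" using arg_cong[OF c, of "\<lambda>v. v $ j"] assms(3) by simp
  qed
  then have "infinite (range (\<lambda>s. proj_point (f s)))"
    using infinite_UNIV_char_0[where 'a = complex] finite_imageD by blast
  moreover have "range (\<lambda>s. proj_point (f s)) \<subseteq> proj_point ` {v \<in> K. v \<noteq> 0}"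
    using assms(1,2) by (auto intro!: imageI) (metis zero_index zero_neq_one)
  ultimately show ?thesis using finite_subset by blast
qed

text \<open>A curve with infinitely many points cannot have two generic multiplicities. Exceptional
  vectors may be multiples of finitely many.\<close>

lemma mult_along_eqI:
  assumes inf: "infinite (proj_point ` {v \<in> K. v \<noteq> 0})"
    and fin: "finite R" "\<And>v. v \<in> K \<Longrightarrow> v \<noteq> 0 \<Longrightarrow> mult_at G v = k \<or> (\<exists>c r. c \<noteq> 0 \<and> r \<in> R \<and> v = c *s r)"
  shows "mult_along G K = k"
  unfolding mult_along_def
proof (rule the_equality)
  let ?A = "\<lambda>k. proj_point ` {v \<in> K. v \<noteq> 0 \<and> mult_at G v \<noteq> k}"
  have "?A k \<subseteq> proj_point ` R"
  proof clarify
    fix v assume "v \<in> K" "v \<noteq> 0" "mult_at G v \<noteq> k"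
    then obtain c r where "c \<noteq> 0" "r \<in> R" "v = c *s r" using fin(2) by blast
    then show "proj_point v \<in> proj_point ` R" using proj_point_scale by blast
  qed
  then show A: "finite (?A k)" using fin(1) finite_subset by blast
  fix k' assume k': "finite (?A k')"
  show "k' = k"
  proof (rule ccontr)
    assume "k' \<noteq> k"
    then have "proj_point ` {v \<in> K. v \<noteq> 0} \<subseteq> ?A k \<union> ?A k'" by blast
    with A k' inf show False using finite_subset by blast
  qed
qed

lemma square_eq_cases: "x\<^sup>2 = y \<Longrightarrow> x = csqrt y \<or> x = - csqrt y"
  by (metis power2_csqrt power2_eq_iff)

context plane_curve_equation
begin

text \<open>An exceptional point has either x1 = 0, which leaves two points of the conic, or a ratio
  x2 / x1 that is a root of the leading coefficient, with at most two values of x3 / x1 for each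
  root.\<close>

lemma mult_along_absolute_conic:
  assumes conic: "\<And>v. v $ 1 = 0 \<Longrightarrow> quadric q v = 0 \<Longrightarrow> v $ 2 \<noteq> 0 \<Longrightarrow>
    poly (lead_coeff P) (v $ 3 / v $ 2) \<noteq> 0 \<Longrightarrow> mult_at G v = k"
  shows "mult_along G absolute_conic = k"
proof (rule mult_along_eqI)
  show "infinite (proj_point ` {v \<in> absolute_conic. v \<noteq> 0})"
    by (rule infinite_proj_points[of "\<lambda>s. vector [0, 1, s, csqrt (- 1 - s\<^sup>2)]" _ 2 3])
      (simp_all add: absolute_conic_def)
  let ?Z = "{s. poly (lead_coeff P) s = 0}"
  let ?R = "{vector [0, 0, 1, \<i>], vector [0, 0, 1, - \<i>]} \<union>
    (\<lambda>s. vector [0, 1, s, csqrt (- 1 - s\<^sup>2)]) ` ?Z \<union> (\<lambda>s. vector [0, 1, s, - csqrt (- 1 - s\<^sup>2)]) ` ?Z"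
  show "finite ?R" using P_nz by (simp add: poly_roots_finite)
  fix v assume v: "v \<in> absolute_conic" "v \<noteq> 0"
  then have v0: "v $ 1 = 0" and vq: "(v $ 2)\<^sup>2 + (v $ 3)\<^sup>2 + (v $ 4)\<^sup>2 = 0"
    by (auto simp: absolute_conic_def)
  then have q0: "quadric q v = 0" by (simp add: quadric_def)
  show "mult_at G v = k \<or> (\<exists>c r. c \<noteq> 0 \<and> r \<in> ?R \<and> v = c *s r)"
  proof (cases "v $ 2 = 0")
    case True
    have "v $ 3 \<noteq> 0"
    proof
      assume "v $ 3 = 0"
      with True v0 vq have "v = 0" by (simp add: vec_eq_iff forall_4)
      with v show False by simp
    qed
    have "(v $ 4)\<^sup>2 = (\<i> * v $ 3)\<^sup>2" using True vq by (simp add: power_mult_distrib add_eq_0_iff2)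
    then have "v $ 4 = \<i> * v $ 3 \<or> v $ 4 = - (\<i> * v $ 3)" by (simp add: power2_eq_iff)
    then have "v = (v $ 3) *s vector [0, 0, 1, \<i>] \<or> v = (v $ 3) *s vector [0, 0, 1, - \<i>]"
      using True v0 by (auto simp: vec_eq_iff forall_4)
    then show ?thesis using \<open>v $ 3 \<noteq> 0\<close> by blast
  next
    case False
    define s where "s = v $ 3 / v $ 2"
    show ?thesis
    proof (cases "poly (lead_coeff P) s = 0")
      case True
      have "(v $ 4 / v $ 2)\<^sup>2 = - 1 - s\<^sup>2"
        using False vq by (simp add: s_def power_divide field_simps) (metis add.assoc add.commute add_eq_0_iff2)
      then have "v $ 4 / v $ 2 = csqrt (- 1 - s\<^sup>2) \<or> v $ 4 / v $ 2 = - csqrt (- 1 - s\<^sup>2)"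
        by (rule square_eq_cases)
      then have "v = (v $ 2) *s vector [0, 1, s, csqrt (- 1 - s\<^sup>2)] \<or>
          v = (v $ 2) *s vector [0, 1, s, - csqrt (- 1 - s\<^sup>2)]"
        using False v0 by (auto simp: vec_eq_iff forall_4 s_def field_simps)
      then show ?thesis using True False by blast
    next
      case f: False
      then show ?thesis using conic[OF v0 q0 False] by (simp add: s_def)
    qed
  qed
qed

text \<open>The axis meets the quadric in the base points only, and these are at most two.\<close>

lemma mult_along_z_axis:
  assumes axis: "\<And>v. v $ 2 = 0 \<Longrightarrow> v $ 3 = 0 \<Longrightarrow> quadric q v \<noteq> 0 \<Longrightarrow> mult_at G v = k"
  shows "mult_along G proj_z_axis = k"
proof (rule mult_along_eqI)
  show "infinite (proj_point ` {v \<in> proj_z_axis. v \<noteq> 0})"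
    by (rule infinite_proj_points[of "\<lambda>s. vector [1, 0, 0, s]" _ 1 4]) (simp_all add: proj_z_axis_def)
  let ?R = "{vector [1, 0, 0, csqrt q], vector [1, 0, 0, - csqrt q]}"
  show "finite ?R" by simp
  fix v assume v: "v \<in> proj_z_axis" "v \<noteq> 0"
  then have v0: "v $ 2 = 0" "v $ 3 = 0" by (auto simp: proj_z_axis_def)
  show "mult_at G v = k \<or> (\<exists>c r. c \<noteq> 0 \<and> r \<in> ?R \<and> v = c *s r)"
  proof (cases "quadric q v = 0")
    case True
    then have vq: "(v $ 4)\<^sup>2 = q * (v $ 1)\<^sup>2" using v0 by (simp add: quadric_def)
    have "v $ 1 \<noteq> 0"
    proof
      assume "v $ 1 = 0"
      with v0 vq have "v = 0" by (simp add: vec_eq_iff forall_4)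
      with v show False by simp
    qed
    have "(v $ 4 / v $ 1)\<^sup>2 = q" using vq \<open>v $ 1 \<noteq> 0\<close> by (simp add: power_divide)
    then have "v $ 4 / v $ 1 = csqrt q \<or> v $ 4 / v $ 1 = - csqrt q" by (rule square_eq_cases)
    then have "v = (v $ 1) *s vector [1, 0, 0, csqrt q] \<or> v = (v $ 1) *s vector [1, 0, 0, - csqrt q]"
      using \<open>v $ 1 \<noteq> 0\<close> v0 by (auto simp: vec_eq_iff forall_4 field_simps)
    then show ?thesis using \<open>v $ 1 \<noteq> 0\<close> by blast
  qed (use axis v0 in blast)
qed

section \<open>The surface with equation \<open>W\<close> in x0, x1, x2 and the quadric\<close>

context
  fixes F :: "4 cpoly" and q :: complex
  assumes F: "\<And>v. eval_cpoly F v = W (v $ 1) (v $ 2) (v $ 3) (quadric q v)"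
begin

lemma surface_nonzero: "F \<noteq> 0"
proof -
  obtain s2 where s2: "W 0 1 s2 1 \<noteq> 0" using MOST_complex_ex[OF MOST_W_0[of 1]] by auto
  have "eval_cpoly F (vector [0, 1, s2, csqrt (- s2\<^sup>2)]) \<noteq> 0" using s2 by (simp add: F quadric_def)
  then show ?thesis by auto
qed

text \<open>Write G = g + x3 h with g and h polynomials in x0, x1, x2 and the quadric. The points
  supplied by \<open>points\<close> come in pairs with x3 = z and x3 = - z, so g and h vanish
  separately, and \<open>dvd_if_vanishes\<close> applies to both.\<close>

lemma ideal_generator_surface:
  fixes \<xi> \<zeta> :: "complex \<Rightarrow> complex"
  assumes gen: "\<And>G. (MOST t. ev2 G (\<xi> t) (\<zeta> t) = 0) \<longleftrightarrow> P dvd G"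
    and vanish: "\<And>v. v \<in> X \<Longrightarrow> eval_cpoly F v = 0"
    and points: "MOST t. \<forall>a b z. a \<noteq> 0 \<longrightarrow> b \<noteq> 0 \<longrightarrow>
      quadric q (vector [a, b, \<xi> t * b, z]) = \<zeta> t * a * b \<longrightarrow> vector [a, b, \<xi> t * b, z] \<in> X"
    and isotropic: "MOST t. 1 + (\<xi> t)\<^sup>2 \<noteq> 0"
  shows "ideal_generator X F"
  unfolding ideal_generator_def
proof (intro conjI allI iffI)
  show "F \<noteq> 0" by (rule surface_nonzero)
  fix G
  assume "F dvd G"
  then obtain H where "G = F * H" by (rule dvdE)
  then show "\<forall>v\<in>X. eval_cpoly G v = 0" using vanish by simp
next
  fix G
  assume G: "\<forall>v\<in>X. eval_cpoly G v = 0"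
  obtain g h where "polyfun g" "polyfun h" and
    gh: "\<And>x. eval_cpoly G x = g (to_quadric q x) + x $ 4 * h (to_quadric q x)"
    using even_odd_decomposition[OF polyfun_eval[of G], of q] by blast
  then obtain G0 H0 where GH: "g = eval_cpoly G0" "h = eval_cpoly H0" by (auto simp: polyfun_def)
  have "polyfun (\<lambda>v::complex^4. W (v $ 1) (v $ 2) (v $ 3) (v $ 4))" by (intro polyfun_hom2 polyfun_intros)
  then obtain F0 where F0': "(\<lambda>v::complex^4. W (v $ 1) (v $ 2) (v $ 3) (v $ 4)) = eval_cpoly F0"
    unfolding polyfun_def by blast
  have F0: "eval_cpoly F0 v = W (v $ 1) (v $ 2) (v $ 3) (v $ 4)" for v
    using fun_cong[OF F0', of v] by simp
  have "MOST t. MOST a. MOST b. g (vector [a, b, \<xi> t * b, \<zeta> t * a * b]) = 0 \<and>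
      h (vector [a, b, \<xi> t * b, \<zeta> t * a * b]) = 0"
    using points isotropic
  proof eventually_elim
    case (elim t)
    have pts: "vector [a, b, \<xi> t * b, z] \<in> X" if "a \<noteq> 0" "b \<noteq> 0"
      "quadric q (vector [a, b, \<xi> t * b, z]) = \<zeta> t * a * b" for a b z using elim(1) that by blast
    have iso: "1 + (\<xi> t)\<^sup>2 \<noteq> 0" by (rule elim(2))
    have "MOST a::complex. a \<noteq> 0" by simp
    then show ?case
    proof eventually_elim
      case (elim a)
      note a = elim
      \<comment> \<open>This quadratic in \<open>b\<close> is the value of z^2 that the condition in
        \<open>points\<close> prescribes. Its top coefficient is nonzero by
        \<open>isotropic\<close>, so for most \<open>b\<close> the roots z and - z are
        different.\<close>
      have "MOST b. poly [:q * a\<^sup>2, \<zeta> t * a, - (1 + (\<xi> t)\<^sup>2):] b \<noteq> 0"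
        using iso by (intro MOST_poly_nonzero) (simp add: add_eq_0_iff)
      moreover have "MOST b::complex. b \<noteq> 0" by simp
      ultimately show ?case
      proof eventually_elim
        case (elim b)
        define y where "y = poly [:q * a\<^sup>2, \<zeta> t * a, - (1 + (\<xi> t)\<^sup>2):] b"
        define z where "z = csqrt y"
        have z: "z\<^sup>2 = y" "z \<noteq> 0" using elim by (simp_all add: z_def y_def)
        have Q: "quadric q (vector [a, b, \<xi> t * b, w]) = \<zeta> t * a * b" if w: "w\<^sup>2 = z\<^sup>2" for w
        proof -
          have wy: "w\<^sup>2 = y" using w z(1) by simp
          show ?thesis unfolding quadric_def vector_4 wy y_def
            by (simp add: power2_eq_square algebra_simps)
        qed
        have 0: "g (vector [a, b, \<xi> t * b, \<zeta> t * a * b]) +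
            w * h (vector [a, b, \<xi> t * b, \<zeta> t * a * b]) = 0" if w: "w\<^sup>2 = z\<^sup>2" for w
        proof -
          have "vector [a, b, \<xi> t * b, w] \<in> X" using Q[OF w] elim(2) a by (intro pts)
          then have "eval_cpoly G (vector [a, b, \<xi> t * b, w]) = 0" using G by blast
          then show ?thesis using Q[OF w] by (simp add: gh to_quadric_def)
        qed
        have cancel: "g' = 0 \<and> h' = 0" if "g' + z * h' = 0" "g' + (- z) * h' = 0" for g' h'
        proof -
          have "2 * z * h' = (g' + z * h') - (g' + (- z) * h')" by simp
          then have "h' = 0" unfolding that using z(2) by simp
          with that show ?thesis by simp
        qed
        show ?case by (rule cancel[OF 0 0]) simp_all
      qed
    qed
  qed
  then have m: "MOST t. MOST a. MOST b. eval_cpoly G0 (vector [a, b, \<xi> t * b, \<zeta> t * a * b]) = 0"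
    "MOST t. MOST a. MOST b. eval_cpoly H0 (vector [a, b, \<xi> t * b, \<zeta> t * a * b]) = 0"
    unfolding GH by (auto elim!: eventually_mono)
  have "F0 dvd G0" "F0 dvd H0" using dvd_if_vanishes[OF gen _ m(1), of F0] dvd_if_vanishes[OF gen _ m(2), of F0]
    by (simp_all add: F0)
  then obtain g' h' where g': "polyfun g'" "\<And>x. eval_cpoly G0 x = eval_cpoly F0 x * g' x"
    and h': "polyfun h'" "\<And>x. eval_cpoly H0 x = eval_cpoly F0 x * h' x"
    unfolding dvd_cpoly_iff by blast
  have FF: "eval_cpoly F x = eval_cpoly F0 (to_quadric q x)" for x by (simp add: F F0)
  show "F dvd G" unfolding dvd_cpoly_iff
  proof (intro exI conjI allI)
    show "polyfun (\<lambda>x. g' (to_quadric q x) + x $ 4 * h' (to_quadric q x))"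
      by (intro polyfun_intros polyfun_to_quadric g' h')
    show "eval_cpoly G x = eval_cpoly F x * (g' (to_quadric q x) + x $ 4 * h' (to_quadric q x))" for x
      unfolding gh GH g'(2) h'(2) FF by (simp add: algebra_simps)
  qed
qed

lemma ex_line_hom2:
  "\<exists>R. \<forall>T. poly R T = W (poly A T) (v $ 2 + T * w $ 2) (v $ 3 + T * w $ 3) (x + T * (y + T * z))"
  using ex_poly_hom2[of P m A "[:v $ 2, w $ 2:]" "[:v $ 3, w $ 3:]" "[:x, y, z:]"] by simp

text \<open>Along a line through the point both x0 and the quadric acquire a factor T, so
  \<open>W_conic\<close> splits off T^L. In a direction with \<open>w $ 1 = 0\<close> the cofactor
  at T = 0 is governed by the leading coefficient of \<open>P\<close>.\<close>

lemma mult_at_absolute_conic: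
  assumes v: "v $ 1 = 0" "quadric q v = 0" "v $ 2 \<noteq> 0" "poly (lead_coeff P) (v $ 3 / v $ 2) \<noteq> 0"
  shows "mult_at F v = L"
proof (rule mult_at_eqI)
  define \<beta> where "\<beta> w = 2 * (v $ 2 * w $ 2 + v $ 3 * w $ 3 + v $ 4 * w $ 4 - q * v $ 1 * w $ 1)" for w :: "complex^4"
  have line: "eval_cpoly F (v + T *s w) = T ^ L *
      W (w $ 1) (v $ 2 + T * w $ 2) (v $ 3 + T * w $ 3) (\<beta> w + T * quadric q w)" for T w
    using W_conic[of T "w $ 1" "v $ 2 + T * w $ 2" "v $ 3 + T * w $ 3" "\<beta> w + T * quadric q w"] v
    by (simp add: F quadric_line \<beta>_def)
  have R: "\<exists>R. \<forall>T. poly R T =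
      W (w $ 1) (v $ 2 + T * w $ 2) (v $ 3 + T * w $ 3) (\<beta> w + T * quadric q w)" for w
    using ex_line_hom2[of "[:w $ 1:]" v w "\<beta> w" "quadric q w" 0] by simp
  show "\<exists>R. \<forall>T. eval_cpoly F (v + T *s w) = T ^ L * poly R T" for w
  proof -
    obtain R where "\<And>T. poly R T =
      W (w $ 1) (v $ 2 + T * w $ 2) (v $ 3 + T * w $ 3) (\<beta> w + T * quadric q w)" using R by blast
    then show ?thesis unfolding line by (intro exI[of _ R]) simp
  qed
  \<comment> \<open>In this direction the linear part of the quadric is twice \<open>v $ 2\<close>,
    which is not zero.\<close>
  let ?w = "vector [0, 1, 0, 0] :: complex^4"
  have "W 0 (v $ 2) (v $ 3) (\<beta> ?w) = W 0 (v $ 2 * 1) (v $ 2 * (v $ 3 / v $ 2)) (v $ 2 * 2)"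
    using v by (simp add: \<beta>_def mult.commute)
  also have "\<dots> \<noteq> 0" unfolding W_homogeneous W_0 using v by simp
  finally have nz: "W 0 (v $ 2) (v $ 3) (\<beta> ?w) \<noteq> 0" .
  obtain R where "\<And>T. poly R T =
      W (?w $ 1) (v $ 2 + T * ?w $ 2) (v $ 3 + T * ?w $ 3) (\<beta> ?w + T * quadric q ?w)" using R[of ?w] by blast
  then show "\<exists>w R. (\<forall>T. eval_cpoly F (v + T *s w) = T ^ L * poly R T) \<and> poly R 0 \<noteq> 0"
    unfolding line using nz by (intro exI[of _ ?w] exI[of _ R]) simp
qed

lemma mult_at_z_axis:
  assumes v: "v $ 2 = 0" "v $ 3 = 0" "quadric q v \<noteq> 0"
  shows "mult_at F v = m - L"
proof (rule mult_at_eqI)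
  define \<beta> where "\<beta> w = 2 * (v $ 2 * w $ 2 + v $ 3 * w $ 3 + v $ 4 * w $ 4 - q * v $ 1 * w $ 1)" for w :: "complex^4"
  have line: "eval_cpoly F (v + T *s w) = T ^ (m - L) *
      W (T * (v $ 1 + T * w $ 1)) (w $ 2) (w $ 3) (quadric q v + T * (\<beta> w + T * quadric q w))" for T w
    using W_axis[of "v $ 1 + T * w $ 1" T "w $ 2" "w $ 3" "quadric q v + T * (\<beta> w + T * quadric q w)"] v
    by (simp add: F quadric_line \<beta>_def)
  have R: "\<exists>R. \<forall>T. poly R T =
      W (T * (v $ 1 + T * w $ 1)) (w $ 2) (w $ 3) (quadric q v + T * (\<beta> w + T * quadric q w))" for w
    using ex_line_hom2[of "[:0, v $ 1, w $ 1:]" w 0 "quadric q v" "\<beta> w" "quadric q w"] by simp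
  show "\<exists>R. \<forall>T. eval_cpoly F (v + T *s w) = T ^ (m - L) * poly R T" for w
  proof -
    obtain R where "\<And>T. poly R T =
      W (T * (v $ 1 + T * w $ 1)) (w $ 2) (w $ 3) (quadric q v + T * (\<beta> w + T * quadric q w))" using R by blast
    then show ?thesis unfolding line by (intro exI[of _ R]) simp
  qed
  obtain s2 where s2: "W 0 1 s2 (quadric q v) \<noteq> 0" using MOST_complex_ex[OF MOST_W_0[OF v(3)]] by auto
  let ?w = "vector [0, 1, s2, 0] :: complex^4"
  obtain R where "\<And>T. poly R T =
      W (T * (v $ 1 + T * ?w $ 1)) (?w $ 2) (?w $ 3) (quadric q v + T * (\<beta> ?w + T * quadric q ?w))" using R[of ?w] by blast
  then show "\<exists>w R. (\<forall>T. eval_cpoly F (v + T *s w) = T ^ (m - L) * poly R T) \<and> poly R 0 \<noteq> 0"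
    unfolding line using s2 by (intro exI[of _ ?w] exI[of _ R]) simp
qed

text \<open>The hypothesis \<open>nz\<close> serves the parabolic case z = 0: there the quadric has
  no linear part at the base point, and the cofactor at T = 0 sees \<open>P\<close> only at \<zeta>
  = 0.\<close>

lemma mult_at_base_point:
  assumes z: "z\<^sup>2 = q" and nz: "\<exists>x. ev2 P x 0 \<noteq> 0"
  shows "mult_at F (vector [1, 0, 0, z]) = m"
proof (rule mult_at_eqI)
  let ?v = "vector [1, 0, 0, z] :: complex^4"
  define \<beta> where "\<beta> w = 2 * (z * w $ 4 - q * w $ 1)" for w :: "complex^4"
  have v: "quadric q ?v = 0" using z by (simp add: quadric_def)
  have line: "eval_cpoly F (?v + T *s w) = T ^ m *
      W (1 + T * w $ 1) (w $ 2) (w $ 3) (\<beta> w + T * quadric q w)" for T w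
    using W_homogeneous[of "1 + T * w $ 1" T "w $ 2" "w $ 3" "\<beta> w + T * quadric q w"] v
    by (simp add: F quadric_line \<beta>_def)
  have R: "\<exists>R. \<forall>T. poly R T = W (1 + T * w $ 1) (w $ 2) (w $ 3) (\<beta> w + T * quadric q w)" for w
    using ex_line_hom2[of "[:1, w $ 1:]" w 0 "\<beta> w" "quadric q w" 0] by simp
  show "\<exists>R. \<forall>T. eval_cpoly F (?v + T *s w) = T ^ m * poly R T" for w
  proof -
    obtain R where "\<And>T. poly R T = W (1 + T * w $ 1) (w $ 2) (w $ 3) (\<beta> w + T * quadric q w)" using R by blast
    then show ?thesis unfolding line by (intro exI[of _ R]) simp
  qed
  have "\<exists>w. w $ 1 = 0 \<and> W 1 (w $ 2) (w $ 3) (\<beta> w) \<noteq> 0"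
  proof (cases "z = 0")
    case True
    then obtain x where "ev2 P x 0 \<noteq> 0" using nz by blast
    then show ?thesis using True z by (intro exI[of _ "vector [0, 1, x, 0]"]) (simp add: \<beta>_def W_1_1)
  next
    case False
    have "\<exists>x y. ev2 P x y \<noteq> 0" using ev2_eqI[of P 0] P_nz by auto
    then obtain x y where "ev2 P x y \<noteq> 0" by blast
    then show ?thesis using False by (intro exI[of _ "vector [0, 1, x, y / (2 * z)]"]) (simp add: \<beta>_def W_1_1)
  qed
  then obtain w where w: "w $ 1 = 0" "W 1 (w $ 2) (w $ 3) (\<beta> w) \<noteq> 0" by blast
  obtain R where "\<And>T. poly R T = W (1 + T * w $ 1) (w $ 2) (w $ 3) (\<beta> w + T * quadric q w)" using R by blast
  then show "\<exists>w R. (\<forall>T. eval_cpoly F (?v + T *s w) = T ^ m * poly R T) \<and> poly R 0 \<noteq> 0"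
    unfolding line using w by (intro exI[of _ w] exI[of _ R]) simp
qed

lemma has_characters_surface:
  assumes gen: "ideal_generator X F" and nz: "\<exists>x. ev2 P x 0 \<noteq> 0" and p: "p\<^sup>2 = q"
  shows "has_characters (implicit_poly X ^ e) p (int (e * (L + m))) (int (e * L))
    (int (e * (m - L))) (int (e * m))"
proof -
  let ?G = "implicit_poly X"
  obtain c where c: "c \<noteq> 0" "\<And>x. eval_cpoly ?G x = c * eval_cpoly F x"
    using implicit_poly_eq[OF gen] by blast
  obtain y where y: "eval_cpoly F y \<noteq> 0" using eval_cpoly_nonzero[OF surface_nonzero] by blast
  have G: "?G \<noteq> 0" using c y by (metis eval_cpoly_0 mult_eq_0_iff)
  have Ge: "?G ^ e \<noteq> 0"
  proof
    assume "?G ^ e = 0"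
    then have "eval_cpoly (?G ^ e) y = 0" by simp
    then show False using c y by simp
  qed
  have mult: "mult_at (?G ^ e) x = e * mult_at F x" for x
    unfolding mult_at_power[OF G] using mult_at_scale[OF c] by simp
  have "quadric q (T *s x) = T\<^sup>2 * quadric q x" for T x
    by (simp add: quadric_def power_mult_distrib algebra_simps)
  then have FT: "eval_cpoly F (T *s x) = T ^ (L + m) * eval_cpoly F x" for T x
    by (simp add: F W_scale)
  have "eval_cpoly (?G ^ e) (T *s x) = T ^ (e * (L + m)) * eval_cpoly (?G ^ e) x" for T x
  proof -
    have "eval_cpoly (?G ^ e) (T *s x) = (T ^ (L + m) * (c * eval_cpoly F x)) ^ e"
      unfolding eval_cpoly_power c FT by (simp only: mult_ac)
    also have "\<dots> = (T ^ (L + m)) ^ e * (c * eval_cpoly F x) ^ e" by (rule power_mult_distrib)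
    finally show ?thesis unfolding eval_cpoly_power c power_mult[symmetric] by (simp only: mult.commute[of e])
  qed
  then have "total_degree (?G ^ e) = e * (L + m)" by (rule total_degree_eqI[OF Ge])
  moreover have "mult_along (?G ^ e) absolute_conic = e * L"
    by (rule mult_along_absolute_conic[of q]) (simp add: mult mult_at_absolute_conic)
  moreover have "mult_along (?G ^ e) proj_z_axis = e * (m - L)"
    by (rule mult_along_z_axis[of q]) (simp add: mult mult_at_z_axis)
  moreover have "mult_at (?G ^ e) (homog (base_point1 p)) = e * m"
    "mult_at (?G ^ e) (homog (base_point2 p)) = e * m"
    using mult_at_base_point[OF _ nz, of p] mult_at_base_point[OF _ nz, of "- p"] p
    by (simp_all add: mult homog_def base_point1_def base_point2_def)
  ultimately show ?thesis by (simp add: has_characters_def)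
qed

end

end

section \<open>Cyclic-harmonic curves\<close>

locale cyclic_harmonic =
  fixes n d :: nat and a :: real
  assumes n_pos: "n > 0" and d_pos: "d > 0" and cop: "coprime n d"
begin

text \<open>
  With \<open>w = exp (i \<phi> / d)\<close> the curve is parametrized by \<open>x = xh/w\<^sup>n\<^sup>+\<^sup>d\<close>, \<open>y = yh/w\<^sup>n\<^sup>+\<^sup>d\<close>,
  and \<open>r = rp/w\<^sup>n\<close>.
\<close>

definition rp :: "complex poly" where
  "rp = smult (1/2) (monom 1 (2 * n) + 1) + smult (of_real a) (monom 1 n)"
definition xh :: "complex poly" where "xh = smult (1/2) (rp * (monom 1 (2 * d) + 1))"
definition yh :: "complex poly" where "yh = smult (- \<i> / 2) (rp * (monom 1 (2 * d) - 1))"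
definition oh :: "complex poly" where "oh = monom 1 (n + d)"
definition "px w = poly xh w / w ^ (n + d)"
definition "py w = poly yh w / w ^ (n + d)"

lemma poly_oh [simp]: "poly oh w = w ^ (n + d)"
  by (simp add: oh_def poly_monom)

lemma poly_rp: "poly rp w = (w ^ (2 * n) + 1) / 2 + of_real a * w ^ n"
  by (simp add: rp_def poly_monom)

lemma poly_xh: "poly xh w = poly rp w * (w ^ (2 * d) + 1) / 2"
  by (simp add: xh_def poly_monom)

lemma poly_yh: "poly yh w = - \<i> * poly rp w * (w ^ (2 * d) - 1) / 2"
  by (simp add: yh_def poly_monom)

lemma degree_rp: "degree rp = 2 * n" and coeff_rp: "coeff rp (2 * n) = 1 / 2"
proof -
  show c: "coeff rp (2 * n) = 1 / 2" using n_pos by (simp add: rp_def coeff_1)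
  have "degree rp \<le> 2 * n" unfolding rp_def
    by (intro degree_add_le order_trans[OF degree_smult_le] order_trans[OF degree_monom_le]) simp_all
  moreover have "coeff rp (2 * n) \<noteq> 0" unfolding c by simp
  then have "2 * n \<le> degree rp" by (rule le_degree)
  ultimately show "degree rp = 2 * n" by simp
qed

text \<open>The lowest and highest coefficients describe the ends w = 0 and w = infinity, where the
  curve tends to the isotropic directions (1 : i) and (1 : -i).\<close>

lemma coeff_curve_bounds:
  "coeff xh 0 = 1 / 4" "coeff yh 0 = \<i> / 4" "coeff oh 0 = 0"
  "coeff xh (2 * (n + d)) = 1 / 4" "coeff yh (2 * (n + d)) = - \<i> / 4" "coeff oh (2 * (n + d)) = 0"
  "degree xh \<le> 2 * (n + d)" "degree yh \<le> 2 * (n + d)" "degree oh \<le> 2 * (n + d)"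
proof -
  have d1: "degree (monom 1 (2 * d) + 1 :: complex poly) = 2 * d"
    and d2: "degree (monom 1 (2 * d) - 1 :: complex poly) = 2 * d"
    using d_pos degree_add_eq_left[of 1 "monom 1 (2 * d) :: complex poly"]
      degree_add_eq_left[of "- 1" "monom 1 (2 * d) :: complex poly"] by (simp_all add: degree_monom_eq)
  have top: "coeff (rp * q) (2 * (n + d)) = coeff rp (2 * n) * coeff q (2 * d)" if "degree q = 2 * d" for q
    using coeff_mult_degree_sum[of rp q] degree_rp that by (simp add: distrib_left)
  show "coeff xh (2 * (n + d)) = 1 / 4" "coeff yh (2 * (n + d)) = - \<i> / 4"
    unfolding xh_def yh_def coeff_smult top[OF d1] top[OF d2] coeff_rp
    using d_pos by (simp_all add: coeff_1)
  show "coeff xh 0 = 1 / 4" "coeff yh 0 = \<i> / 4" "coeff oh 0 = 0"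
    using n_pos d_pos
    by (simp_all flip: poly_0_coeff_0 add: poly_xh poly_yh poly_rp power_0_left)
  show "coeff oh (2 * (n + d)) = 0" using n_pos by (simp add: oh_def)
  show "degree xh \<le> 2 * (n + d)" "degree yh \<le> 2 * (n + d)"
    using degree_mult_le[of rp "monom 1 (2 * d) + 1"] degree_mult_le[of rp "monom 1 (2 * d) - 1"]
    by (simp_all add: xh_def yh_def degree_rp d1 d2)
  show "degree oh \<le> 2 * (n + d)" unfolding oh_def by (rule order_trans[OF degree_monom_le]) simp
qed

text \<open>The numerator, over w^(n + d), of the affine function with constant term
  \<open>s\<close> and linear coefficients \<open>x\<close> and \<open>y\<close>, restricted to the
  curve.\<close>

definition comb :: "complex \<Rightarrow> complex \<Rightarrow> complex \<Rightarrow> complex poly" where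
  "comb s x y = smult s oh + smult x xh + smult y yh"

lemma poly_comb: "poly (comb s x y) w = s * w ^ (n + d) + x * poly xh w + y * poly yh w"
  by (simp add: comb_def)

lemma poly_comb_nz: "w \<noteq> 0 \<Longrightarrow> poly (comb s x y) w = w ^ (n + d) * (s + x * px w + y * py w)"
  by (simp add: poly_comb px_def py_def distrib_left)

lemma coeff_comb:
  "coeff (comb s x y) 0 = (x + \<i> * y) / 4" "coeff (comb s x y) (2 * (n + d)) = (x - \<i> * y) / 4"
  "degree (comb s x y) \<le> 2 * (n + d)"
proof -
  show "coeff (comb s x y) 0 = (x + \<i> * y) / 4" "coeff (comb s x y) (2 * (n + d)) = (x - \<i> * y) / 4"
    unfolding comb_def coeff_add coeff_smult coeff_curve_bounds by (simp_all add: field_simps)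
  show "degree (comb s x y) \<le> 2 * (n + d)" unfolding comb_def
    by (intro degree_add_le order_trans[OF degree_smult_le] coeff_curve_bounds)
qed

lemma poly_comb_0: "poly (comb s x y) 0 = (x + \<i> * y) / 4"
  by (simp add: poly_0_coeff_0 coeff_comb)

lemma comb_eq_0_iff: "comb s x y = 0 \<longleftrightarrow> s = 0 \<and> x = 0 \<and> y = 0"
proof
  assume 0: "comb s x y = 0"
  then have e: "x + \<i> * y = 0" "x - \<i> * y = 0" using coeff_comb(1,2)[of s x y] by simp_all
  have "2 * x = (x + \<i> * y) + (x - \<i> * y)" by simp
  then have x: "x = 0" unfolding e by simp
  with e(1) have y: "y = 0" by simp
  note xy = x y
  with 0 have "smult s oh = 0" by (simp add: comb_def)
  with xy show "s = 0 \<and> x = 0 \<and> y = 0" by (simp add: oh_def)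
qed (simp add: comb_def)

lemma comb_add: "comb s x y + comb s' x' y' = comb (s + s') (x + x') (y + y')"
  by (rule poly_eqI) (simp add: comb_def algebra_simps)

lemma smult_comb: "smult c (comb s x y) = comb (c * s) (c * x) (c * y)"
  by (rule poly_eqI) (simp add: comb_def algebra_simps)

lemma norm_one_param:
  assumes "norm w = 1"
  shows "\<exists>\<phi>\<in>{0..2 * real d * pi}. w = cis (\<phi> / real d)"
proof -
  obtain t where t: "0 \<le> t" "t < 2 * pi" "w = Complex (cos t) (sin t)"
    using complex_unimodular_polar[OF assms] by blast
  show ?thesis
  proof (rule bexI)
    show "w = cis ((real d * t) / real d)" using d_pos t(3) by (simp add: cis.code)
    show "real d * t \<in> {0..2 * real d * pi}"
      using t mult_left_mono[of t "2 * pi" "real d"] by (simp add: mult_ac)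
  qed
qed

lemma locus_point:
  assumes w: "w = cis (\<phi> / real d)"
  shows "cvec ((cos (real n / real d * \<phi>) + a) *s (vector [cos \<phi>, sin \<phi>] :: real^2)) = vector [px w, py w]"
proof -
  define t where "t = \<phi> / real d"
  have \<phi>: "\<phi> = real d * t" "real n / real d * \<phi> = real n * t" using d_pos by (simp_all add: t_def)
  have w0: "w \<noteq> 0" using w by simp
  have pw: "w ^ k = cis (real k * t)" for k by (simp only: w t_def Complex.DeMoivre)
  have ex: "of_real (cos (real k * t)) = (w ^ (2 * k) + 1) / (2 * w ^ k)"
    "of_real (sin (real k * t)) = - \<i> * ((w ^ (2 * k) - 1) / (2 * w ^ k))" for k
  proof -
    define W where "W = w ^ k"
    have W: "W \<noteq> 0" "w ^ (2 * k) = W * W" using w0 by (simp_all add: W_def mult_2 power_add)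
    have c: "cis (real k * t) = W" by (simp add: W_def pw)
    have c': "cis (- (real k * t)) = 1 / W"
      unfolding cis_inverse[symmetric] c by (simp add: inverse_eq_divide)
    have e1: "of_real (cos x) = (cis x + cis (- x)) / 2"
      and e2: "of_real (sin x) = - \<i> * ((cis x - cis (- x)) / 2)" for x
      by (simp_all add: complex_eq_iff)
    have W1: "(W + 1 / W) / 2 = (W * W + 1) / (2 * W)"
      using W(1) by (simp add: add_divide_distrib mult.commute)
    have W2: "(W - 1 / W) / 2 = (W * W - 1) / (2 * W)"
      using W(1) by (simp add: diff_divide_distrib mult.commute)
    show "of_real (cos (real k * t)) = (w ^ (2 * k) + 1) / (2 * w ^ k)"
      unfolding e1 c c' W(2) W1 W_def[symmetric] by (rule refl)
    show "of_real (sin (real k * t)) = - \<i> * ((w ^ (2 * k) - 1) / (2 * w ^ k))"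
      unfolding e2 c c' W(2) W2 W_def[symmetric] by (rule refl)
  qed
  have r: "of_real (cos (real n * t) + a) = poly rp w / w ^ n"
    unfolding of_real_add ex(1) poly_rp using w0 by (simp add: add_divide_distrib)
  have "of_real ((cos (real n * t) + a) * cos (real d * t)) = px w"
    "of_real ((cos (real n * t) + a) * sin (real d * t)) = py w"
    unfolding of_real_mult r ex px_def py_def poly_xh poly_yh power_add
    by (simp_all add: mult_ac)
  then have 1: "of_real ((cos (real n * t) + a) * cos \<phi>) = px w"
    "of_real ((cos (real n * t) + a) * sin \<phi>) = py w" using \<phi>(1) by simp_all
  have 2: "cvec (k *s (vector [x, y] :: real^2)) = vector [of_real (k * x), of_real (k * y)]" for k x y
    by (simp add: cvec_def vec_eq_iff forall_2)
  show ?thesis unfolding \<phi>(2) 2 1 by (rule refl)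
qed

lemma ex_poly_on_curve:
  fixes f :: "complex^2 \<Rightarrow> complex"
  assumes "polyfun f"
  shows "\<exists>N g. \<forall>w. w \<noteq> 0 \<longrightarrow> w ^ N * f (vector [px w, py w]) = poly g w"
  using assms
proof (induction f rule: polyfun_induct)
  case (const c)
  show ?case by (rule exI[of _ 0], rule exI[of _ "[:c:]"]) simp
next
  case (var i f)
  then obtain N g where g: "\<And>w. w \<noteq> 0 \<Longrightarrow> w ^ N * f (vector [px w, py w]) = poly g w" by blast
  obtain h where h: "\<And>w. w \<noteq> 0 \<Longrightarrow> w ^ (n + d) * (vector [px w, py w] :: complex^2) $ i = poly h w"
    using exhaust_2[of i] by (elim disjE) (auto simp: px_def py_def)
  show ?case
  proof (intro exI[of _ "n + d + N"] exI[of _ "h * g"] allI impI)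
    fix w :: complex assume w: "w \<noteq> 0"
    show "w ^ (n + d + N) * ((vector [px w, py w] :: complex^2) $ i * f (vector [px w, py w])) = poly (h * g) w"
      unfolding poly_mult h[OF w, symmetric] g[OF w, symmetric] power_add by (simp only: mult_ac)
  qed
next
  case (add f f')
  then obtain N g N' g' where g: "\<And>w. w \<noteq> 0 \<Longrightarrow> w ^ N * f (vector [px w, py w]) = poly g w"
    "\<And>w. w \<noteq> 0 \<Longrightarrow> w ^ N' * f' (vector [px w, py w]) = poly g' w" by blast
  show ?case
  proof (intro exI[of _ "N + N'"] exI[of _ "monom 1 N' * g + monom 1 N * g'"] allI impI)
    fix w :: complex assume w: "w \<noteq> 0"
    show "w ^ (N + N') * (f (vector [px w, py w]) + f' (vector [px w, py w])) =
        poly (monom 1 N' * g + monom 1 N * g') w"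
      unfolding poly_add poly_mult poly_monom g[OF w, symmetric] power_add by (simp add: algebra_simps)
  qed
qed

lemma MOST_nonzero: "MOST w::complex. w \<noteq> 0"
  by simp

text \<open>The real locus is the image of the unit circle. After clearing denominators a polynomial
  in w remains, and it is zero if it vanishes on the unit circle or at almost all w.\<close>

lemma vanishes_on_curve_iff:
  fixes G :: "2 cpoly"
  shows "(MOST w. eval_cpoly G (vector [px w, py w]) = 0) \<longleftrightarrow>
    (\<forall>w. w \<noteq> 0 \<longrightarrow> eval_cpoly G (vector [px w, py w]) = 0)" (is ?A)
    and "(\<forall>v\<in>cvec ` CH_locus n d a. eval_cpoly G v = 0) \<longleftrightarrow>
    (MOST w. eval_cpoly G (vector [px w, py w]) = 0)" (is ?B)
proof -
  obtain N g where g: "\<And>w. w \<noteq> 0 \<Longrightarrow> w ^ N * eval_cpoly G (vector [px w, py w]) = poly g w"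
    using ex_poly_on_curve[OF polyfun_eval[of G]] by blast
  have all: "\<forall>w. w \<noteq> 0 \<longrightarrow> eval_cpoly G (vector [px w, py w]) = 0" if "g = 0"
    using g that by simp
  show ?A
  proof
    assume "MOST w. eval_cpoly G (vector [px w, py w]) = 0"
    then have "MOST w. poly g w = poly 0 w" using MOST_nonzero
      by eventually_elim (simp flip: g)
    then have "g = 0" by (rule poly_eqI_MOST)
    then show "\<forall>w. w \<noteq> 0 \<longrightarrow> eval_cpoly G (vector [px w, py w]) = 0" by (rule all)
  next
    assume "\<forall>w. w \<noteq> 0 \<longrightarrow> eval_cpoly G (vector [px w, py w]) = 0"
    then show "MOST w. eval_cpoly G (vector [px w, py w]) = 0"
      by (intro eventually_mono[OF MOST_nonzero]) blast
  qed
  show ?B unfolding \<open>?A\<close>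
  proof
    assume v: "\<forall>v\<in>cvec ` CH_locus n d a. eval_cpoly G v = 0"
    have "poly g w = 0" if nw: "norm w = 1" for w
    proof -
      obtain \<phi> where \<phi>: "\<phi> \<in> {0..2 * real d * pi}" "w = cis (\<phi> / real d)" using norm_one_param[OF nw] by blast
      then have "vector [px w, py w] \<in> cvec ` CH_locus n d a"
        unfolding CH_locus_def locus_point[OF \<phi>(2), symmetric] by blast
      then have "eval_cpoly G (vector [px w, py w]) = 0" using v by blast
      moreover have "w \<noteq> 0" using nw by auto
      ultimately show ?thesis using g[of w] by simp
    qed
    then have "sphere 0 1 \<subseteq> {w. poly g w = 0}" by auto
    moreover have "infinite (sphere (0::complex) 1)"
    proof
      assume "finite (sphere (0::complex) 1)"
      then have "sphere (0::complex) 1 = {}  \<or> (\<exists>c. sphere (0::complex) 1 = {c})"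
        using connected_finite_iff_sing[OF connected_sphere[of "0::complex" 1]] by simp
      moreover have "1 \<in> sphere (0::complex) 1" "- 1 \<in> sphere (0::complex) 1" by simp_all
      ultimately show False by (metis empty_iff singletonD one_neq_neg_one)
    qed
    ultimately have "infinite {w. poly g w = 0}" using finite_subset by blast
    then have "g = 0" using poly_roots_finite by blast
    then show "\<forall>w. w \<noteq> 0 \<longrightarrow> eval_cpoly G (vector [px w, py w]) = 0" by (rule all)
  next
    assume v: "\<forall>w. w \<noteq> 0 \<longrightarrow> eval_cpoly G (vector [px w, py w]) = 0"
    show "\<forall>v\<in>cvec ` CH_locus n d a. eval_cpoly G v = 0"
    proof
      fix x assume "x \<in> cvec ` CH_locus n d a"
      then obtain \<phi> where "x = cvec ((cos (real n / real d * \<phi>) + a) *s vector [cos \<phi>, sin \<phi>])"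
        unfolding CH_locus_def by blast
      then show "eval_cpoly G x = 0" unfolding locus_point[OF refl] using v by simp
    qed
  qed
qed

definition branches :: nat where "branches = (if case_A n d a then 2 else 1)"

lemma coprime_power_1:
  fixes x :: complex
  assumes "x ^ (k * n) = 1" "x ^ (k * d) = 1"
  shows "x ^ k = 1"
proof -
  obtain s t where st: "n * s = d * t + 1"
    using bezout_nat[of n d] n_pos cop by (auto simp: coprime_iff_gcd_eq_1)
  have "x ^ k = x ^ k * (x ^ (k * d)) ^ t" using assms by simp
  also have "\<dots> = (x ^ (k * n)) ^ s"
    unfolding power_mult[symmetric] power_add[symmetric] mult.assoc st by (simp add: algebra_simps)
  finally show ?thesis using assms by simp
qed

lemma odd_if_even_sum: "even (n + d) \<Longrightarrow> odd (n * d)"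
proof -
  assume e: "even (n + d)"
  have "\<not> (even n \<and> even d)"
  proof
    assume "even n \<and> even d"
    then have "is_unit (2::nat)" using coprime_common_divisor[OF cop] by blast
    then show False by simp
  qed
  with e show ?thesis by (simp only: even_add even_mult_iff) blast
qed

text \<open>The numbers x - iy and x + iy differ by the factor w^(2 d), so the quotient u of two
  parameters of a generic point satisfies u^(2 d) = 1. For each such u outside \<open>E\<close>,
  equality of x - iy is a nontrivial polynomial condition on \<open>s\<close>.\<close>

lemma MOST_card_branches:
  "MOST s. card {t. t \<noteq> 0 \<and> px t = px s \<and> py t = py s} = branches"
proof -
  define E :: "complex set" where "E = (if case_A n d a then {1, - 1} else {1})"
  have XY: "px w - \<i> * py w = poly rp w / w ^ (n + d)"
    "px w + \<i> * py w = poly rp w * w ^ (2 * d) / w ^ (n + d)" if "w \<noteq> 0" for w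
    using that by (simp_all add: px_def py_def poly_xh poly_yh field_simps)
  have "MOST s. \<forall>u\<in>{u. poly (monom 1 (2 * d) - 1) u = 0} - E. poly rp (u * s) \<noteq> u ^ (n + d) * poly rp s"
  proof (intro eventually_ball_finite ballI)
    have "degree (monom 1 (2 * d) - 1 :: complex poly) = 2 * d"
      using d_pos degree_add_eq_left[of "- 1" "monom 1 (2 * d) :: complex poly"] by (simp add: degree_monom_eq)
    then have "monom 1 (2 * d) - 1 \<noteq> (0 :: complex poly)" using d_pos by auto
    then show "finite ({u::complex. poly (monom 1 (2 * d) - 1) u = 0} - E)" by (intro finite_Diff poly_roots_finite)
    fix u assume u: "u \<in> {u. poly (monom 1 (2 * d) - 1) u = 0} - E"
    define Q where "Q = pcompose rp [:0, u:] - smult (u ^ (n + d)) rp"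
    have "Q \<noteq> 0"
    proof
      assume Q0: "Q = 0"
      have coeff_rp': "coeff rp i = (if i = 2 * n then 1 / 2 else 0) + (if i = 0 then 1 / 2 else 0) +
          (if i = n then of_real a else 0)" for i
        by (simp add: rp_def coeff_1)
      \<comment> \<open>Used at the exponents 0, 2 n and n: they give u^(n + d) = 1, u^(2 n) = 1
        and, for nonzero \<open>a\<close>, u^n = 1.\<close>
      have cQ: "u ^ i * coeff rp i = u ^ (n + d) * coeff rp i" for i
      proof -
        have "coeff (pcompose rp [:0, u:]) i = u ^ i * coeff rp i"
          by (simp add: coeff_pcompose_linear)
        with Q0 show ?thesis unfolding Q_def by (metis coeff_smult eq_iff_diff_eq_0)
      qed
      have 1: "u ^ (n + d) = 1" using cQ[of 0] n_pos by (simp add: coeff_rp')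
      have 2: "u ^ (2 * n) = 1" using cQ[of "2 * n"] n_pos 1 by (simp add: coeff_rp')
      have 3: "u ^ (2 * d) = 1" using u by (simp add: poly_monom)
      have "u ^ 2 = 1" using coprime_power_1[OF 2 3] .
      then have pm: "u = 1 \<or> u = - 1" by (simp add: power2_eq_1_iff)
      show False
      proof (cases "a = 0")
        case False
        then have "u ^ n = 1" using cQ[of n] n_pos 1 by (simp add: coeff_rp')
        moreover from this have "u ^ d = 1" using 1 by (simp add: power_add)
        ultimately have "u = 1" using coprime_power_1[of u 1] by simp
        with u show False by (auto simp: E_def split: if_splits)
      next
        case True
        have "u \<noteq> 1" using u by (auto simp: E_def split: if_splits)
        with pm have "u = - 1" by simp
        then have "even (n + d)" using 1 by (metis neg_one_even_power neg_one_odd_power one_neq_neg_one)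
        then have "case_A n d a" using True odd_if_even_sum by (simp add: case_A_def)
        with u \<open>u = - 1\<close> show False by (simp add: E_def)
      qed
    qed
    from MOST_poly_nonzero[OF this]
    show "MOST s. poly rp (u * s) \<noteq> u ^ (n + d) * poly rp s"
      by eventually_elim (auto simp: Q_def poly_pcompose mult.commute)
  qed
  moreover have "MOST s. poly rp s \<noteq> 0" using degree_rp n_pos by (intro MOST_poly_nonzero) auto
  ultimately show ?thesis using MOST_nonzero
  proof eventually_elim
    case (elim s)
    have "{t. t \<noteq> 0 \<and> px t = px s \<and> py t = py s} = (\<lambda>u. u * s) ` E"
    proof (rule set_eqI, rule iffI)
      fix t assume "t \<in> {t. t \<noteq> 0 \<and> px t = px s \<and> py t = py s}"
      then have t: "t \<noteq> 0" "px t = px s" "py t = py s" by auto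
      define u where "u = t / s"
      have u: "t = u * s" "u \<noteq> 0" using elim t by (simp_all add: u_def)
      have Y: "poly rp t / t ^ (n + d) = poly rp s / s ^ (n + d)"
        using XY(1)[OF t(1)] XY(1)[OF elim(3)] t by simp
      have "poly rp w / w ^ (n + d) * w ^ (2 * d) = px w + \<i> * py w" if "w \<noteq> 0" for w
        using XY(2)[OF that] by simp
      from this[OF t(1)] this[OF elim(3)]
      have "poly rp s / s ^ (n + d) * t ^ (2 * d) = poly rp s / s ^ (n + d) * s ^ (2 * d)"
        unfolding Y t by simp
      then have "t ^ (2 * d) = s ^ (2 * d)" using elim by simp
      then have ud: "u ^ (2 * d) = 1" using elim by (simp add: u_def power_divide)
      have "poly rp (u * s) = u ^ (n + d) * poly rp s"
        using Y elim(3) u by (simp add: power_mult_distrib field_simps)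
      with elim(1) ud have "u \<in> E" by (auto simp: poly_monom)
      then show "t \<in> (\<lambda>u. u * s) ` E" using u by blast
    next
      fix t assume "t \<in> (\<lambda>u. u * s) ` E"
      then obtain u where u: "u \<in> E" "t = u * s" by blast
      show "t \<in> {t. t \<noteq> 0 \<and> px t = px s \<and> py t = py s}"
      proof (cases "u = 1")
        case False
        then have A: "case_A n d a" "t = - s" using u by (auto simp: E_def split: if_splits)
        have a0: "of_real a = (0::complex)" "odd n" "odd d" using A(1) by (auto simp: case_A_def)
        have rs: "poly rp t = poly rp s" unfolding poly_rp a0(1) A(2) by simp
        have pw: "t ^ (n + d) = s ^ (n + d)" "t ^ (2 * d) = s ^ (2 * d)" unfolding A(2) using a0 by simp_all
        have "px t = px s" "py t = py s" unfolding px_def py_def poly_xh poly_yh rs pw by (rule refl)+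
        moreover have "t \<noteq> 0" unfolding A(2) using elim(3) by simp
        ultimately show ?thesis by blast
      qed (use u elim in simp)
    qed
    moreover have "inj_on (\<lambda>u. u * s) E" using elim by (auto simp: inj_on_def)
    ultimately show ?case by (simp add: card_image E_def branches_def)
  qed
qed

end

lemma degree_0_if_no_root:
  fixes p :: "complex poly"
  assumes "\<And>t. poly p t \<noteq> 0"
  shows "degree p = 0"
proof -
  have "constant (poly p)" using fundamental_theorem_of_algebra[of p] assms by blast
  then show ?thesis by (simp add: constant_degree)
qed

lemma degree_eq_if_dvd_dvd: "p dvd q \<Longrightarrow> q dvd p \<Longrightarrow> q \<noteq> 0 \<Longrightarrow> p \<noteq> 0 \<Longrightarrow> degree p = degree (q :: complex poly)"
  by (intro antisym dvd_imp_degree_le)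

lemma poly_gcd_root:
  fixes p q :: "complex poly"
  assumes "poly (gcd p q) t = 0"
  shows "poly p t = 0" "poly q t = 0"
  using assms by (meson gcd_dvd1 gcd_dvd2 poly_eq_0_iff_dvd dvd_trans)+

lemma poly_gcd_rootI:
  fixes p q :: "complex poly"
  assumes "poly p t = 0" "poly q t = 0"
  shows "poly (gcd p q) t = 0"
  using assms by (simp add: poly_eq_0_iff_dvd)

lemma degree_pos_if_root: "p \<noteq> 0 \<Longrightarrow> poly p t = 0 \<Longrightarrow> degree p > 0" for p :: "complex poly"
  by (rule ccontr) (auto elim!: degree_eq_zeroE)

lemma rational_curve_equationE:
  fixes f1 f2 f3 :: "complex poly"
  assumes "f1 \<noteq> 0" "\<And>c. f2 \<noteq> smult c f1"
  obtains e \<gamma> m where "e > 0"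
    "MOST s. card {t. poly f1 t \<noteq> 0 \<and> poly f2 t / poly f1 t = poly f2 s / poly f1 s \<and>
      poly f3 t / poly f1 t = poly f3 s / poly f1 s} = e"
    "\<gamma> \<noteq> 0" "total_degree2 \<gamma> m"
    "degree \<gamma> * e + degree (gcd f1 f2) = max (degree f1) (degree f2)"
    "m * e + degree (gcd (gcd f1 f2) f3) = max (max (degree f1) (degree f2)) (degree f3)"
    "\<forall>G. (MOST t. ev2 G (poly f2 t / poly f1 t) (poly f3 t / poly f1 t) = 0) \<longleftrightarrow> \<gamma> dvd G"
  using rational_curve_equation[OF assms, of f3] by (elim exE conjE) (rule that)

section \<open>Multiplicities and complex points of the curve\<close>

context cyclic_harmonic
begin

text \<open>The roots are the parameters of the point (D1, D2), counted as often as x - D1 and y -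
  D2 vanish together.\<close>

definition gcd_at :: "complex \<Rightarrow> complex \<Rightarrow> complex poly" where
  "gcd_at D1 D2 = gcd (comb (- D1) 1 0) (comb (- D2) 0 1)"

text \<open>The curve is projected from the point: in the coordinates (y - D2) / (x - D1) and 1 / (x
  - D1) the multiplicity is the total degree minus the degree in the last coordinate. Both degree
  formulas have the right-hand side 2 (n + d), so the difference is the degree of the gcd.\<close>

lemma CH_poly_props:
  "CH_poly n d a \<noteq> 0"
  "branches * mult_at (CH_poly n d a) (vector [D1, D2]) = degree (gcd_at D1 D2)"
proof -
  define f1 f2 where "f1 = comb (- D1) 1 0" and "f2 = comb (- D2) 0 1"
  have f1: "f1 \<noteq> 0" by (simp add: f1_def comb_eq_0_iff)
  have indep: "f2 \<noteq> smult c f1" for c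
  proof
    assume "f2 = smult c f1"
    then have "f2 + smult (- c) f1 = 0" by simp
    then show False by (simp add: f1_def f2_def smult_comb comb_add comb_eq_0_iff)
  qed
  have f_nz: "poly f1 t = t ^ (n + d) * (px t - D1)" "poly f2 t = t ^ (n + d) * (py t - D2)"
    if "t \<noteq> 0" for t using that by (simp_all add: f1_def f2_def poly_comb_nz)
  have "coeff f1 (2 * (n + d)) \<noteq> 0" unfolding f1_def coeff_comb by simp
  then have "2 * (n + d) \<le> degree f1" by (rule le_degree)
  moreover have "degree f1 \<le> 2 * (n + d)" "degree f2 \<le> 2 * (n + d)"
    unfolding f1_def f2_def by (rule coeff_comb(3))+
  ultimately have max12: "max (degree f1) (degree f2) = 2 * (n + d)" by linarith
  have max3: "max (max (degree f1) (degree f2)) (degree oh) = 2 * (n + d)"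
    unfolding max12 using coeff_curve_bounds(9) by linarith
  \<comment> \<open>\<open>oh\<close> vanishes only at w = 0, an end of the curve, where
    \<open>f1\<close> is not zero.\<close>
  have gcd3: "degree (gcd (gcd f1 f2) oh) = 0"
  proof (rule degree_0_if_no_root, rule notI)
    fix t assume t: "poly (gcd (gcd f1 f2) oh) t = 0"
    then have "t = 0" using poly_gcd_root(2)[OF t] by simp
    moreover have "poly f1 t = 0" using poly_gcd_root(1)[OF poly_gcd_root(1)[OF t]] .
    ultimately show False by (simp add: f1_def poly_comb_0)
  qed
  let ?fib = "\<lambda>s. {t. poly f1 t \<noteq> 0 \<and> poly f2 t / poly f1 t = poly f2 s / poly f1 s \<and>
    poly oh t / poly f1 t = poly oh s / poly f1 s}"
  obtain e \<gamma> m where e: "e > 0" "MOST s. card (?fib s) = e" and \<gamma>: "\<gamma> \<noteq> 0" "total_degree2 \<gamma> m"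
    and deg': "degree \<gamma> * e + degree (gcd f1 f2) = max (degree f1) (degree f2)"
      "m * e + degree (gcd (gcd f1 f2) oh) = max (max (degree f1) (degree f2)) (degree oh)"
    and gen: "\<forall>G. (MOST t. ev2 G (poly f2 t / poly f1 t) (poly oh t / poly f1 t) = 0) \<longleftrightarrow> \<gamma> dvd G"
    by (rule rational_curve_equationE[where ?f3.0 = oh, OF f1 indep]) (rule that)
  note deg = deg'(1)[unfolded max12] deg'(2)[unfolded max3 gcd3]
  have MOST_f1: "MOST s. poly f1 s \<noteq> 0" using f1 by (rule MOST_poly_nonzero)
  \<comment> \<open>The new coordinates determine x and y, so a fibre consists of the parameters of
    one point.\<close>
  have "MOST s::complex. e = branches" using e(2) MOST_card_branches MOST_f1 MOST_nonzero
  proof eventually_elim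
    case (elim s)
    have quot: "poly f2 t / poly f1 t = (py t - D2) / (px t - D1)" "poly oh t / poly f1 t = 1 / (px t - D1)"
      if "t \<noteq> 0" for t using that by (simp_all add: f_nz)
    have s: "px s - D1 \<noteq> 0" using elim by (auto simp: f_nz)
    have "?fib s = {t. t \<noteq> 0 \<and> px t = px s \<and> py t = py s}"
    proof (rule set_eqI, rule iffI)
      fix t assume t: "t \<in> ?fib s"
      have "t \<noteq> 0"
      proof
        assume "t = 0"
        then have z: "poly oh t / poly f1 t = 0" using n_pos by simp
        have "poly oh t / poly f1 t = poly oh s / poly f1 s" using t by blast
        then have "poly oh s / poly f1 s = 0" unfolding z by (rule sym)
        then show False using elim by simp
      qed
      then have q: "(py t - D2) / (px t - D1) = (py s - D2) / (px s - D1)"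
        "1 / (px t - D1) = 1 / (px s - D1)" "px t - D1 \<noteq> 0"
        using t elim(4) by (auto simp: quot f_nz)
      have x: "px t - D1 = px s - D1"
        using arg_cong[OF q(2), of inverse] by (simp only: inverse_eq_divide div_by_1 divide_divide_eq_right mult_1_left)
      have "py t - D2 = py s - D2" using q(1) s unfolding x by simp
      with x \<open>t \<noteq> 0\<close> show "t \<in> {t. t \<noteq> 0 \<and> px t = px s \<and> py t = py s}" by simp
    next
      fix t assume "t \<in> {t. t \<noteq> 0 \<and> px t = px s \<and> py t = py s}"
      then show "t \<in> ?fib s" using elim s by (auto simp: quot f_nz)
    qed
    with elim show ?case by simp
  qed
  then have eb: "e = branches" by (simp add: infinite_UNIV_char_0)
  interpret plane_curve_equation \<gamma> m by unfold_locales (rule \<gamma>(2))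
  have "polyfun (\<lambda>v::complex^2. W 1 (v $ 1 - D1) (v $ 2 - D2) 1)"
    by (intro polyfun_hom2 polyfun_intros)
  then obtain F where F': "(\<lambda>v::complex^2. W 1 (v $ 1 - D1) (v $ 2 - D2) 1) = eval_cpoly F"
    unfolding polyfun_def by blast
  have F: "eval_cpoly F v = W 1 (v $ 1 - D1) (v $ 2 - D2) 1" for v
    using fun_cong[OF F', of v] by simp
  have "MOST t. px t \<noteq> D1" using MOST_f1 MOST_nonzero by eventually_elim (simp add: f_nz)
  then have IG: "ideal_generator (cvec ` CH_locus n d a) F"
  proof (rule ideal_generator_plane_curve[where y = py and ?D2.0 = D2, rotated])
    show "(MOST t. ev2 G ((py t - D2) / (px t - D1)) (1 / (px t - D1)) = 0) \<longleftrightarrow> \<gamma> dvd G" for G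
    proof -
      have "(MOST t. ev2 G ((py t - D2) / (px t - D1)) (1 / (px t - D1)) = 0) \<longleftrightarrow>
          (MOST t. ev2 G (poly f2 t / poly f1 t) (poly oh t / poly f1 t) = 0)"
        by (rule eventually_cong[OF MOST_nonzero]) (simp add: f_nz)
      then show ?thesis using gen by blast
    qed
  qed (rule vanishes_on_curve_iff(2), rule F)
  obtain c where c: "c \<noteq> 0" "\<And>x. eval_cpoly (CH_poly n d a) x = c * eval_cpoly F x"
    using implicit_poly_eq[OF IG] unfolding CH_poly_def by blast
  have "mult_at (CH_poly n d a) (vector [D1, D2]) = m - degree \<gamma>"
    unfolding mult_at_scale[OF c] using F by (rule mult_at_plane_curve)
  then have "branches * mult_at (CH_poly n d a) (vector [D1, D2]) = m * e - degree \<gamma> * e"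
    by (simp add: eb diff_mult_distrib2 mult.commute[of branches])
  also have "\<dots> = degree (gcd f1 f2)" using deg by simp
  finally show "branches * mult_at (CH_poly n d a) (vector [D1, D2]) = degree (gcd_at D1 D2)"
    by (simp add: gcd_at_def f1_def f2_def)
  have "F \<noteq> 0" using IG by (simp add: ideal_generator_def)
  then obtain y where "eval_cpoly F y \<noteq> 0" using eval_cpoly_nonzero by blast
  then have "eval_cpoly (CH_poly n d a) y \<noteq> 0" using c by simp
  then show "CH_poly n d a \<noteq> 0" by auto
qed

lemma gcd_at_root_iff: "poly (gcd_at D1 D2) w = 0 \<longleftrightarrow> w \<noteq> 0 \<and> px w = D1 \<and> py w = D2"
proof
  assume "poly (gcd_at D1 D2) w = 0"
  then have r: "poly (comb (- D1) 1 0) w = 0" "poly (comb (- D2) 0 1) w = 0"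
    using poly_gcd_root unfolding gcd_at_def by blast+
  then have w: "w \<noteq> 0" by (auto simp: poly_comb_0)
  with r show "w \<noteq> 0 \<and> px w = D1 \<and> py w = D2" by (simp add: poly_comb_nz)
next
  assume "w \<noteq> 0 \<and> px w = D1 \<and> py w = D2"
  then show "poly (gcd_at D1 D2) w = 0"
    unfolding gcd_at_def by (intro poly_gcd_rootI) (simp_all add: poly_comb_nz)
qed

lemma gcd_at_nz: "gcd_at D1 D2 \<noteq> 0"
  by (simp add: gcd_at_def comb_eq_0_iff)

text \<open>A point is on the algebraic curve iff its multiplicity is positive, hence iff the gcd
  has a root. So no affine point is missed: the limits w = 0 and w = infinity lie at
  infinity.\<close>

lemma CH_eq: "CH n d a = {vector [px w, py w] | w. w \<noteq> 0}"
proof (rule set_eqI)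
  fix v :: "complex^2"
  define D1 D2 where "D1 = v $ 1" and "D2 = v $ 2"
  have v: "v = vector [D1, D2]" by (simp add: vec_eq_iff forall_2 D1_def D2_def)
  have "v \<in> CH n d a \<longleftrightarrow> mult_at (CH_poly n d a) v > 0"
    unfolding CH_def using mult_at_pos_iff[OF CH_poly_props(1)] by simp
  also have "\<dots> \<longleftrightarrow> degree (gcd_at D1 D2) > 0"
    unfolding v CH_poly_props(2)[symmetric] by (simp add: branches_def)
  also have "\<dots> \<longleftrightarrow> (\<exists>w. poly (gcd_at D1 D2) w = 0)"
    using degree_0_if_no_root[of "gcd_at D1 D2"] degree_pos_if_root[OF gcd_at_nz] by fastforce
  also have "\<dots> \<longleftrightarrow> v \<in> {vector [px w, py w] | w. w \<noteq> 0}"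
    unfolding gcd_at_root_iff by (auto simp: v vec_eq_iff forall_2)
  finally show "v \<in> CH n d a \<longleftrightarrow> v \<in> {vector [px w, py w] | w. w \<noteq> 0}" .
qed

text \<open>Up to constants the numerators are \<open>rp\<close> times w^(2 d) + 1 and w^(2 d) - 1;
  a combination of the two gives \<open>rp\<close> itself.\<close>

lemma degree_gcd_at_pole: "degree (gcd_at 0 0) = 2 * n"
proof -
  have g: "gcd_at 0 0 = gcd xh yh" by (simp add: gcd_at_def comb_def)
  have "rp dvd gcd xh yh" by (simp add: xh_def yh_def dvd_smult)
  moreover have "gcd xh yh dvd rp"
  proof -
    have "rp = xh - smult \<i> yh"
      by (intro poly_eqI_MOST MOST_I) (simp add: poly_xh poly_yh algebra_simps diff_divide_distrib add_divide_distrib)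
    moreover have "gcd xh yh dvd xh - smult \<i> yh" by (intro dvd_diff dvd_smult) simp_all
    ultimately show ?thesis by simp
  qed
  moreover have "rp \<noteq> 0" using degree_rp n_pos by auto
  ultimately show ?thesis unfolding g using degree_eq_if_dvd_dvd[of "gcd xh yh" rp] gcd_at_nz[of 0 0] degree_rp
    by (simp add: g)
qed

end

section \<open>Circular surfaces of cyclic-harmonic curves\<close>

text \<open>\<open>not_vertical\<close> says that the plane does not contain the axis: a nonzero
  vector (x, y, 0) orthogonal to \<open>b\<close>, \<open>u\<close> and \<open>v\<close> would be
  the normal of a plane that does.\<close>

locale rose_surface = cyclic_harmonic n d a for n d :: nat and a :: real +
  fixes b u v :: "real^3" and q :: real and p :: complex
  assumes n_neq_d: "n \<noteq> d"
    and uu: "u \<bullet> u = 1" and vv: "v \<bullet> v = 1" and uv: "u \<bullet> v = 0"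
    and p2: "p\<^sup>2 = of_real q"
    and not_vertical: "\<And>x y. x * b $ 1 + y * b $ 2 = 0 \<Longrightarrow> x * u $ 1 + y * u $ 2 = 0 \<Longrightarrow>
      x * v $ 1 + y * v $ 2 = 0 \<Longrightarrow> x = 0 \<and> y = 0"
begin

definition "A w = place b u v (vector [px w, py w])"
definition Ah :: "3 \<Rightarrow> complex poly" where
  "Ah k = comb (of_real (b $ k)) (of_real (u $ k)) (of_real (v $ k))"
text \<open>The power of a point with respect to the sphere of squared radius \<open>q\<close> about
  the origin, which passes through the base points.\<close>

definition "power_of x = (x $ 1)\<^sup>2 + (x $ 2)\<^sup>2 + (x $ 3)\<^sup>2 - complex_of_real q" for x :: "complex^3"
text \<open>At w = 0 the coordinates have poles of order at most n + d and r^2 has one of order 2 n,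
  so w^K is a common denominator. \<open>f1\<close>, \<open>f2\<close> and \<open>f3\<close> are the
  numerators of the two horizontal coordinates and of the power.\<close>

definition "K = max (2 * n) (n + d)"
definition "f1 = monom 1 (K - (n + d)) * Ah 1"
definition "f2 = monom 1 (K - (n + d)) * Ah 2"
definition "f3 = smult (of_real (b \<bullet> b - q)) (monom 1 K) +
  comb 0 (of_real (2 * (b \<bullet> u))) (of_real (2 * (b \<bullet> v))) * monom 1 (K - (n + d)) +
  rp * rp * monom 1 (K - 2 * n)"

lemma K_ge: "n + d \<le> K" "2 * n \<le> K" by (simp_all add: K_def)

lemma A_nth: "A w $ k = of_real (b $ k) + px w * of_real (u $ k) + py w * of_real (v $ k)"
  by (simp add: A_def place_def cvec_def)

lemma rose_curve_eq: "rose_curve n d a b u v = A ` {w. w \<noteq> 0}"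
  unfolding rose_curve_def CH_eq A_def by auto

lemma poly_Ah: "w \<noteq> 0 \<Longrightarrow> poly (Ah k) w = w ^ (n + d) * A w $ k"
  by (simp add: Ah_def poly_comb_nz A_nth mult_ac)

lemma poly_f12:
  assumes "w \<noteq> 0"
  shows "poly f1 w = w ^ K * A w $ 1" "poly f2 w = w ^ K * A w $ 2"
proof -
  have "w ^ (K - (n + d)) * w ^ (n + d) = w ^ K"
    unfolding power_add[symmetric] using K_ge by simp
  then have "w ^ (K - (n + d)) * (w ^ (n + d) * x) = w ^ K * x" for x
    unfolding mult.assoc[symmetric] by simp
  then show "poly f1 w = w ^ K * A w $ 1" "poly f2 w = w ^ K * A w $ 2"
    unfolding f1_def f2_def poly_mult poly_monom poly_Ah[OF assms] by simp_all
qed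

text \<open>This is x^2 + y^2 = r^2. Each square has a pole of order 2 (n + d) at w = 0, but (Z +
  1)^2 - (Z - 1)^2 = 4 Z reduces the order of the sum to 2 n.\<close>

lemma px_py_squares:
  assumes "w \<noteq> 0"
  shows "(px w)\<^sup>2 + (py w)\<^sup>2 = (poly rp w / w ^ n)\<^sup>2"
proof -
  have "(R * (Z + 1) / 2 / N)\<^sup>2 = R\<^sup>2 * (Z + 1)\<^sup>2 / 4 / N\<^sup>2"
    "(- \<i> * R * (Z - 1) / 2 / N)\<^sup>2 = - (R\<^sup>2 * (Z - 1)\<^sup>2 / 4 / N\<^sup>2)" for R Z N :: complex
    by (simp_all add: power_divide power_mult_distrib)
  then have "(px w)\<^sup>2 + (py w)\<^sup>2 = (poly rp w)\<^sup>2 * (w ^ (2 * d) + 1)\<^sup>2 / 4 / (w ^ (n + d))\<^sup>2 -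
      (poly rp w)\<^sup>2 * (w ^ (2 * d) - 1)\<^sup>2 / 4 / (w ^ (n + d))\<^sup>2"
    unfolding px_def py_def poly_xh poly_yh by simp
  also have "\<dots> = (poly rp w)\<^sup>2 * (((w ^ (2 * d) + 1)\<^sup>2 - (w ^ (2 * d) - 1)\<^sup>2) / 4) / (w ^ (n + d))\<^sup>2"
    by (simp only: diff_divide_distrib right_diff_distrib times_divide_eq_right)
  also have "(w ^ (2 * d) + 1)\<^sup>2 - (w ^ (2 * d) - 1)\<^sup>2 = 4 * (w ^ d)\<^sup>2"
  proof -
    have "(X * X + 1)\<^sup>2 - (X * X - 1)\<^sup>2 = 4 * X\<^sup>2" for X :: complex
      by (simp add: power2_eq_square algebra_simps)
    moreover have "w ^ (2 * d) = w ^ d * w ^ d" by (simp add: mult_2 power_add)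
    ultimately show ?thesis by simp
  qed
  also have "(poly rp w)\<^sup>2 * (4 * (w ^ d)\<^sup>2 / 4) / (w ^ (n + d))\<^sup>2 = (poly rp w / w ^ n)\<^sup>2"
    using assms by (simp add: power_divide power_add power_mult_distrib)
  finally show ?thesis .
qed

lemma power_of_A:
  assumes "w \<noteq> 0"
  shows "power_of (A w) = of_real (b \<bullet> b - q) + of_real (2 * (b \<bullet> u)) * px w +
    of_real (2 * (b \<bullet> v)) * py w + (poly rp w / w ^ n)\<^sup>2"
proof -
  have e: "complex_of_real (x \<bullet> y) = of_real (x $ 1) * of_real (y $ 1) + of_real (x $ 2) * of_real (y $ 2)
     + of_real (x $ 3) * of_real (y $ 3)" for x y :: "real^3"
    by (simp add: inner_vec_def sum_3)
  have "power_of (A w) = of_real (b \<bullet> b) - of_real q + 2 * of_real (b \<bullet> u) * px w + 2 * of_real (b \<bullet> v) * py w +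
      of_real (u \<bullet> u) * (px w)\<^sup>2 + of_real (v \<bullet> v) * (py w)\<^sup>2 + 2 * of_real (u \<bullet> v) * (px w * py w)"
    unfolding power_of_def A_nth e by (simp add: power2_eq_square algebra_simps)
  then show ?thesis unfolding uu vv uv px_py_squares[OF assms, symmetric] by simp
qed

lemma poly_f3:
  assumes "w \<noteq> 0"
  shows "poly f3 w = w ^ K * power_of (A w)"
proof -
  have 1: "w ^ (n + d) * w ^ (K - (n + d)) = w ^ K"
    unfolding power_add[symmetric] using K_ge by simp
  have "w ^ n * w ^ n * w ^ (K - 2 * n) = w ^ (n + n + (K - 2 * n))" by (simp only: power_add)
  also have "n + n + (K - 2 * n) = K" using K_ge by simp
  finally have 2: "w ^ n * w ^ n * w ^ (K - 2 * n) = w ^ K" .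
  have "poly f3 w = of_real (b \<bullet> b - q) * w ^ K +
      (w ^ (n + d) * w ^ (K - (n + d))) * (of_real (2 * (b \<bullet> u)) * px w + of_real (2 * (b \<bullet> v)) * py w) +
      poly rp w * poly rp w * w ^ (K - 2 * n)"
    unfolding f3_def poly_add poly_mult poly_smult poly_monom poly_comb_nz[OF assms] by (simp add: mult_ac)
  also have "poly rp w * poly rp w * w ^ (K - 2 * n) =
      (w ^ n * w ^ n * w ^ (K - 2 * n)) * (poly rp w / w ^ n)\<^sup>2"
    using assms by (simp add: power_divide power2_eq_square)
  finally show ?thesis unfolding power_of_A[OF assms] 1 2 by (simp add: algebra_simps)
qed

lemma comb_independent:
  assumes "smult x (Ah 1) + smult y (Ah 2) = 0"
  shows "x = 0 \<and> y = 0"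
proof -
  have z: "x * of_real (s $ 1) + y * of_real (s $ 2) = 0" if "s \<in> {b, u, v}" for s
    using assms that unfolding Ah_def smult_comb comb_add comb_eq_0_iff by blast
  have "Re x * s $ 1 + Re y * s $ 2 = 0" "Im x * s $ 1 + Im y * s $ 2 = 0" if "s \<in> {b, u, v}" for s
    using arg_cong[OF z[OF that], of Re] arg_cong[OF z[OF that], of Im] by simp_all
  then have "Re x = 0 \<and> Re y = 0" "Im x = 0 \<and> Im y = 0"
    using not_vertical[of "Re x" "Re y"] not_vertical[of "Im x" "Im y"] by blast+
  then show ?thesis by (simp add: complex_eq_iff)
qed

lemma Ah_nz: "Ah 1 \<noteq> 0" "Ah 2 \<noteq> 0"
  using comb_independent[of 1 0] comb_independent[of 0 1] by auto

lemma directions_nz: "u $ 1 \<noteq> 0 \<or> v $ 1 \<noteq> 0 \<or> u $ 2 \<noteq> 0 \<or> v $ 2 \<noteq> 0"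
proof (rule ccontr)
  assume "\<not> ?thesis"
  then have 0: "u $ 1 = 0" "v $ 1 = 0" "u $ 2 = 0" "v $ 2 = 0" by auto
  have "b $ 2 = 0 \<and> - b $ 1 = 0" by (rule not_vertical) (simp_all add: 0)
  then show False using not_vertical[of 1 0] 0 by simp
qed

lemma real_comb_nz: "x \<noteq> 0 \<or> y \<noteq> 0 \<Longrightarrow> complex_of_real x + \<i> * complex_of_real y \<noteq> 0"
  "x \<noteq> 0 \<or> y \<noteq> 0 \<Longrightarrow> complex_of_real x - \<i> * complex_of_real y \<noteq> 0"
  by (auto simp: complex_eq_iff)

lemma Ah_at_0: "poly (Ah 1) 0 \<noteq> 0 \<or> poly (Ah 2) 0 \<noteq> 0"
proof -
  have "(complex_of_real (u $ 1) + \<i> * complex_of_real (v $ 1)) \<noteq> 0 \<or>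
      (complex_of_real (u $ 2) + \<i> * complex_of_real (v $ 2)) \<noteq> 0"
    using real_comb_nz(1) directions_nz by blast
  then show ?thesis by (simp add: Ah_def poly_comb_0)
qed

lemma max_degree_Ah: "max (degree (Ah 1)) (degree (Ah 2)) = 2 * (n + d)"
proof -
  have "(complex_of_real (u $ 1) - \<i> * complex_of_real (v $ 1)) \<noteq> 0 \<or>
      (complex_of_real (u $ 2) - \<i> * complex_of_real (v $ 2)) \<noteq> 0"
    using real_comb_nz(2) directions_nz by blast
  then have "coeff (Ah 1) (2 * (n + d)) \<noteq> 0 \<or> coeff (Ah 2) (2 * (n + d)) \<noteq> 0"
    unfolding Ah_def coeff_comb by simp
  then have "2 * (n + d) \<le> degree (Ah 1) \<or> 2 * (n + d) \<le> degree (Ah 2)" using le_degree by blast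
  moreover have "degree (Ah k) \<le> 2 * (n + d)" for k unfolding Ah_def by (rule coeff_comb(3))
  ultimately show ?thesis by (metis max.absorb1 max.absorb2 le_antisym)
qed

lemma degree_f12:
  "degree f1 = K - (n + d) + degree (Ah 1)" "degree f2 = K - (n + d) + degree (Ah 2)"
  using Ah_nz by (simp_all add: f1_def f2_def degree_mult_eq degree_monom_eq monom_eq_0_iff)

lemma f1_nz: "f1 \<noteq> 0" using Ah_nz by (simp add: f1_def monom_eq_0_iff)

lemma f2_indep: "f2 \<noteq> smult c f1"
proof
  assume "f2 = smult c f1"
  then have "monom 1 (K - (n + d)) * (smult (- c) (Ah 1) + smult 1 (Ah 2)) = 0"
    by (simp add: f1_def f2_def algebra_simps)
  then have "smult (- c) (Ah 1) + smult 1 (Ah 2) = 0" by (simp add: monom_eq_0_iff)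
  from comb_independent[OF this] show False by simp
qed

definition "\<kappa> = degree (gcd (Ah 1) (Ah 2))"
definition "\<kappa>' = degree (gcd (gcd f1 f2) f3)"

lemma degree_gcd_f12: "degree (gcd f1 f2) = K - (n + d) + \<kappa>"
proof -
  have g: "gcd (Ah 1) (Ah 2) \<noteq> 0" using Ah_nz by simp
  have "degree (gcd f1 f2) = degree (normalize (monom 1 (K - (n + d)) * gcd (Ah 1) (Ah 2)))"
    unfolding f1_def f2_def gcd_mult_left ..
  also have "\<dots> = degree (monom 1 (K - (n + d)) * gcd (Ah 1) (Ah 2))"
    using g by (intro degree_eq_if_dvd_dvd) (simp_all add: monom_eq_0_iff)
  also have "\<dots> = K - (n + d) + \<kappa>"
    using g by (simp add: degree_mult_eq degree_monom_eq monom_eq_0_iff \<kappa>_def)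
  finally show ?thesis .
qed

lemma max_degree_f12: "max (degree f1) (degree f2) = K + (n + d)"
proof -
  have "max (c + x) (c + y) = c + max x y" for c x y :: nat by (simp add: max_def)
  then show ?thesis unfolding degree_f12 using max_degree_Ah K_ge by simp
qed

lemma poly_f3_0: "d < n \<Longrightarrow> poly f3 0 = 1 / 4"
proof -
  assume dn: "d < n"
  then have K: "K = 2 * n" "K - (n + d) > 0" by (simp_all add: K_def)
  then show ?thesis using n_pos
    by (simp add: f3_def poly_monom poly_rp power_0_left)
qed

text \<open>For d < n the maximum is attained by \<open>f3\<close>, through the leading term of r^2;
  for d > n it is attained by \<open>f1\<close> or \<open>f2\<close>.\<close>

lemma max_degree_f: "max (max (degree f1) (degree f2)) (degree f3) = 2 * K"
proof -
  have "rp \<noteq> 0" using degree_rp n_pos by auto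
  then have rr: "degree (rp * rp) = 4 * n" using degree_rp by (simp add: degree_mult_eq)
  show ?thesis
  proof (cases "d < n")
    case True
    then have K: "K = 2 * n" by (simp add: K_def)
    have c: "coeff f3 (4 * n) = 1 / 4"
    proof -
      have "degree (smult (of_real (b \<bullet> b - q)) (monom 1 K) :: complex poly) < 4 * n"
        by (rule le_less_trans[OF degree_smult_le]) (use n_pos in \<open>simp add: degree_monom_eq K\<close>)
      moreover have "degree (comb 0 (of_real (2 * (b \<bullet> u))) (of_real (2 * (b \<bullet> v))) * monom 1 (K - (n + d))) < 4 * n"
        using coeff_comb(3)[of 0 "of_real (2 * (b \<bullet> u))" "of_real (2 * (b \<bullet> v))"] True n_pos K
          degree_mult_le[of "comb 0 (of_real (2 * (b \<bullet> u))) (of_real (2 * (b \<bullet> v)))" "monom 1 (K - (n + d))"]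
        by (simp add: degree_monom_eq)
      moreover have "coeff (rp * rp) (4 * n) = 1 / 4"
        using coeff_mult_degree_sum[of rp rp] by (simp add: degree_rp coeff_rp)
      ultimately show ?thesis unfolding f3_def coeff_add K by (simp add: coeff_eq_0)
    qed
    have "degree f3 \<le> 4 * n" unfolding f3_def
    proof (intro degree_add_le)
      show "degree (smult (of_real (b \<bullet> b - q)) (monom 1 K) :: complex poly) \<le> 4 * n"
        by (rule order_trans[OF degree_smult_le]) (simp add: degree_monom_eq K)
      show "degree (comb 0 (of_real (2 * (b \<bullet> u))) (of_real (2 * (b \<bullet> v))) * monom 1 (K - (n + d))) \<le> 4 * n"
        using coeff_comb(3)[of 0 "of_real (2 * (b \<bullet> u))" "of_real (2 * (b \<bullet> v))"] True K
          degree_mult_le[of "comb 0 (of_real (2 * (b \<bullet> u))) (of_real (2 * (b \<bullet> v)))" "monom 1 (K - (n + d))"]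
        by (simp add: degree_monom_eq)
      show "degree (rp * rp * monom 1 (K - 2 * n)) \<le> 4 * n" by (simp add: K rr)
    qed
    moreover have "4 * n \<le> degree f3" by (rule le_degree) (simp add: c)
    ultimately show ?thesis unfolding max_degree_f12 using True K by simp
  next
    case False
    then have dn: "n < d" using n_neq_d by simp
    then have K: "K = n + d" by (simp add: K_def)
    have "degree f3 \<le> 2 * (n + d)" unfolding f3_def
    proof (intro degree_add_le)
      show "degree (smult (of_real (b \<bullet> b - q)) (monom 1 K) :: complex poly) \<le> 2 * (n + d)"
        by (rule order_trans[OF degree_smult_le]) (simp add: degree_monom_eq K)
      show "degree (comb 0 (of_real (2 * (b \<bullet> u))) (of_real (2 * (b \<bullet> v))) * monom 1 (K - (n + d))) \<le> 2 * (n + d)"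
        using coeff_comb(3)[of 0 "of_real (2 * (b \<bullet> u))" "of_real (2 * (b \<bullet> v))"] K by simp
      show "degree (rp * rp * monom 1 (K - 2 * n)) \<le> 2 * (n + d)"
        using degree_mult_le[of "rp * rp" "monom 1 (K - 2 * n)"] dn by (simp add: K rr degree_monom_eq)
    qed
    then show ?thesis unfolding max_degree_f12 using K by simp
  qed
qed

text \<open>The curve does not lie on the sphere of zero power. For d > n the value at w = 0 would
  force \<open>b\<close> to be orthogonal to \<open>u\<close> and \<open>v\<close>, and then r^2
  would have to be constant.\<close>

lemma f3_nz: "f3 \<noteq> 0"
proof
  assume 0: "f3 = 0"
  show False
  proof (cases "d < n")
    case True
    then show False using poly_f3_0 0 by simp
  next
    case False
    then have dn: "n < d" using n_neq_d by simp
    then have K: "K = n + d" by (simp add: K_def)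
    have "poly f3 0 = complex_of_real (2 * (b \<bullet> u)) / 4 + \<i> * complex_of_real (2 * (b \<bullet> v)) / 4"
      using dn n_pos by (simp add: f3_def K poly_monom power_0_left poly_comb_0 add_divide_distrib)
    then have "b \<bullet> u = 0" "b \<bullet> v = 0" unfolding 0 by (auto simp: complex_eq_iff)
    then have "f3 = monom 1 (d - n) * (smult (of_real (b \<bullet> b - q)) (monom 1 (2 * n)) + rp * rp)"
      using dn by (simp add: f3_def K comb_def distrib_left mult_monom mult.commute smult_monom)
    then have "smult (of_real (b \<bullet> b - q)) (monom 1 (2 * n)) + rp * rp = 0"
      using 0 by (simp add: monom_eq_0_iff)
    from arg_cong[OF this, of "\<lambda>p. poly p 0"] show False
      using n_pos by (simp add: poly_monom poly_rp power_0_left)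
  qed
qed

lemma no_common_root_at_0: "poly (gcd (gcd f1 f2) f3) 0 \<noteq> 0"
proof
  assume 0: "poly (gcd (gcd f1 f2) f3) 0 = 0"
  note f = poly_gcd_root(1)[OF poly_gcd_root(1)[OF 0]] poly_gcd_root(2)[OF poly_gcd_root(1)[OF 0]]
    poly_gcd_root(2)[OF 0]
  show False
  proof (cases "d < n")
    case True
    then show False using poly_f3_0 f by simp
  next
    case False
    then have "K = n + d" using n_neq_d by (simp add: K_def)
    then show False using f Ah_at_0 by (simp add: f1_def f2_def)
  qed
qed

end

section \<open>Circles of the congruence and the generic circle of the system\<close>

context rose_surface
begin

text \<open>A fibre of the map (x : y : power), written with a factor \<open>l\<close> so that l = 0
  includes the base points.\<close>

definition circle_through :: "complex^3 \<Rightarrow> (complex^3) set" where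
  "circle_through x = {y. \<exists>l. y $ 1 = l * x $ 1 \<and> y $ 2 = l * x $ 2 \<and> power_of y = l * power_of x}"

text \<open>In the plane of direction \<open>e\<close> the equation of a circle says that the power
  equals 2 c r, so both horizontal coordinates and the power are proportional to r along it.\<close>

lemma circle_unique:
  assumes "C \<in> congruence p" "x \<in> C" "x \<notin> z_axis"
  shows "C = circle_through x"
proof -
  obtain e c where C: "C = circle_in e c p" and e: "(e $ 1)\<^sup>2 + (e $ 2)\<^sup>2 = 1"
    using assms(1) unfolding congruence_def by blast
  have mem: "y \<in> C \<longleftrightarrow> (\<exists>r. y $ 1 = r * e $ 1 \<and> y $ 2 = r * e $ 2 \<and> power_of y = 2 * c * r)" for y
  proof -
    have pw: "power_of y = r\<^sup>2 + (y $ 3)\<^sup>2 - p\<^sup>2" if "y $ 1 = r * e $ 1" "y $ 2 = r * e $ 2" for r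
    proof -
      have "(y $ 1)\<^sup>2 + (y $ 2)\<^sup>2 = r\<^sup>2 * ((e $ 1)\<^sup>2 + (e $ 2)\<^sup>2)"
        unfolding that by (simp add: power_mult_distrib distrib_left)
      then show ?thesis unfolding power_of_def e p2 by simp
    qed
    show ?thesis
    proof
      assume "y \<in> C"
      then obtain r z where y: "y = vector [r * e $ 1, r * e $ 2, z]" "r\<^sup>2 + z\<^sup>2 - 2 * c * r - p\<^sup>2 = 0"
        unfolding C circle_in_def by blast
      then show "\<exists>r. y $ 1 = r * e $ 1 \<and> y $ 2 = r * e $ 2 \<and> power_of y = 2 * c * r"
        using pw[of r] by (intro exI[of _ r]) (simp add: algebra_simps)
    next
      assume "\<exists>r. y $ 1 = r * e $ 1 \<and> y $ 2 = r * e $ 2 \<and> power_of y = 2 * c * r"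
      then obtain r where r: "y $ 1 = r * e $ 1" "y $ 2 = r * e $ 2" "power_of y = 2 * c * r" by blast
      have "y = vector [r * e $ 1, r * e $ 2, y $ 3]" using r by (simp add: vec_eq_iff forall_3)
      moreover have "r\<^sup>2 + (y $ 3)\<^sup>2 - 2 * c * r - p\<^sup>2 = 0" using pw[OF r(1,2)] r(3) by simp
      ultimately show "y \<in> C" unfolding C circle_in_def by blast
    qed
  qed
  obtain r where r: "x $ 1 = r * e $ 1" "x $ 2 = r * e $ 2" "power_of x = 2 * c * r"
    using assms(2) unfolding mem by blast
  have r0: "r \<noteq> 0" using assms(3) r by (auto simp: z_axis_def)
  show ?thesis
  proof (rule set_eqI, rule iffI)
    fix y assume "y \<in> C"
    then obtain s where "y $ 1 = s * e $ 1" "y $ 2 = s * e $ 2" "power_of y = 2 * c * s" unfolding mem by blast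
    then show "y \<in> circle_through x" unfolding circle_through_def r
      using r0 by (intro CollectI exI[of _ "s / r"]) simp
  next
    fix y assume "y \<in> circle_through x"
    then obtain l where "y $ 1 = l * x $ 1" "y $ 2 = l * x $ 2" "power_of y = l * power_of x"
      unfolding circle_through_def by blast
    then show "y \<in> C" unfolding mem r by (intro exI[of _ "l * r"]) simp
  qed
qed

lemma self_in_circle_through: "x \<in> circle_through x"
  unfolding circle_through_def by (intro CollectI exI[of _ 1]) simp

text \<open>The horizontal part of \<open>x\<close> can be normalized to a unit vector because it is
  not isotropic.\<close>

lemma circle_through_in_congruence:
  assumes "(x $ 1)\<^sup>2 + (x $ 2)\<^sup>2 \<noteq> 0"
  shows "circle_through x \<in> congruence p" "x \<notin> z_axis"
proof -
  show z: "x \<notin> z_axis" using assms by (auto simp: z_axis_def)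
  define r where "r = csqrt ((x $ 1)\<^sup>2 + (x $ 2)\<^sup>2)"
  have r: "r\<^sup>2 = (x $ 1)\<^sup>2 + (x $ 2)\<^sup>2" "r \<noteq> 0" using assms by (simp_all add: r_def)
  define e :: "complex^2" where "e = vector [x $ 1 / r, x $ 2 / r]"
  define c where "c = power_of x / (2 * r)"
  have "(e $ 1)\<^sup>2 + (e $ 2)\<^sup>2 = ((x $ 1)\<^sup>2 + (x $ 2)\<^sup>2) / r\<^sup>2"
    by (simp add: e_def power_divide add_divide_distrib)
  also have "\<dots> = r\<^sup>2 / r\<^sup>2" unfolding r(1) ..
  finally have e: "(e $ 1)\<^sup>2 + (e $ 2)\<^sup>2 = 1" using r(2) by simp
  then have C: "circle_in e c p \<in> congruence p" unfolding congruence_def by blast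
  have "x = vector [r * e $ 1, r * e $ 2, x $ 3]" using r(2) by (simp add: e_def vec_eq_iff forall_3)
  moreover have "r\<^sup>2 + (x $ 3)\<^sup>2 - 2 * c * r - p\<^sup>2 = 0"
  proof -
    have "2 * c * r = power_of x" using r(2) by (simp add: c_def)
    then show ?thesis unfolding r(1) p2 by (simp add: power_of_def)
  qed
  ultimately have "x \<in> circle_in e c p" unfolding circle_in_def by blast
  from circle_unique[OF C this z] C show "circle_through x \<in> congruence p" by simp
qed

abbreviation "\<alpha> \<equiv> rose_curve n d a b u v"

lemma circle_system_cases:
  assumes "C \<in> circle_system \<alpha> p"
  obtains w where "w \<noteq> 0" "A w \<notin> z_axis" "C = circle_through (A w)"
proof -
  obtain x where x: "x \<in> \<alpha>" "x \<notin> z_axis" "x \<in> C" "C \<in> congruence p"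
    using assms unfolding circle_system_def by blast
  then obtain w where "w \<noteq> 0" "x = A w" unfolding rose_curve_eq by blast
  with x circle_unique that show thesis by blast
qed

lemma circle_through_in_system:
  assumes "w \<noteq> 0" "(A w $ 1)\<^sup>2 + (A w $ 2)\<^sup>2 \<noteq> 0"
  shows "circle_through (A w) \<in> circle_system \<alpha> p"
  unfolding circle_system_def rose_curve_eq
  using circle_through_in_congruence[OF assms(2)] self_in_circle_through assms(1) by blast

lemma MOST_not_isotropic: "MOST w. (A w $ 1)\<^sup>2 + (A w $ 2)\<^sup>2 \<noteq> 0"
proof -
  have nz: "smult 1 (Ah 1) + smult \<i> (Ah 2) \<noteq> 0" "smult 1 (Ah 1) + smult (- \<i>) (Ah 2) \<noteq> 0"
    using comb_independent[of 1 \<i>] comb_independent[of 1 "- \<i>"] by auto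
  show ?thesis using MOST_poly_nonzero[OF nz(1)] MOST_poly_nonzero[OF nz(2)] MOST_nonzero
  proof eventually_elim
    case (elim w)
    have "(A w $ 1 + \<i> * A w $ 2) \<noteq> 0" "(A w $ 1 - \<i> * A w $ 2) \<noteq> 0"
    proof -
      have "poly (smult 1 (Ah 1) + smult \<i> (Ah 2)) w = w ^ (n + d) * (A w $ 1 + \<i> * A w $ 2)"
        "poly (smult 1 (Ah 1) + smult (- \<i>) (Ah 2)) w = w ^ (n + d) * (A w $ 1 - \<i> * A w $ 2)"
        using elim(3) by (simp_all add: poly_Ah algebra_simps)
      with elim show "(A w $ 1 + \<i> * A w $ 2) \<noteq> 0" "(A w $ 1 - \<i> * A w $ 2) \<noteq> 0" by auto
    qed
    moreover have "(x + \<i> * y) * (x - \<i> * y) = x\<^sup>2 + y\<^sup>2" for x y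
      by (simp add: algebra_simps power2_eq_square)
    ultimately show ?case by (metis mult_eq_0_iff)
  qed
qed

definition "fib s = {t. poly f1 t \<noteq> 0 \<and> poly f2 t / poly f1 t = poly f2 s / poly f1 s \<and>
  poly f3 t / poly f1 t = poly f3 s / poly f1 s}"

lemma ratios:
  assumes "w \<noteq> 0"
  shows "poly f1 w \<noteq> 0 \<longleftrightarrow> A w $ 1 \<noteq> 0" "poly f2 w / poly f1 w = A w $ 2 / A w $ 1"
    "poly f3 w / poly f1 w = power_of (A w) / A w $ 1"
  using assms by (simp_all add: poly_f12 poly_f3)

text \<open>Since \<open>f1\<close> and \<open>f2\<close> are not proportional, a given
  \<open>t\<close> lies in \<open>fib s\<close> for finitely many \<open>s\<close> with nonzero
  \<open>f1\<close>, and the zeros of \<open>f1\<close> are finite in number as well.\<close>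

lemma MOST_fib:
  assumes "MOST t. Q t"
  shows "MOST s. \<forall>t\<in>fib s. Q t"
proof -
  have nz: "smult (poly f1 t) f2 - smult (poly f2 t) f1 \<noteq> 0" if "poly f1 t \<noteq> 0" for t
  proof
    assume "smult (poly f1 t) f2 - smult (poly f2 t) f1 = 0"
    then have "smult (1 / poly f1 t) (smult (poly f1 t) f2) = smult (1 / poly f1 t) (smult (poly f2 t) f1)" by simp
    then show False using that f2_indep by simp
  qed
  have "{s. \<not> (\<forall>t\<in>fib s. Q t)} \<subseteq> {s. poly f1 s = 0} \<union>
      (\<Union>t\<in>{t. \<not> Q t} \<inter> {t. poly f1 t \<noteq> 0}. {s. poly (smult (poly f1 t) f2 - smult (poly f2 t) f1) s = 0})"
  proof
    fix s assume "s \<in> {s. \<not> (\<forall>t\<in>fib s. Q t)}"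
    then obtain t where t: "t \<in> fib s" "\<not> Q t" by blast
    then have f: "poly f1 t \<noteq> 0" "poly f2 t / poly f1 t = poly f2 s / poly f1 s" by (simp_all add: fib_def)
    show "s \<in> {s. poly f1 s = 0} \<union>
      (\<Union>t\<in>{t. \<not> Q t} \<inter> {t. poly f1 t \<noteq> 0}. {s. poly (smult (poly f1 t) f2 - smult (poly f2 t) f1) s = 0})"
    proof (cases "poly f1 s = 0")
      case False
      then have "poly (smult (poly f1 t) f2 - smult (poly f2 t) f1) s = 0"
        using f by (simp add: frac_eq_eq mult.commute)
      with t f(1) show ?thesis by blast
    qed simp
  qed
  moreover have "finite \<dots>"
    using assms nz f1_nz by (intro finite_UnI finite_UN_I poly_roots_finite) (auto simp: eventually_cofinite)
  ultimately show ?thesis unfolding eventually_cofinite by (rule finite_subset)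
qed

lemma px_py_A:
  "px w = (A w $ 1 - of_real (b $ 1)) * of_real (u $ 1) + (A w $ 2 - of_real (b $ 2)) * of_real (u $ 2) +
    (A w $ 3 - of_real (b $ 3)) * of_real (u $ 3)"
  "py w = (A w $ 1 - of_real (b $ 1)) * of_real (v $ 1) + (A w $ 2 - of_real (b $ 2)) * of_real (v $ 2) +
    (A w $ 3 - of_real (b $ 3)) * of_real (v $ 3)"
proof -
  have e: "complex_of_real (x $ 1) * of_real (y $ 1) + of_real (x $ 2) * of_real (y $ 2)
     + of_real (x $ 3) * of_real (y $ 3) = complex_of_real (x \<bullet> y)" for x y :: "real^3"
    by (simp add: inner_vec_def sum_3)
  have lin: "(A w $ 1 - of_real (b $ 1)) * of_real (s $ 1) + (A w $ 2 - of_real (b $ 2)) * of_real (s $ 2) +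
    (A w $ 3 - of_real (b $ 3)) * of_real (s $ 3) =
    px w * of_real (u \<bullet> s) + py w * of_real (v \<bullet> s)" for s
    unfolding A_nth e[symmetric] by (simp add: algebra_simps)
  show "px w = (A w $ 1 - of_real (b $ 1)) * of_real (u $ 1) + (A w $ 2 - of_real (b $ 2)) * of_real (u $ 2) +
    (A w $ 3 - of_real (b $ 3)) * of_real (u $ 3)"
    unfolding lin uu inner_commute[of v u] uv by simp
  show "py w = (A w $ 1 - of_real (b $ 1)) * of_real (v $ 1) + (A w $ 2 - of_real (b $ 2)) * of_real (v $ 2) +
    (A w $ 3 - of_real (b $ 3)) * of_real (v $ 3)"
    unfolding lin vv uv by simp
qed

lemma A_eq_iff: "A w = A w' \<longleftrightarrow> px w = px w' \<and> py w = py w'"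
proof
  assume "A w = A w'"
  then show "px w = px w' \<and> py w = py w'" unfolding px_py_A by simp
qed (simp add: A_def)

context
  fixes e' :: nat
  assumes e': "e' > 0" "MOST s. card (fib s) = e'"
begin

text \<open>Every parameter on the circle of \<open>w\<close>, and not only \<open>w\<close>, has to
  be generic: then each point of the curve on this circle has exactly \<open>branches\<close>
  parameters.\<close>

definition "good w \<longleftrightarrow> w \<noteq> 0 \<and> poly f1 w \<noteq> 0 \<and> (A w $ 1)\<^sup>2 + (A w $ 2)\<^sup>2 \<noteq> 0 \<and> card (fib w) = e' \<and>
  (\<forall>t\<in>fib w. t \<noteq> 0 \<and> card {t'. t' \<noteq> 0 \<and> px t' = px t \<and> py t' = py t} = branches)"

lemma MOST_good: "MOST w. good w"
proof -
  have "MOST t. t \<noteq> 0 \<and> card {t'. t' \<noteq> 0 \<and> px t' = px t \<and> py t' = py t} = branches"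
    using MOST_nonzero MOST_card_branches by eventually_elim simp
  from MOST_fib[OF this] MOST_nonzero MOST_poly_nonzero[OF f1_nz] MOST_not_isotropic e'(2)
  show ?thesis unfolding good_def by eventually_elim blast
qed

lemma fib_A:
  assumes "good w" "t \<noteq> 0" "s \<in> fib w" "A t = A s"
  shows "t \<in> fib w"
proof -
  have s: "s \<noteq> 0" using assms by (auto simp: good_def)
  show ?thesis using assms(3) unfolding fib_def ratios[OF s] mem_Collect_eq
    using ratios[OF assms(2)] ratios(1)[OF s] unfolding assms(4) by simp
qed

lemma curve_meets_circle:
  assumes "good w"
  shows "(\<alpha> - z_axis) \<inter> circle_through (A w) = A ` fib w"
proof (rule set_eqI, rule iffI)
  have w: "w \<noteq> 0" "A w $ 1 \<noteq> 0" using assms ratios(1)[of w] by (auto simp: good_def)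
  {
    fix x assume "x \<in> (\<alpha> - z_axis) \<inter> circle_through (A w)"
    then obtain t l where t: "t \<noteq> 0" "x = A t" "A t \<notin> z_axis" and
      l: "A t $ 1 = l * A w $ 1" "A t $ 2 = l * A w $ 2" "power_of (A t) = l * power_of (A w)"
      unfolding rose_curve_eq circle_through_def by blast
    have l0: "l \<noteq> 0" using t(3) l by (auto simp: z_axis_def)
    have "t \<in> fib w" unfolding fib_def mem_Collect_eq ratios[OF t(1)] ratios(2,3)[OF w(1)] l
      using l0 w(2) by simp
    then show "x \<in> A ` fib w" using t by blast
  next
    fix x assume "x \<in> A ` fib w"
    then obtain t where t: "t \<in> fib w" "x = A t" by blast
    then have t0: "t \<noteq> 0" using assms by (auto simp: good_def)
    have r: "A t $ 1 \<noteq> 0" "A t $ 2 / A t $ 1 = A w $ 2 / A w $ 1"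
      "power_of (A t) / A t $ 1 = power_of (A w) / A w $ 1"
      using t(1) unfolding fib_def mem_Collect_eq ratios[OF t0] ratios(2,3)[OF w(1)] by blast+
    have "A t \<notin> z_axis" using r(1) by (simp add: z_axis_def)
    moreover have "A t \<in> circle_through (A w)" unfolding circle_through_def
    proof (intro CollectI exI[of _ "A t $ 1 / A w $ 1"] conjI)
      show "A t $ 1 = A t $ 1 / A w $ 1 * A w $ 1" using w by simp
      have "A t $ 2 = A t $ 1 * (A t $ 2 / A t $ 1)" using r(1) by simp
      then show "A t $ 2 = A t $ 1 / A w $ 1 * A w $ 2" unfolding r(2) by simp
      have "power_of (A t) = A t $ 1 * (power_of (A t) / A t $ 1)" using r(1) by simp
      then show "power_of (A t) = A t $ 1 / A w $ 1 * power_of (A w)" unfolding r(3) by simp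
    qed
    ultimately show "x \<in> (\<alpha> - z_axis) \<inter> circle_through (A w)"
      using t t0 unfolding rose_curve_eq by blast
  }
qed

lemma finite_fib: "good w \<Longrightarrow> finite (fib w)"
  using e'(1) unfolding good_def by (metis card.infinite less_irrefl)

text \<open>The e' parameters on a generic circle are grouped by points of the curve, each with
  \<open>branches\<close> parameters.\<close>

lemma card_curve_meets_circle:
  assumes "good w"
  shows "card ((\<alpha> - z_axis) \<inter> circle_through (A w)) * branches = e'"
proof -
  have "card {t \<in> fib w. A t = y} = branches" if y: "y \<in> A ` fib w" for y
  proof -
    obtain s where s: "s \<in> fib w" "y = A s" using y by blast
    have "{t \<in> fib w. A t = y} = {t. t \<noteq> 0 \<and> px t = px s \<and> py t = py s}"
    proof (rule set_eqI, rule iffI)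
      fix t assume "t \<in> {t \<in> fib w. A t = y}"
      then show "t \<in> {t. t \<noteq> 0 \<and> px t = px s \<and> py t = py s}"
        using assms s A_eq_iff[of t s] unfolding good_def by blast
    next
      fix t assume "t \<in> {t. t \<noteq> 0 \<and> px t = px s \<and> py t = py s}"
      then have "t \<noteq> 0" "A t = A s" using A_eq_iff[of t s] by blast+
      then show "t \<in> {t \<in> fib w. A t = y}" using fib_A[OF assms _ s(1)] s(2) by blast
    qed
    then show ?thesis using assms s(1) unfolding good_def by simp
  qed
  moreover have "card (fib w) = (\<Sum>y\<in>A ` fib w. card {t \<in> fib w. A t = y})"
    using sum.image_gen[OF finite_fib[OF assms], of "\<lambda>_. 1::nat" A] unfolding card_eq_sum .
  ultimately show ?thesis unfolding curve_meets_circle[OF assms] using assms by (simp add: good_def)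
qed

text \<open>Almost all parameters are good, and each circle has finitely many good ones. It is
  needed for the uniqueness of the number that defines \<open>circle_count\<close>.\<close>

lemma infinite_circle_system: "infinite (circle_system \<alpha> p)"
proof
  assume fin: "finite (circle_system \<alpha> p)"
  have "finite {w. good w \<and> circle_through (A w) = C}" for C
  proof (cases "\<exists>w0. good w0 \<and> circle_through (A w0) = C")
    case True
    then obtain w0 where w0: "good w0" "circle_through (A w0) = C" by blast
    have "{w. good w \<and> circle_through (A w) = C} \<subseteq> fib w0"
    proof clarify
      fix w assume w: "good w" "C = circle_through (A w)"
      have w1: "w \<noteq> 0" "A w \<notin> z_axis" using w(1) circle_through_in_congruence(2)[of "A w"]
        unfolding good_def by blast+
      then have "A w \<in> (\<alpha> - z_axis) \<inter> circle_through (A w0)"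
        unfolding w0(2) w(2) rose_curve_eq using self_in_circle_through by blast
      then obtain s where "s \<in> fib w0" "A w = A s" unfolding curve_meets_circle[OF w0(1)] by blast
      then show "w \<in> fib w0" using fib_A[OF w0(1) w1(1)] by blast
    qed
    then show ?thesis using finite_fib[OF w0(1)] finite_subset by blast
  next
    case False
    then have "{w. good w \<and> circle_through (A w) = C} = {}" by blast
    then show ?thesis by (simp only: finite.emptyI)
  qed
  then have "finite (\<Union>C\<in>circle_system \<alpha> p. {w. good w \<and> circle_through (A w) = C})" using fin by blast
  moreover have "{w. good w} \<subseteq> (\<Union>C\<in>circle_system \<alpha> p. {w. good w \<and> circle_through (A w) = C})"
    using circle_through_in_system unfolding good_def by blast
  ultimately have "finite {w. good w}" using finite_subset by blast
  moreover have "finite {w. \<not> good w}" using MOST_good by (simp only: eventually_cofinite)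
  ultimately have "finite ({w. good w} \<union> {w. \<not> good w})" by (rule finite_UnI)
  moreover have "{w. good w} \<union> {w. \<not> good w} = UNIV" by blast
  ultimately show False using infinite_UNIV_char_0[where 'a = complex] by simp
qed

text \<open>Circles with a different number of points can only come from the finitely many
  parameters that are not good.\<close>

lemma circle_count_branches: "circle_count \<alpha> p * branches = e'"
proof -
  have br: "branches > 0" by (simp add: branches_def)
  obtain w0 where w0: "good w0" using MOST_complex_ex[OF MOST_good] by blast
  define k where "k = card ((\<alpha> - z_axis) \<inter> circle_through (A w0))"
  have k: "card ((\<alpha> - z_axis) \<inter> circle_through (A w)) = k" if "good w" for w
  proof -
    have "card ((\<alpha> - z_axis) \<inter> circle_through (A w)) * branches = k * branches"
      unfolding k_def card_curve_meets_circle[OF that] card_curve_meets_circle[OF w0] ..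
    then show ?thesis using br by simp
  qed
  let ?B = "\<lambda>k. {C \<in> circle_system \<alpha> p. card ((\<alpha> - z_axis) \<inter> C) \<noteq> k}"
  have "?B k \<subseteq> (\<lambda>w. circle_through (A w)) ` {w. \<not> good w}"
  proof
    fix C assume C: "C \<in> ?B k"
    then obtain w where w: "w \<noteq> 0" "A w \<notin> z_axis" "C = circle_through (A w)"
      using circle_system_cases[of C] by blast
    then show "C \<in> (\<lambda>w. circle_through (A w)) ` {w. \<not> good w}" using k[of w] C by blast
  qed
  moreover have "finite {w. \<not> good w}" using MOST_good by (simp only: eventually_cofinite)
  ultimately have fin: "finite (?B k)" using finite_subset finite_imageI by blast
  have "circle_count \<alpha> p = k" unfolding circle_count_def
  proof (rule the_equality)
    show "finite (?B k)" by (rule fin)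
    fix k' assume fin': "finite (?B k')"
    show "k' = k"
    proof (rule ccontr)
      assume "k' \<noteq> k"
      then have "circle_system \<alpha> p \<subseteq> ?B k \<union> ?B k'" by blast
      with fin fin' infinite_circle_system show False using finite_subset by blast
    qed
  qed
  then show ?thesis using card_curve_meets_circle[OF w0] by (simp add: k_def)
qed

end

theorem surface_characters:
  "\<exists>e L m. L \<le> m \<and> branches * (e * L) + \<kappa> = 2 * (n + d) \<and> branches * (e * m) + \<kappa>' = 2 * K \<and>
    has_characters (circular_surface \<alpha> p) p (int (e * (L + m))) (int (e * L)) (int (e * (m - L))) (int (e * m))"
proof -
  obtain e' \<gamma> m where e': "e' > 0" "MOST s. card (fib s) = e'" and \<gamma>: "\<gamma> \<noteq> 0" "total_degree2 \<gamma> m"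
    and deg: "degree \<gamma> * e' + degree (gcd f1 f2) = max (degree f1) (degree f2)"
      "m * e' + degree (gcd (gcd f1 f2) f3) = max (max (degree f1) (degree f2)) (degree f3)"
    and gen: "\<forall>G. (MOST t. ev2 G (poly f2 t / poly f1 t) (poly f3 t / poly f1 t) = 0) \<longleftrightarrow> \<gamma> dvd G"
    by (rule rational_curve_equationE[where ?f3.0 = f3, OF f1_nz f2_indep, folded fib_def]) (rule that)
  let ?\<xi> = "\<lambda>t. poly f2 t / poly f1 t" and ?\<zeta> = "\<lambda>t. poly f3 t / poly f1 t"
  note gen' = gen[rule_format]
  have \<gamma>_vanishes: "MOST t. ev2 \<gamma> (?\<xi> t) (?\<zeta> t) = 0" by (rule iffD2[OF gen' dvd_refl])
  interpret plane_curve_equation \<gamma> m by unfold_locales (rule \<gamma>(2))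
  have MOST_f1: "MOST t. poly f1 t \<noteq> 0" by (rule MOST_poly_nonzero[OF f1_nz])
  define qc where "qc = complex_of_real q"
  have "polyfun (\<lambda>x::complex^4. W (x $ 1) (x $ 2) (x $ 3) (quadric qc x))"
    by (intro polyfun_hom2 polyfun_intros polyfun_quadric)
  then obtain F where F': "(\<lambda>x::complex^4. W (x $ 1) (x $ 2) (x $ 3) (quadric qc x)) = eval_cpoly F"
    unfolding polyfun_def by blast
  have F: "eval_cpoly F x = W (x $ 1) (x $ 2) (x $ 3) (quadric qc x)" for x
    using fun_cong[OF F', of x] by simp
  let ?X = "cone_over (\<Union> (circle_system \<alpha> p))"
  have quad: "quadric qc (c *s homog y) = c\<^sup>2 * power_of y" for c y
    by (simp add: quadric_def power_of_def homog_def qc_def power_mult_distrib algebra_simps)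
  \<comment> \<open>The vanishing for almost all parameters is a polynomial identity, so it extends
    to all nonzero w, including those whose first coordinate is 0.\<close>
  have WA: "W 1 (A w $ 1) (A w $ 2) (power_of (A w)) = 0" if w: "w \<noteq> 0" for w
  proof -
    obtain R where R: "\<And>T. poly R T = W (poly 1 T) (poly f1 T) (poly f2 T) (poly f3 T)"
      using ex_poly_hom2[of \<gamma> m 1 f1 f2 f3] by blast
    have "MOST t. poly R t = poly 0 t" using MOST_f1 \<gamma>_vanishes
      by eventually_elim (simp add: R W_affine)
    then have "R = 0" by (rule poly_eqI_MOST)
    then have "W 1 (w ^ K * A w $ 1) (w ^ K * A w $ 2) (w ^ K * power_of (A w)) = 0"
      using R[of w] by (simp add: poly_f12[OF w] poly_f3[OF w])
    then show ?thesis unfolding W_homogeneous using w by simp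
  qed
  have vanish: "eval_cpoly F x = 0" if x: "x \<in> ?X" for x
  proof -
    obtain c y C where y: "x = c *s homog y" "y \<in> C" "C \<in> circle_system \<alpha> p"
      using x unfolding cone_over_def by blast
    obtain w where w: "w \<noteq> 0" "A w \<notin> z_axis" "C = circle_through (A w)"
      using circle_system_cases[OF y(3)] by blast
    then obtain l where l: "y $ 1 = l * A w $ 1" "y $ 2 = l * A w $ 2" "power_of y = l * power_of (A w)"
      using y(2) unfolding circle_through_def by blast
    have "eval_cpoly F x = W (c * 1) (c * y $ 1) (c * y $ 2) (c\<^sup>2 * power_of y)"
      unfolding F y(1) quad by (simp add: homog_def)
    also have "\<dots> = 0" unfolding W_scale l W_homogeneous WA[OF w(1)] by simp
    finally show ?thesis .
  qed
  \<comment> \<open>Dehomogenized, such a point is the multiple \<open>b / a / A t $ 1\<close> of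
    \<open>A t\<close> in both horizontal coordinates and in the power, hence on the circle through
    \<open>A t\<close>.\<close>
  have points: "MOST t. \<forall>a b z. a \<noteq> 0 \<longrightarrow> b \<noteq> 0 \<longrightarrow>
      quadric qc (vector [a, b, ?\<xi> t * b, z]) = ?\<zeta> t * a * b \<longrightarrow> vector [a, b, ?\<xi> t * b, z] \<in> ?X"
    using MOST_f1 MOST_nonzero MOST_not_isotropic
  proof eventually_elim
    case (elim t)
    have A1: "A t $ 1 \<noteq> 0" using elim ratios(1)[of t] by blast
    show ?case
    proof (intro allI impI)
      fix a b z :: complex
      assume ab: "a \<noteq> 0" "b \<noteq> 0" "quadric qc (vector [a, b, ?\<xi> t * b, z]) = ?\<zeta> t * a * b"
      define y :: "complex^3" where "y = vector [b / a, ?\<xi> t * b / a, z / a]"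
      have x: "vector [a, b, ?\<xi> t * b, z] = a *s homog y"
        using ab by (simp add: y_def homog_def vec_eq_iff forall_4)
      have "a\<^sup>2 * power_of y = ?\<zeta> t * a * b" using ab(3) unfolding x quad .
      moreover have "x = z * b / a" if "a\<^sup>2 * x = z * a * b" for x z
        using that ab(1) by (simp add: power2_eq_square eq_divide_eq mult_ac)
      ultimately have pw: "power_of y = ?\<zeta> t * b / a" by blast
      have "y \<in> circle_through (A t)" unfolding circle_through_def
      proof (intro CollectI exI[of _ "b / a / A t $ 1"] conjI)
        show "y $ 1 = b / a / A t $ 1 * A t $ 1" using A1 by (simp add: y_def)
        show "y $ 2 = b / a / A t $ 1 * A t $ 2" by (simp add: y_def ratios(2)[OF elim(2)] mult.commute)
        show "power_of y = b / a / A t $ 1 * power_of (A t)"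
          unfolding pw ratios(3)[OF elim(2)] by (simp add: mult.commute)
      qed
      then show "vector [a, b, ?\<xi> t * b, z] \<in> ?X"
        unfolding x cone_over_def using circle_through_in_system[OF elim(2,3)] by blast
    qed
  qed
  have iso: "MOST t. 1 + (?\<xi> t)\<^sup>2 \<noteq> 0" using MOST_f1 MOST_nonzero MOST_not_isotropic
  proof eventually_elim
    case (elim t)
    have A1: "A t $ 1 \<noteq> 0" using elim ratios(1)[of t] by blast
    have "1 + (?\<xi> t)\<^sup>2 = ((A t $ 1)\<^sup>2 + (A t $ 2)\<^sup>2) / (A t $ 1)\<^sup>2"
      unfolding ratios(2)[OF elim(2)] using A1 by (simp add: power_divide add_divide_distrib)
    then show ?case using elim(3) A1 by simp
  qed
  have IG: "ideal_generator ?X F"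
    by (rule ideal_generator_surface[OF F gen' vanish points iso])
  \<comment> \<open>\<gamma> is not divisible by \<zeta>: as \<open>f3\<close> is not zero, the
    quotient \<open>H\<close> would vanish on the curve too, though its degree is smaller.\<close>
  have hz: "\<exists>x. ev2 \<gamma> x 0 \<noteq> 0"
  proof (rule ccontr)
    assume no: "\<nexists>x. ev2 \<gamma> x 0 \<noteq> 0"
    obtain c H where cH: "\<gamma> = pCons c H" by (cases \<gamma>)
    have "c = 0"
    proof (rule poly_eqI_MOST, rule MOST_I)
      fix x show "poly c x = poly 0 x" using no unfolding cH by (simp add: ev2_def)
    qed
    then have ev: "ev2 \<gamma> x y = y * ev2 H x y" for x y unfolding cH by (simp add: ev2_def)
    have "MOST t. ev2 H (?\<xi> t) (?\<zeta> t) = 0" using \<gamma>_vanishes MOST_f1 MOST_poly_nonzero[OF f3_nz]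
      by eventually_elim (simp add: ev)
    then have "\<gamma> dvd H" by (rule iffD1[OF gen'])
    moreover have "H \<noteq> 0" using \<gamma>(1) cH \<open>c = 0\<close> by auto
    ultimately have "degree \<gamma> \<le> degree H" by (rule dvd_imp_degree_le)
    then show False using \<open>H \<noteq> 0\<close> by (simp add: cH)
  qed
  let ?e = "circle_count \<alpha> p"
  have ch: "has_characters (circular_surface \<alpha> p) p (int (?e * (L + m))) (int (?e * L))
      (int (?e * (m - L))) (int (?e * m))"
    unfolding circular_surface_def using IG hz p2 by (intro has_characters_surface[OF F]) (simp_all add: qc_def)
  \<comment> \<open>The exponent of the surface replaces the division by e' with a division by
    \<open>branches\<close>.\<close>
  have eb: "?e * branches = e'" by (rule circle_count_branches[OF e'])
  have b: "branches * (?e * L) = L * e'" "branches * (?e * m) = m * e'" by (simp_all add: mult_ac flip: eb)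
  \<comment> \<open>\<open>J\<close> is the order K - (n + d) of the zero at w = 0 that
    \<open>f1\<close> and \<open>f2\<close> share; it cancels against their maximal degree K + (n +
    d).\<close>
  obtain J where "K = n + d + J" using le_Suc_ex[OF K_ge(1)] by blast
  then have eL: "branches * (?e * L) + \<kappa> = 2 * (n + d)"
    using deg(1) unfolding b degree_gcd_f12 max_degree_f12 by simp
  have em: "branches * (?e * m) + \<kappa>' = 2 * K" using deg(2) unfolding b max_degree_f \<kappa>'_def .
  show ?thesis
    by (rule exI[of _ ?e], rule exI[of _ L], rule exI[of _ m]) (intro conjI L_le eL em ch)
qed

end

section \<open>Parameters over the axis and over the base points\<close>

context rose_surface
begin

lemma axis_iff: "(w \<noteq> 0 \<and> A w \<in> z_axis) \<longleftrightarrow> poly (gcd (Ah 1) (Ah 2)) w = 0"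
proof
  assume w: "w \<noteq> 0 \<and> A w \<in> z_axis"
  then show "poly (gcd (Ah 1) (Ah 2)) w = 0"
    by (intro poly_gcd_rootI) (simp_all add: poly_Ah z_axis_def)
next
  assume r: "poly (gcd (Ah 1) (Ah 2)) w = 0"
  note r12 = poly_gcd_root[OF r]
  then have "w \<noteq> 0" using Ah_at_0 by blast
  with r12 show "w \<noteq> 0 \<and> A w \<in> z_axis" by (simp add: poly_Ah z_axis_def)
qed

lemma gcd3_root:
  assumes "poly (gcd (gcd f1 f2) f3) w = 0"
  shows "w \<noteq> 0" "A w \<in> z_axis" "power_of (A w) = 0"
proof -
  show w: "w \<noteq> 0" using assms no_common_root_at_0 by blast
  note r = poly_gcd_root(1)[OF poly_gcd_root(1)[OF assms]] poly_gcd_root(2)[OF poly_gcd_root(1)[OF assms]]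
    poly_gcd_root(2)[OF assms]
  show "A w \<in> z_axis" "power_of (A w) = 0"
    using r w unfolding poly_f12[OF w] poly_f3[OF w] by (simp_all add: z_axis_def)
qed

lemma \<kappa>_off_axis:
  assumes "\<alpha> \<inter> z_axis = {}"
  shows "\<kappa> = 0" "\<kappa>' = 0"
proof -
  have no: "A w \<notin> z_axis" if "w \<noteq> 0" for w using assms that unfolding rose_curve_eq by blast
  show "\<kappa> = 0" unfolding \<kappa>_def using axis_iff no by (intro degree_0_if_no_root) blast
  show "\<kappa>' = 0" unfolding \<kappa>'_def using gcd3_root(1,2) no by (intro degree_0_if_no_root) blast
qed

context
  fixes D :: "real^2"
  assumes axis: "place b u v (cvec D) \<in> z_axis"
begin

abbreviation "D1 \<equiv> complex_of_real (D $ 1)"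
abbreviation "D2 \<equiv> complex_of_real (D $ 2)"
abbreviation "P0 \<equiv> place b u v (cvec D)"

lemma P0_nth: "P0 $ k = of_real (b $ k) + D1 * of_real (u $ k) + D2 * of_real (v $ k)"
  by (simp add: place_def cvec_def)

lemma b_eq: "b $ 1 = - (D $ 1 * u $ 1 + D $ 2 * v $ 1)" "b $ 2 = - (D $ 1 * u $ 2 + D $ 2 * v $ 2)"
proof -
  have "P0 $ 1 = 0" "P0 $ 2 = 0" using axis by (simp_all add: z_axis_def)
  then have "complex_of_real (b $ 1 + D $ 1 * u $ 1 + D $ 2 * v $ 1) = 0"
    "complex_of_real (b $ 2 + D $ 1 * u $ 2 + D $ 2 * v $ 2) = 0"
    unfolding P0_nth by simp_all
  then have "b $ 1 + D $ 1 * u $ 1 + D $ 2 * v $ 1 = 0" "b $ 2 + D $ 1 * u $ 2 + D $ 2 * v $ 2 = 0"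
    unfolding of_real_eq_0_iff by this+
  then show "b $ 1 = - (D $ 1 * u $ 1 + D $ 2 * v $ 1)" "b $ 2 = - (D $ 1 * u $ 2 + D $ 2 * v $ 2)" by linarith+
qed

abbreviation "cx \<equiv> comb (- D1) 1 0"
abbreviation "cy \<equiv> comb (- D2) 0 1"

lemma Ah_eq:
  "Ah k = smult (of_real (u $ k)) cx + smult (of_real (v $ k)) cy + smult (P0 $ k) oh"
  unfolding Ah_def P0_nth by (rule poly_eqI) (simp add: comb_def algebra_simps)

lemma P0_12: "P0 $ 1 = 0" "P0 $ 2 = 0" using axis by (simp_all add: z_axis_def)

text \<open>The plane meets the axis in \<open>P0\<close>. If its directions became dependent under
  projection to the horizontal plane, it would be vertical and contain the axis.\<close>

lemma det_nz: "u $ 1 * v $ 2 - u $ 2 * v $ 1 \<noteq> 0"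
proof
  assume det: "u $ 1 * v $ 2 - u $ 2 * v $ 1 = 0"
  have "u $ 2 = 0 \<and> - u $ 1 = 0"
    by (rule not_vertical) (use det in \<open>simp_all add: b_eq algebra_simps\<close>)
  moreover have "v $ 2 = 0 \<and> - v $ 1 = 0"
    by (rule not_vertical) (use det in \<open>simp_all add: b_eq algebra_simps\<close>)
  ultimately show False using directions_nz by simp
qed

text \<open>As \<open>P0\<close> has no horizontal part, \<open>Ah 1\<close> and \<open>Ah 2\<close>
  are combinations of the numerators of x - D1 and y - D2 with determinant \<Delta>, which Cramer's
  rule inverts.\<close>

lemma gcd_Ah_dvd: "gcd (Ah 1) (Ah 2) dvd gcd_at D1 D2" "gcd_at D1 D2 dvd gcd (Ah 1) (Ah 2)"
proof -
  let ?g = "gcd (Ah 1) (Ah 2)"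
  have Ah12: "Ah 1 = smult (of_real (u $ 1)) cx + smult (of_real (v $ 1)) cy"
    "Ah 2 = smult (of_real (u $ 2)) cx + smult (of_real (v $ 2)) cy"
    unfolding Ah_eq P0_12 by simp_all
  define \<Delta> where "\<Delta> = complex_of_real (u $ 1 * v $ 2 - u $ 2 * v $ 1)"
  have \<Delta>: "\<Delta> \<noteq> 0" unfolding \<Delta>_def using det_nz by (simp only: of_real_eq_0_iff not_False_eq_True)
  have "smult (of_real (v $ 2)) (Ah 1) - smult (of_real (v $ 1)) (Ah 2) = smult \<Delta> cx"
    "smult (of_real (u $ 1)) (Ah 2) - smult (of_real (u $ 2)) (Ah 1) = smult \<Delta> cy"
    unfolding Ah12 \<Delta>_def by (rule poly_eqI, simp add: algebra_simps)+
  moreover have "?g dvd smult (of_real (v $ 2)) (Ah 1) - smult (of_real (v $ 1)) (Ah 2)"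
    "?g dvd smult (of_real (u $ 1)) (Ah 2) - smult (of_real (u $ 2)) (Ah 1)"
    by (intro dvd_diff dvd_smult gcd_dvd1 gcd_dvd2)+
  ultimately have "?g dvd cx" "?g dvd cy" using \<Delta> by (simp_all add: dvd_smult_iff)
  then show "?g dvd gcd_at D1 D2" unfolding gcd_at_def by (rule gcd_greatest)
  show "gcd_at D1 D2 dvd ?g" unfolding Ah12
    by (intro gcd_greatest dvd_add dvd_smult) (simp_all add: gcd_at_def)
qed

lemma \<kappa>_eq: "\<kappa> = degree (gcd_at D1 D2)"
  unfolding \<kappa>_def using gcd_Ah_dvd gcd_at_nz Ah_nz by (intro degree_eq_if_dvd_dvd) auto

text \<open>A common root would be a parameter of a point of the axis, and the plane meets the axis
  in \<open>P0\<close> only.\<close>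

lemma \<kappa>'_eq_0:
  assumes "power_of P0 \<noteq> 0"
  shows "\<kappa>' = 0"
  unfolding \<kappa>'_def
proof (rule degree_0_if_no_root, rule notI)
  fix w assume "poly (gcd (gcd f1 f2) f3) w = 0"
  note w = gcd3_root[OF this]
  then have "poly (gcd (Ah 1) (Ah 2)) w = 0" using axis_iff by blast
  then have "poly (gcd_at D1 D2) w = 0" using gcd_Ah_dvd(1) by (meson poly_eq_0_iff_dvd dvd_trans)
  then have "px w = D1" "py w = D2" using gcd_at_root_iff by blast+
  then have "A w = P0" by (simp add: vec_eq_iff A_nth P0_nth)
  with w(3) assms show False by simp
qed

text \<open>With z0 the height of \<open>P0\<close> and z0^2 = q, the power of a point (X, Y, Z) is
  X^2 + Y^2 + (Z - z0)(Z + z0), and on the plane Z - z0 is a combination of x - D1 and y - D2. So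
  the gcd of the first two numerators divides the third, multiplicities included; powers of w do not
  interfere, as w = 0 is not a root of either gcd.\<close>

lemma \<kappa>'_eq_\<kappa>:
  assumes P0: "power_of P0 = 0"
  shows "\<kappa>' = \<kappa>"
proof -
  let ?g = "gcd (Ah 1) (Ah 2)" and ?h = "gcd (gcd f1 f2) f3"
  have q: "(P0 $ 3)\<^sup>2 = of_real q" using P0 P0_12 by (simp add: power_of_def)
  have "f3 * monom 1 (2 * (n + d)) = monom 1 K * (Ah 1 * Ah 1 + Ah 2 * Ah 2 +
      (Ah 3 - smult (P0 $ 3) oh) * (Ah 3 + smult (P0 $ 3) oh))"
  proof (rule poly_eqI_MOST, rule eventually_mono[OF MOST_nonzero])
    fix w :: complex assume w: "w \<noteq> 0"
    have "w ^ (2 * (n + d)) = w ^ (n + d) * w ^ (n + d)" by (simp only: mult_2 power_add)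
    then show "poly (f3 * monom 1 (2 * (n + d))) w = poly (monom 1 K * (Ah 1 * Ah 1 + Ah 2 * Ah 2 +
      (Ah 3 - smult (P0 $ 3) oh) * (Ah 3 + smult (P0 $ 3) oh))) w"
      unfolding poly_mult poly_add poly_diff poly_smult poly_monom poly_Ah[OF w] poly_f3[OF w] poly_oh
        power_of_def q[symmetric] by (simp add: power2_eq_square algebra_simps)
  qed
  moreover have "?g dvd monom 1 K * (Ah 1 * Ah 1 + Ah 2 * Ah 2 +
      (Ah 3 - smult (P0 $ 3) oh) * (Ah 3 + smult (P0 $ 3) oh))"
  proof (rule dvd_mult, intro dvd_add)
    show "?g dvd Ah 1 * Ah 1" "?g dvd Ah 2 * Ah 2" by (simp_all add: dvd_mult)
    have "?g dvd cx" "?g dvd cy" using gcd_Ah_dvd(1) unfolding gcd_at_def by (meson dvd_trans gcd_dvd1 gcd_dvd2)+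
    then have "?g dvd smult (of_real (u $ 3)) cx + smult (of_real (v $ 3)) cy" by (intro dvd_add dvd_smult)
    moreover have "Ah 3 - smult (P0 $ 3) oh = smult (of_real (u $ 3)) cx + smult (of_real (v $ 3)) cy"
      unfolding Ah_eq[of 3] by simp
    ultimately show "?g dvd (Ah 3 - smult (P0 $ 3) oh) * (Ah 3 + smult (P0 $ 3) oh)" by simp
  qed
  ultimately have "?g dvd f3 * monom 1 (2 * (n + d))" by simp
  moreover have "coprime ?g (monom 1 (2 * (n + d)))"
  proof (rule coprime_if_no_common_root)
    fix t assume "poly ?g t = 0"
    then have "t \<noteq> 0" using axis_iff by blast
    then show "poly (monom 1 (2 * (n + d))) t \<noteq> 0" by (simp add: poly_monom)
  qed
  ultimately have "?g dvd f3" by (simp only: coprime_dvd_mult_left_iff)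
  moreover have "?g dvd f1" "?g dvd f2" by (simp_all add: f1_def f2_def dvd_mult)
  ultimately have gh: "?g dvd ?h" by (intro gcd_greatest)
  have "?h dvd gcd f1 f2" by (rule gcd_dvd1)
  then have "?h dvd monom 1 (K - (n + d)) * ?g" unfolding f1_def f2_def gcd_mult_left by simp
  moreover have "coprime ?h (monom 1 (K - (n + d)))"
  proof (rule coprime_if_no_common_root)
    fix t assume "poly ?h t = 0"
    then have "t \<noteq> 0" by (rule gcd3_root(1))
    then show "poly (monom 1 (K - (n + d))) t \<noteq> 0" by (simp add: poly_monom)
  qed
  ultimately have hg: "?h dvd ?g" by (simp only: coprime_dvd_mult_right_iff)
  show ?thesis unfolding \<kappa>_def \<kappa>'_def using hg gh Ah_nz f1_nz by (intro degree_eq_if_dvd_dvd) auto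
qed

lemma power_of_axis_point: "power_of P0 = 0 \<longleftrightarrow> P0 \<in> {base_point1 p, base_point2 p}"
proof -
  have "power_of P0 = 0 \<longleftrightarrow> (P0 $ 3)\<^sup>2 = p\<^sup>2" unfolding power_of_def P0_12 p2 by simp
  also have "\<dots> \<longleftrightarrow> P0 $ 3 = p \<or> P0 $ 3 = - p" by (rule power2_eq_iff)
  also have "\<dots> \<longleftrightarrow> P0 \<in> {base_point1 p, base_point2 p}"
    using P0_12 by (simp add: base_point1_def base_point2_def vec_eq_iff forall_3)
  finally show ?thesis .
qed

end

lemma character_equations:
  "\<exists>X Y. X \<le> Y \<and> branches * X + \<kappa> = 2 * (n + d) \<and> branches * Y + \<kappa>' = 2 * K \<and>
    has_characters (circular_surface \<alpha> p) p (int X + int Y) (int X) (int Y - int X) (int Y)"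
proof -
  obtain e L m where c: "L \<le> m" "branches * (e * L) + \<kappa> = 2 * (n + d)" "branches * (e * m) + \<kappa>' = 2 * K"
    "has_characters (circular_surface \<alpha> p) p (int (e * (L + m))) (int (e * L)) (int (e * (m - L))) (int (e * m))"
    using surface_characters by blast
  have "int (e * (L + m)) = int (e * L) + int (e * m)" by (simp add: distrib_left)
  moreover have "int (e * (m - L)) = int (e * m) - int (e * L)"
    using c(1) by (simp add: of_nat_diff right_diff_distrib)
  ultimately have "has_characters (circular_surface \<alpha> p) p (int (e * L) + int (e * m)) (int (e * L))
      (int (e * m) - int (e * L)) (int (e * m))" using c(4) by (simp only:)
  moreover have "e * L \<le> e * m" using c(1) by simp
  ultimately show ?thesis using c(2,3) by blast
qed

end

section \<open>The five types\<close>

lemma base_points_on_axis: "base_point1 p \<in> z_axis" "base_point2 p \<in> z_axis"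
  by (simp_all add: base_point1_def base_point2_def z_axis_def)

text \<open>The vectors \<open>u\<close>, \<open>v\<close>, \<open>w\<close> form an orthogonal
  basis of space, and \<open>x\<close> minus its projection to the span of \<open>u\<close> and
  \<open>v\<close> is orthogonal to all three.\<close>

lemma in_span_if_orthogonal:
  fixes u v w x :: "real^3"
  assumes "norm u = 1" "norm v = 1" "u \<bullet> v = 0" "w \<noteq> 0" "w \<bullet> u = 0" "w \<bullet> v = 0" "w \<bullet> x = 0"
  shows "x = (x \<bullet> u) *\<^sub>R u + (x \<bullet> v) *\<^sub>R v"
proof -
  have uu: "u \<bullet> u = 1" "v \<bullet> v = 1" using assms(1,2) by (simp_all add: norm_eq_1)
  have ne: "u \<noteq> v" "w \<noteq> u" "w \<noteq> v" "u \<noteq> 0" "v \<noteq> 0" using assms uu by auto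
  let ?S = "{u, v, w}"
  have "pairwise orthogonal ?S"
    using assms by (auto simp: pairwise_def orthogonal_def inner_commute)
  moreover have "0 \<notin> ?S" using ne assms(4) by auto
  ultimately have "independent ?S" by (rule pairwise_orthogonal_independent)
  moreover have "card ?S = 3" using ne by auto
  ultimately have span: "UNIV \<subseteq> span ?S" by (intro card_ge_dim_independent) simp_all
  define y where "y = x - (x \<bullet> u) *\<^sub>R u - (x \<bullet> v) *\<^sub>R v"
  have "orthogonal y z" if "z \<in> ?S" for z
    using that assms uu by (auto simp: orthogonal_def y_def inner_diff_left inner_diff_right inner_commute)
  then have "orthogonal y y" using span by (intro orthogonal_to_span[of y ?S]) auto
  then have "y = 0" by (simp add: orthogonal_def)
  moreover have "x = y + ((x \<bullet> u) *\<^sub>R u + (x \<bullet> v) *\<^sub>R v)" by (simp add: y_def)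
  ultimately show ?thesis by (simp only: add_0_left)
qed

theorem theorem2:
  fixes n d :: nat and a q :: real and p :: complex and b u v :: "real^3" and S :: "4 cpoly"
  assumes "n > 0" and "d > 0" and "coprime n d" and "a \<ge> 0"
    and p: "p = csqrt (complex_of_real q)"
    and frame: "norm u = 1" "norm v = 1" "u \<bullet> v = 0"
    and plane: "\<not> (\<forall>z. \<exists>s t. (vector [0, 0, z] :: real^3) = b + s *\<^sub>R u + t *\<^sub>R v)"
    and S: "S = circular_surface (rose_curve n d a b u v) p"
  shows "
    (place b u v 0 \<in> {base_point1 p, base_point2 p} \<longrightarrow>
        (case_A n d a \<and> d < n \<longrightarrow>
          has_characters S p (int n + int d) (int d) (int n - int d) (int n)) \<and>
        (case_A n d a \<and> d > n \<longrightarrow>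
          has_characters S p (2 * int d) (int d) 0 (int d)) \<and>
        (\<not> case_A n d a \<and> d < n \<longrightarrow>
          has_characters S p (2 * (int n + int d)) (2 * int d) (2 * (int n - int d)) (2 * int n)) \<and>
        (\<not> case_A n d a \<and> d > n \<longrightarrow>
          has_characters S p (4 * int d) (2 * int d) 0 (2 * int d))) \<and>
    (place b u v 0 \<in> z_axis \<and> place b u v 0 \<notin> {base_point1 p, base_point2 p} \<longrightarrow>
        (case_A n d a \<and> d < n \<longrightarrow>
          has_characters S p (2 * int n + int d) (int d) (2 * int n - int d) (2 * int n)) \<and>
        (case_A n d a \<and> d > n \<longrightarrow>
          has_characters S p (int n + 2 * int d) (int d) (int n) (int n + int d)) \<and>
        (\<not> case_A n d a \<and> d < n \<longrightarrow>
          has_characters S p (2 * (2 * int n + int d)) (2 * int d) (2 * (2 * int n - int d)) (4 * int n)) \<and>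
        (\<not> case_A n d a \<and> d > n \<longrightarrow>
          has_characters S p (2 * (int n + 2 * int d)) (2 * int d) (2 * int n) (2 * (int n + int d)))) \<and>
    (\<forall>j D. real_fold_point n d a j D \<and> place b u v (cvec D) \<in> {base_point1 p, base_point2 p} \<longrightarrow>
        (case_A n d a \<and> d < n \<longrightarrow>
          has_characters S p (3 * int n + int d - 2 * int j) (int n + int d - int j) (int n - int d) (2 * int n - int j)) \<and>
        (case_A n d a \<and> d > n \<longrightarrow>
          has_characters S p (2 * (int n + int d) - 2 * int j) (int n + int d - int j) 0 (int n + int d - int j)) \<and>
        (\<not> case_A n d a \<and> d < n \<longrightarrow>
          has_characters S p (2 * (3 * int n + int d) - 2 * int j) (2 * (int n + int d) - int j) (2 * (int n - int d)) (4 * int n - int j)) \<and>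
        (\<not> case_A n d a \<and> d > n \<longrightarrow>
          has_characters S p (4 * (int n + int d) - 2 * int j) (2 * (int n + int d) - int j) 0 (2 * (int n + int d) - int j))) \<and>
    (\<forall>j D. real_fold_point n d a j D \<and> place b u v (cvec D) \<in> z_axis \<and>
        place b u v (cvec D) \<notin> {base_point1 p, base_point2 p} \<longrightarrow>
        (case_A n d a \<and> d < n \<longrightarrow>
          has_characters S p (3 * int n + int d - int j) (int n + int d - int j) (int n - int d + int j) (2 * int n)) \<and>
        (case_A n d a \<and> d > n \<longrightarrow>
          has_characters S p (2 * (int n + int d) - int j) (int n + int d - int j) (int j) (int n + int d)) \<and>
        (\<not> case_A n d a \<and> d < n \<longrightarrow>
          has_characters S p (2 * (3 * int n + int d) - int j) (2 * (int n + int d) - int j) (2 * (int n - int d) + int j) (4 * int n)) \<and>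
        (\<not> case_A n d a \<and> d > n \<longrightarrow>
          has_characters S p (4 * (int n + int d) - int j) (2 * (int n + int d) - int j) (int j) (2 * (int n + int d)))) \<and>
    (rose_curve n d a b u v \<inter> z_axis = {} \<longrightarrow>
        (case_A n d a \<and> d < n \<longrightarrow>
          has_characters S p (3 * int n + int d) (int n + int d) (int n - int d) (2 * int n)) \<and>
        (case_A n d a \<and> d > n \<longrightarrow>
          has_characters S p (2 * (int n + int d)) (int n + int d) 0 (int n + int d)) \<and>
        (\<not> case_A n d a \<and> d < n \<longrightarrow>
          has_characters S p (2 * (3 * int n + int d)) (2 * (int n + int d)) (2 * (int n - int d)) (4 * int n)) \<and>
        (\<not> case_A n d a \<and> d > n \<longrightarrow>
          has_characters S p (4 * (int n + int d)) (2 * (int n + int d)) 0 (2 * (int n + int d))))"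
proof (cases "d = n")
  case True
  \<comment> \<open>Every claim assumes d < n or d > n.\<close>
  then show ?thesis by simp
next
  case neq: False
  have u1: "u \<bullet> u = 1" "v \<bullet> v = 1" using frame by (simp_all add: norm_eq_1)
  interpret rose_surface n d a b u v q p
  proof unfold_locales
    show "p\<^sup>2 = complex_of_real q" unfolding p by simp
    fix x y :: real
    assume 0: "x * b $ 1 + y * b $ 2 = 0" "x * u $ 1 + y * u $ 2 = 0" "x * v $ 1 + y * v $ 2 = 0"
    show "x = 0 \<and> y = 0"
    proof (rule ccontr)
      assume xy: "\<not> (x = 0 \<and> y = 0)"
      \<comment> \<open>A horizontal vector normal to the plane and orthogonal to \<open>b\<close>;
        with it the plane would contain every point (0, 0, z).\<close>
      define w :: "real^3" where "w = vector [x, y, 0]"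
      have w: "w \<noteq> 0" using xy by (auto simp: w_def vec_eq_iff forall_3)
      have inner: "w \<bullet> s = x * s $ 1 + y * s $ 2" for s by (simp add: w_def inner_vec_def sum_3)
      have "\<exists>s t. (vector [0, 0, z] :: real^3) = b + s *\<^sub>R u + t *\<^sub>R v" for z
      proof -
        have "w \<bullet> (vector [0, 0, z] - b) = 0" unfolding inner using 0(1) by (simp add: algebra_simps)
        from in_span_if_orthogonal[OF frame w _ _ this] 0(2,3)
        obtain s t where "vector [0, 0, z] - b = s *\<^sub>R u + t *\<^sub>R v" unfolding inner by blast
        then have "vector [0, 0, z] = b + s *\<^sub>R u + t *\<^sub>R v" by (simp only: diff_eq_eq add_ac)
        then show ?thesis by blast
      qed
      then show False using plane by blast
    qed
  qed (use assms(1-3) neq u1 frame(3) in auto)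
  \<comment> \<open>The characters are X + Y, X, Y - X and Y. The types differ only in \<kappa> and
    \<kappa>', which count the parameters over the axis and over the base points.\<close>
  obtain X Y where XY: "X \<le> Y" "branches * X + \<kappa> = 2 * (n + d)" "branches * Y + \<kappa>' = 2 * K"
    and ch: "has_characters S p (int X + int Y) (int X) (int Y - int X) (int Y)"
    using character_equations unfolding S by blast
  have chI: "has_characters S p x1 x2 x3 x4"
    if "x1 = int X + int Y" "x2 = int X" "x3 = int Y - int X" "x4 = int Y" for x1 x2 x3 x4
    using ch that by simp
  have K: "d < n \<longrightarrow> int K = 2 * int n" "n < d \<longrightarrow> int K = int n + int d" by (simp_all add: K_def)
  have XA: "case_A n d a \<longrightarrow> 2 * int X + int \<kappa> = 2 * (int n + int d) \<and> 2 * int Y + int \<kappa>' = 2 * int K"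
    using XY(2,3) by (intro impI; simp add: branches_def)
  have XB: "\<not> case_A n d a \<longrightarrow> int X + int \<kappa> = 2 * (int n + int d) \<and> int Y + int \<kappa>' = 2 * int K"
    using XY(2,3) by (intro impI; simp add: branches_def)
  have cv0: "cvec (0 :: real^2) = 0" by (simp add: cvec_def vec_eq_iff)
  \<comment> \<open>The degree is 2 n in both cases: in Case A the pole is n-fold and each of its
    branches is traced twice.\<close>
  have gcd_pole: "degree (gcd_at (complex_of_real ((0 :: real^2) $ 1)) (complex_of_real ((0 :: real^2) $ 2))) = 2 * n"
    using degree_gcd_at_pole by simp
  have gcd_D: "degree (gcd_at (complex_of_real (D $ 1)) (complex_of_real (D $ 2))) = branches * j" if "real_fold_point n d a j D" for D j
  proof -
    have "cvec D = vector [complex_of_real (D $ 1), complex_of_real (D $ 2)]" by (simp add: cvec_def vec_eq_iff forall_2)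
    then show ?thesis using that CH_poly_props(2)[of "complex_of_real (D $ 1)" "complex_of_real (D $ 2)"] unfolding real_fold_point_def by simp
  qed
  have base: "place b u v (cvec D) \<in> z_axis \<and> \<kappa> = degree (gcd_at (complex_of_real (D $ 1)) (complex_of_real (D $ 2))) \<and> \<kappa>' = \<kappa>"
    if "place b u v (cvec D) \<in> {base_point1 p, base_point2 p}" for D
  proof -
    have z: "place b u v (cvec D) \<in> z_axis" using that base_points_on_axis by auto
    show ?thesis using z \<kappa>_eq[OF z] \<kappa>'_eq_\<kappa>[OF z] power_of_axis_point[OF z] that by simp
  qed
  have off_base: "\<kappa> = degree (gcd_at (complex_of_real (D $ 1)) (complex_of_real (D $ 2))) \<and> \<kappa>' = 0"
    if "place b u v (cvec D) \<in> z_axis" "place b u v (cvec D) \<notin> {base_point1 p, base_point2 p}" for D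
    using \<kappa>_eq[OF that(1)] \<kappa>'_eq_0[OF that(1)] power_of_axis_point[OF that(1)] that(2) by simp
  have type1: "int \<kappa> = 2 * int n \<and> int \<kappa>' = int \<kappa>" if "place b u v 0 \<in> {base_point1 p, base_point2 p}"
    using base[of 0] that unfolding cv0 gcd_pole by simp
  have type2: "int \<kappa> = 2 * int n \<and> int \<kappa>' = 0"
    if "place b u v 0 \<in> z_axis \<and> place b u v 0 \<notin> {base_point1 p, base_point2 p}"
    using off_base[of 0] that unfolding cv0 gcd_pole by simp
  have type3: "(case_A n d a \<longrightarrow> int \<kappa> = 2 * int j) \<and> (\<not> case_A n d a \<longrightarrow> int \<kappa> = int j) \<and> int \<kappa>' = int \<kappa>"
    if "real_fold_point n d a j D \<and> place b u v (cvec D) \<in> {base_point1 p, base_point2 p}" for j D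
    using base[of D] gcd_D[of j D] that by (simp add: branches_def)
  have type4: "(case_A n d a \<longrightarrow> int \<kappa> = 2 * int j) \<and> (\<not> case_A n d a \<longrightarrow> int \<kappa> = int j) \<and> int \<kappa>' = 0"
    if "real_fold_point n d a j D \<and> place b u v (cvec D) \<in> z_axis \<and>
      place b u v (cvec D) \<notin> {base_point1 p, base_point2 p}" for j D
    using off_base[of D] gcd_D[of j D] that by (simp add: branches_def)
  have type5: "int \<kappa> = 0 \<and> int \<kappa>' = 0" if "rose_curve n d a b u v \<inter> z_axis = {}"
    using \<kappa>_off_axis[OF that] by simp
  show ?thesis
    apply (intro conjI; (intro allI)?; rule impI)
    subgoal premises t
      using type1[OF t] XA XB K by (intro conjI impI chI; smt (verit))
    subgoal premises t
      using type2[OF t] XA XB K by (intro conjI impI chI; smt (verit))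
    subgoal premises t for j D
      using type3[OF t] XA XB K by (intro conjI impI chI; smt (verit))
    subgoal premises t for j D
      using type4[OF t] XA XB K by (intro conjI impI chI; smt (verit))
    subgoal premises t
      using type5[OF t] XA XB K by (intro conjI impI chI; smt (verit))
    done
qed

end
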